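(* Let $k$ be a field of characteristic $\ne 2$ and $a,d \in k$ with $a \neq 0$, $d\ne 0$, $d \ne a$. Fix a square root $\sqrt a$ of $a$. The rational map $\psi_{a,d}: E_{a,d} \to L_{d/a}$, $$(x,y)\mapsto\left(\frac{1}{ax^2}, \frac{y(d-a)}{a^{3/2}x(1-y^2)}\right),$$ is a $2$-isogeny, with dual $\widehat{\psi}_{a,d}: L_{d/a}\to E_{a,d}$ given by $$(x,y)\mapsto\left(\frac{2\sqrt{a}\,y}{d-ax^2}, \frac{ay^2 - x^2(a-d)}{ay^2+x^2(a-d)}\right).$$
   Context: $E_{a,d}$ denotes the twisted Edwards curve, the elliptic curve obtained as the desingularization of the projective closure of $ax^2+y^2 = 1+dx^2y^2$; for $\lambda \in k\setminus\{0,1\}$, $L_\lambda$ denotes the Legendre elliptic curve $y^2=x(x-1)(x-\lambda)$. Here $a^{3/2} = a\sqrt a$. *)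

theory Defs
  imports "HOL-Analysis.Cartesian_Space" "HOL-Algebra.Algebraic_Closure_Type"
begin

no_notation fps_nth (infixl \<open>$\<close> 75)

section \<open>Projective varieties over an algebraically closed field\<close>

text \<open>
  Varieties are sets of geometric points. A point of projective space is a set of vectors, namely
  all nonzero multiples of one nonzero vector. The parameter \<open>F\<close> below is the subfield over
  which polynomials are defined.
\<close>

definition proj_point :: "'k::field^'n \<Rightarrow> ('k^'n) set"
  where "proj_point v = {c *s v | c. c \<noteq> 0}"

text \<open>
  Forms of degree \<open>e\<close> with coefficients in \<open>F\<close>, as functions; over an infinite field they may be
  identified with polynomials.
\<close>

inductive form :: "'k::field set \<Rightarrow> nat \<Rightarrow> ('k^'n \<Rightarrow> 'k) \<Rightarrow> bool" for F
  where
    const: "c \<in> F \<Longrightarrow> form F 0 (\<lambda>_. c)"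
  | coord: "form F 1 (\<lambda>v. v $ i)"
  | add: "form F e f \<Longrightarrow> form F e g \<Longrightarrow> form F e (\<lambda>v. f v + g v)"
  | mult: "form F e f \<Longrightarrow> form F e' g \<Longrightarrow> form F (e + e') (\<lambda>v. f v * g v)"

definition zariski_closure :: "('k::field^'n) set set \<Rightarrow> ('k^'n) set set"
  where "zariski_closure A =
    {proj_point w | w. w \<noteq> 0 \<and> (\<forall>e f. form UNIV e f \<longrightarrow> (\<forall>P\<in>A. \<forall>v\<in>P. f v = 0) \<longrightarrow> f w = 0)}"

definition regular_map ::
  "'k::field set \<Rightarrow> ('k^'m) set set \<Rightarrow> ('k^'n) set set \<Rightarrow> (('k^'m) set \<Rightarrow> ('k^'n) set) \<Rightarrow> bool"
  where "regular_map F C D \<phi> \<longleftrightarrow>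
    \<phi> ` C \<subseteq> D \<and>
    (\<forall>P\<in>C. \<exists>e G. (\<forall>i. form F e (\<lambda>v. G v $ i)) \<and> (\<forall>v\<in>P. G v \<noteq> 0) \<and>
      (\<forall>Q\<in>C. \<forall>v\<in>Q. G v \<noteq> 0 \<longrightarrow> \<phi> Q = proj_point (G v)))"


section \<open>Function fields and degrees\<close>

text \<open>
  A rational function on an irreducible curve is represented by a function on all points whose
  values at the finitely many zeros of the chosen denominator are arbitrary. Two such functions
  are equal as elements of the function field iff they agree at almost all points.
\<close>

definition rational_function ::
  "'k::field set \<Rightarrow> ('k^'n) set set \<Rightarrow> (('k^'n) set \<Rightarrow> 'k) \<Rightarrow> bool"
  where "rational_function F C g \<longleftrightarrow>
    (\<exists>e N D. form F e N \<and> form F e D \<and> finite {P \<in> C. \<exists>v\<in>P. D v = 0} \<and>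
      (\<forall>P\<in>C. \<forall>v\<in>P. D v \<noteq> 0 \<longrightarrow> g P = N v / D v))"

definition same_rational_function :: "'p set \<Rightarrow> ('p \<Rightarrow> 'k) \<Rightarrow> ('p \<Rightarrow> 'k) \<Rightarrow> bool"
  where "same_rational_function C f g \<longleftrightarrow> finite {P \<in> C. f P \<noteq> g P}"

text \<open>
  \<open>[F(C) : \<phi>\<^sup>* F(D)] = n\<close>: there is a basis \<open>b 0, \<dots>, b (n - 1)\<close> of \<open>F(C)\<close> over \<open>\<phi>\<^sup>* F(D)\<close>. Only
  meaningful for nonconstant \<open>\<phi>\<close>.
\<close>

definition map_degree ::
  "'k::field set \<Rightarrow> ('k^'m) set set \<Rightarrow> ('k^'n) set set \<Rightarrow> (('k^'m) set \<Rightarrow> ('k^'n) set) \<Rightarrow> nat \<Rightarrow> bool"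
  where "map_degree F C D \<phi> n \<longleftrightarrow>
    (\<exists>b. (\<forall>i<n. rational_function F C (b i)) \<and>
      (\<forall>g. rational_function F C g \<longrightarrow>
        (\<exists>h. (\<forall>i<n. rational_function F D (h i)) \<and>
          same_rational_function C g (\<lambda>P. \<Sum>i<n. h i (\<phi> P) * b i P))) \<and>
      (\<forall>h. (\<forall>i<n. rational_function F D (h i)) \<longrightarrow>
        same_rational_function C (\<lambda>P. \<Sum>i<n. h i (\<phi> P) * b i P) (\<lambda>_. 0) \<longrightarrow>
        (\<forall>i<n. same_rational_function D (h i) (\<lambda>_. 0))))"


section \<open>Elliptic curves and isogenies\<close>

record ('k, 'n) elliptic_curve =
  points :: "('k^'n) set set"
  origin :: "('k^'n) set"
  plus :: "('k^'n) set \<Rightarrow> ('k^'n) set \<Rightarrow> ('k^'n) set"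

definition multiple :: "('k, 'n) elliptic_curve \<Rightarrow> nat \<Rightarrow> ('k^'n) set \<Rightarrow> ('k^'n) set"
  where "multiple E m P = (plus E P ^^ m) (origin E)"

text \<open>
  As usual an isogeny is a nonconstant morphism preserving the origin; being a group homomorphism
  is a consequence.
\<close>

definition isogeny ::
  "'k::field set \<Rightarrow> ('k, 'm) elliptic_curve \<Rightarrow> ('k, 'n) elliptic_curve \<Rightarrow>
    (('k^'m) set \<Rightarrow> ('k^'n) set) \<Rightarrow> bool"
  where "isogeny F E E' \<phi> \<longleftrightarrow>
    regular_map F (points E) (points E') \<phi> \<and> \<phi> (origin E) = origin E' \<and>
    (\<exists>P\<in>points E. \<phi> P \<noteq> origin E')"

definition isogeny_of_degree ::
  "'k::field set \<Rightarrow> ('k, 'm) elliptic_curve \<Rightarrow> ('k, 'n) elliptic_curve \<Rightarrow>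
    (('k^'m) set \<Rightarrow> ('k^'n) set) \<Rightarrow> nat \<Rightarrow> bool"
  where "isogeny_of_degree F E E' \<phi> n \<longleftrightarrow>
    isogeny F E E' \<phi> \<and> map_degree F (points E) (points E') \<phi> n"

definition dual_isogeny ::
  "'k::field set \<Rightarrow> ('k, 'm) elliptic_curve \<Rightarrow> ('k, 'n) elliptic_curve \<Rightarrow>
    (('k^'m) set \<Rightarrow> ('k^'n) set) \<Rightarrow> (('k^'n) set \<Rightarrow> ('k^'m) set) \<Rightarrow> bool"
  where "dual_isogeny F E E' \<phi> \<phi>' \<longleftrightarrow>
    isogeny F E' E \<phi>' \<and>
    (\<exists>n. isogeny_of_degree F E E' \<phi> n \<and>
      (\<forall>P\<in>points E. \<phi>' (\<phi> P) = multiple E n P) \<and>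
      (\<forall>Q\<in>points E'. \<phi> (\<phi>' Q) = multiple E' n Q))"


section \<open>Legendre curves\<close>

definition legendre_point :: "'k::field \<Rightarrow> 'k \<Rightarrow> ('k^3) set"
  where "legendre_point x y = proj_point (vector [x, y, 1])"

definition legendre_origin :: "('k::field^3) set"
  where "legendre_origin = proj_point (vector [0, 1, 0])"

definition legendre_coords :: "('k::field^3) set \<Rightarrow> 'k \<times> 'k"
  where "legendre_coords P = (THE (x, y). P = legendre_point x y)"

text \<open>The chord-and-tangent law on \<open>y\<^sup>2 = x\<^sup>3 - (1 + l) x\<^sup>2 + l x\<close>.\<close>

definition legendre_plus :: "'k::field \<Rightarrow> ('k^3) set \<Rightarrow> ('k^3) set \<Rightarrow> ('k^3) set"
  where "legendre_plus l P Q =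
    (if P = legendre_origin then Q
     else if Q = legendre_origin then P
     else
       let (x1, y1) = legendre_coords P; (x2, y2) = legendre_coords Q in
       if x1 = x2 \<and> y1 = - y2 then legendre_origin
       else
         let s = (if x1 = x2 then (3 * x1^2 - 2 * (1 + l) * x1 + l) / (2 * y1)
                  else (y2 - y1) / (x2 - x1));
             x3 = s^2 + (1 + l) - x1 - x2
         in legendre_point x3 (s * (x1 - x3) - y1))"

definition legendre_curve :: "'k::field \<Rightarrow> ('k, 3) elliptic_curve"
  where "legendre_curve l =
    \<lparr>points = {proj_point v | v. v \<noteq> 0 \<and> (v$2)^2 * v$3 = v$1 * (v$1 - v$3) * (v$1 - l * v$3)},
     origin = legendre_origin,
     plus = legendre_plus l\<rparr>"


section \<open>Twisted Edwards curves\<close>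

text \<open>
  The plane projective closure of \<open>a x\<^sup>2 + y\<^sup>2 = 1 + d x\<^sup>2 y\<^sup>2\<close> is singular at \<open>(1:0:0)\<close> and
  \<open>(0:1:0)\<close>. Its desingularization is the intersection of the quadrics
  \<open>a X\<^sup>2 + Y\<^sup>2 = Z\<^sup>2 + d T\<^sup>2\<close> and \<open>X Y = Z T\<close> in projective 3-space, with the projection
  \<open>(X:Y:Z:T) \<mapsto> (X:Y:Z)\<close>; this is proved in \<open>edwards_desingularization\<close> below.
\<close>

definition edwards_points :: "'k::field \<Rightarrow> 'k \<Rightarrow> ('k^4) set set"
  where "edwards_points a d =
    {proj_point v | v. v \<noteq> 0 \<and> a * (v$1)^2 + (v$2)^2 = (v$3)^2 + d * (v$4)^2 \<and>
      v$1 * v$2 = v$3 * v$4}"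

definition edwards_point :: "'k::field \<Rightarrow> 'k \<Rightarrow> ('k^4) set"
  where "edwards_point x y = proj_point (vector [x, y, 1, x * y])"

text \<open>
  The Edwards addition law
  \<open>x\<^sub>3 = (x\<^sub>1 y\<^sub>2 + y\<^sub>1 x\<^sub>2) / (1 + d x\<^sub>1 x\<^sub>2 y\<^sub>1 y\<^sub>2)\<close>, \<open>y\<^sub>3 = (y\<^sub>1 y\<^sub>2 - a x\<^sub>1 x\<^sub>2) / (1 - d x\<^sub>1 x\<^sub>2 y\<^sub>1 y\<^sub>2)\<close>
  and its dual form
  \<open>x\<^sub>3 = (x\<^sub>1 y\<^sub>1 + x\<^sub>2 y\<^sub>2) / (y\<^sub>1 y\<^sub>2 + a x\<^sub>1 x\<^sub>2)\<close>, \<open>y\<^sub>3 = (x\<^sub>1 y\<^sub>1 - x\<^sub>2 y\<^sub>2) / (x\<^sub>1 y\<^sub>2 - y\<^sub>1 x\<^sub>2)\<close>,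
  in homogeneous coordinates with \<open>T / Z = x y\<close>. For every pair of points at least one of the two
  gives a nonzero vector, and where both do, they agree (Bernstein and Lange, A complete set of
  addition laws for incomplete Edwards curves).
\<close>

definition edwards_sum1 :: "'k::field \<Rightarrow> 'k \<Rightarrow> 'k^4 \<Rightarrow> 'k^4 \<Rightarrow> 'k^4"
  where "edwards_sum1 a d v w =
    (let A = v$1 * w$2 + v$2 * w$1;
         B = v$2 * w$2 - a * v$1 * w$1;
         C = v$3 * w$3 + d * v$4 * w$4;
         D = v$3 * w$3 - d * v$4 * w$4
     in vector [A * D, B * C, C * D, A * B])"

definition edwards_sum2 :: "'k::field \<Rightarrow> 'k^4 \<Rightarrow> 'k^4 \<Rightarrow> 'k^4"
  where "edwards_sum2 a v w =
    (let A = v$4 * w$3 + v$3 * w$4;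
         B = v$4 * w$3 - v$3 * w$4;
         C = v$2 * w$2 + a * v$1 * w$1;
         D = v$1 * w$2 - v$2 * w$1
     in vector [A * D, B * C, C * D, A * B])"

definition edwards_plus :: "'k::field \<Rightarrow> 'k \<Rightarrow> ('k^4) set \<Rightarrow> ('k^4) set \<Rightarrow> ('k^4) set"
  where "edwards_plus a d P Q =
    (let v = (SOME v. v \<in> P); w = (SOME w. w \<in> Q) in
     if edwards_sum1 a d v w \<noteq> 0 then proj_point (edwards_sum1 a d v w)
     else proj_point (edwards_sum2 a v w))"

definition edwards_curve :: "'k::field \<Rightarrow> 'k \<Rightarrow> ('k, 4) elliptic_curve"
  where "edwards_curve a d =
    \<lparr>points = edwards_points a d,
     origin = edwards_point 0 1,
     plus = edwards_plus a d\<rparr>"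

text \<open>The subfield \<open>k(r)\<close> of the algebraic closure of \<open>k\<close>, for \<open>r\<^sup>2 \<in> k\<close>.\<close>

definition adjoin_sqrt :: "'k::field alg_closure \<Rightarrow> 'k alg_closure set"
  where "adjoin_sqrt r = {to_ac u + to_ac v * r | u v. True}"


section \<open>The twisted Edwards curve as a desingularization\<close>

text \<open>
  A closed set \<open>C\<close> is an irreducible curve iff it is infinite and a form that vanishes at infinitely
  many of its points vanishes on all of it.
\<close>

definition irreducible_curve :: "('k::field^'n) set set \<Rightarrow> bool"
  where "irreducible_curve C \<longleftrightarrow>
    zariski_closure C = C \<and> infinite C \<and>
    (\<forall>e f. form UNIV e f \<longrightarrow> infinite {P \<in> C. \<forall>v\<in>P. f v = 0} \<longrightarrow> (\<forall>P\<in>C. \<forall>v\<in>P. f v = 0))"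

text \<open>
  Nonsingularity of a curve at \<open>P\<close>: the maximal ideal of the local ring at \<open>P\<close> is generated by one
  element \<open>S / T\<close>.
\<close>

definition nonsingular_at :: "('k::field^'n) set set \<Rightarrow> ('k^'n) set \<Rightarrow> bool"
  where "nonsingular_at C P \<longleftrightarrow>
    (\<exists>m S T. form UNIV m S \<and> form UNIV m T \<and> (\<forall>v\<in>P. S v = 0 \<and> T v \<noteq> 0) \<and>
      (\<forall>e N D. form UNIV e N \<longrightarrow> form UNIV e D \<longrightarrow> (\<forall>v\<in>P. N v = 0 \<and> D v \<noteq> 0) \<longrightarrow>
        (\<exists>l A B. form UNIV l A \<and> form UNIV l B \<and> (\<forall>v\<in>P. B v \<noteq> 0) \<and>
          (\<forall>Q\<in>C. \<forall>v\<in>Q. T v \<noteq> 0 \<longrightarrow> D v \<noteq> 0 \<longrightarrow> B v \<noteq> 0 \<longrightarrow>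
            N v / D v = (S v / T v) * (A v / B v)))))"

definition desingularization ::
  "('k::field^'m) set set \<Rightarrow> ('k^'n) set set \<Rightarrow> (('k^'n) set \<Rightarrow> ('k^'m) set) \<Rightarrow> bool"
  where "desingularization V C \<pi> \<longleftrightarrow>
    irreducible_curve C \<and> (\<forall>P\<in>C. nonsingular_at C P) \<and>
    regular_map UNIV C V \<pi> \<and> \<pi> ` C = V \<and>
    (\<exists>S \<rho>. finite S \<and> finite {P \<in> C. \<pi> P \<in> S} \<and> regular_map UNIV (V - S) C \<rho> \<and>
      (\<forall>P\<in>C. \<pi> P \<notin> S \<longrightarrow> \<rho> (\<pi> P) = P) \<and> (\<forall>Q\<in>(V - S). \<pi> (\<rho> Q) = Q))"

definition edwards_plane_closure :: "'k::field \<Rightarrow> 'k \<Rightarrow> ('k^3) set set"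
  where "edwards_plane_closure a d =
    zariski_closure {proj_point (vector [x, y, 1]) | x y. a * x^2 + y^2 = 1 + d * x^2 * y^2}"

definition edwards_projection :: "('k::field^4) set \<Rightarrow> ('k^3) set"
  where "edwards_projection P =
    (let v = (SOME v. v \<in> P) in proj_point (vector [v$1, v$2, v$3]))"

lemma vector_4 [simp]:
  "(vector [x,y,z,t] :: ('a::zero)^4)$1 = x"
  "(vector [x,y,z,t] :: ('a::zero)^4)$2 = y"
  "(vector [x,y,z,t] :: ('a::zero)^4)$3 = z"
  "(vector [x,y,z,t] :: ('a::zero)^4)$4 = t"
  unfolding vector_def by simp_all

lemma proj_point_self [simp]: "v \<in> proj_point v"
  by (auto simp: proj_point_def intro!: exI[of _ 1])

lemma proj_point_scale: "c \<noteq> 0 \<Longrightarrow> proj_point (c *s v) = proj_point v"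
proof -
  assume c: "c \<noteq> 0"
  have "\<exists>y. x *s v = y *s (c *s v) \<and> y \<noteq> 0" if "x \<noteq> 0" for x
    by (rule exI[of _ "x / c"]) (use c that in \<open>simp add: vector_smult_assoc\<close>)
  moreover have "\<exists>y. x *s (c *s v) = y *s v \<and> y \<noteq> 0" if "x \<noteq> 0" for x
    by (rule exI[of _ "x * c"]) (use c that in \<open>simp add: vector_smult_assoc\<close>)
  ultimately show ?thesis unfolding proj_point_def by blast
qed

lemma mem_proj_point: "w \<in> proj_point v \<Longrightarrow> \<exists>c. c \<noteq> 0 \<and> w = c *s v"
  by (auto simp: proj_point_def)

lemma proj_point_mem_eq: "w \<in> proj_point v \<Longrightarrow> proj_point w = proj_point v"
  using mem_proj_point proj_point_scale by metis

lemma form_scale: "form F e f \<Longrightarrow> f (c *s v) = c ^ e * f v"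
  by (induction rule: form.induct) (auto simp: algebra_simps power_add)

lemma form_zero_iff: "form F e f \<Longrightarrow> w \<in> proj_point v \<Longrightarrow> f w = 0 \<longleftrightarrow> f v = 0"
  using mem_proj_point form_scale by fastforce

lemma form_ball_iff: "form F e f \<Longrightarrow> (\<forall>w\<in>proj_point v. f w = 0) \<longleftrightarrow> f v = 0"
  using form_zero_iff proj_point_self by metis

lemma form_coord: "form UNIV (Suc 0) (\<lambda>v. v $ i)" using form.coord[of UNIV i] by simp
lemma form_cmult: "form UNIV e f \<Longrightarrow> form UNIV e (\<lambda>v. c * f v)"
  using form.mult[OF form.const[of c UNIV]] by fastforce
lemma form_diff: assumes "form UNIV e f" "form UNIV e g" shows "form UNIV e (\<lambda>v. f v - g v)"
  using form.add[OF assms(1) form_cmult[OF assms(2), of "-1"]] by simp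
lemma form_zero: "form UNIV e (\<lambda>v::'k::field^'n. 0)"
proof (induction e)
  case 0 show ?case by (rule form.const) simp
next
  case (Suc e)
  have "form UNIV (e + 1) (\<lambda>v::'k::field^'n. 0 * v $ undefined)" by (rule form.mult[OF Suc form.coord])
  then show ?case by simp
qed
lemma form_power: "form UNIV e f \<Longrightarrow> form UNIV (n * e) (\<lambda>v. f v ^ n)"
proof (induction n)
  case 0 show ?case using form.const[of 1 UNIV] by simp
next
  case (Suc n) then show ?case using form.mult[of UNIV e f "n*e" "\<lambda>v. f v ^ n"] by simp
qed
lemma form_mult': "form UNIV e f \<Longrightarrow> form UNIV e' g \<Longrightarrow> e + e' = n \<Longrightarrow> form UNIV n (\<lambda>v. f v * g v)"
  using form.mult by blast

lemma form_power': "form UNIV e f \<Longrightarrow> n * e = m \<Longrightarrow> form UNIV m (\<lambda>v. f v ^ n)"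
  using form_power by blast

text \<open>Forms restricted to the curve \<open>w\<^sup>2 q(u) = p(u)\<close>.\<close>

lemma form_on_conic:
  fixes m :: "'k::field \<Rightarrow> 'k \<Rightarrow> 'k^'n"
  assumes "form F e f" "\<And>i. \<exists>A B. \<forall>u w. m u w $ i = poly A u + poly B u * w"
  shows "\<exists>N A B. \<forall>u w. w^2 * poly q u = poly p u \<longrightarrow>
    f (m u w) * poly q u ^ N = poly A u + poly B u * w"
  using assms(1)
proof (induction rule: form.induct)
  case (const c)
  show ?case by (rule exI[of _ 0], rule exI[of _ "[:c:]"], rule exI[of _ 0]) simp
next
  case (coord i)
  obtain A B where "\<forall>u w. m u w $ i = poly A u + poly B u * w" using assms(2) by blast
  then show ?case by (intro exI[of _ 0] exI[of _ A] exI[of _ B]) simp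
next
  case (add e f g)
  obtain N A B where 1: "\<And>u w. w^2 * poly q u = poly p u \<Longrightarrow>
    f (m u w) * poly q u ^ N = poly A u + poly B u * w" using add.IH(1) by blast
  obtain N' A' B' where 2: "\<And>u w. w^2 * poly q u = poly p u \<Longrightarrow>
    g (m u w) * poly q u ^ N' = poly A' u + poly B' u * w" using add.IH(2) by blast
  have "(f (m u w) + g (m u w)) * poly q u ^ (N + N') =
      poly (A * q^N' + A' * q^N) u + poly (B * q^N' + B' * q^N) u * w"
    if "w^2 * poly q u = poly p u" for u w
  proof -
    have "(f (m u w) + g (m u w)) * poly q u ^ (N + N') =
      (f (m u w) * poly q u ^ N) * poly q u ^ N' + (g (m u w) * poly q u ^ N') * poly q u ^ N"
      by (simp add: algebra_simps power_add)
    then show ?thesis unfolding 1[OF that] 2[OF that] by (simp add: algebra_simps poly_power)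
  qed
  then show ?case
    by (intro exI[of _ "N + N'"] exI[of _ "A * q^N' + A' * q^N"] exI[of _ "B * q^N' + B' * q^N"]) blast
next
  case (mult e f e' g)
  obtain N A B where 1: "\<And>u w. w^2 * poly q u = poly p u \<Longrightarrow>
    f (m u w) * poly q u ^ N = poly A u + poly B u * w" using mult.IH(1) by blast
  obtain N' A' B' where 2: "\<And>u w. w^2 * poly q u = poly p u \<Longrightarrow>
    g (m u w) * poly q u ^ N' = poly A' u + poly B' u * w" using mult.IH(2) by blast
  have "(f (m u w) * g (m u w)) * poly q u ^ (N + N' + 1) =
      poly (A * A' * q + B * B' * p) u + poly ((A * B' + A' * B) * q) u * w"
    if "w^2 * poly q u = poly p u" for u w
  proof -
    have "(f (m u w) * g (m u w)) * poly q u ^ (N + N' + 1) =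
      (f (m u w) * poly q u ^ N) * (g (m u w) * poly q u ^ N') * poly q u"
      by (simp add: algebra_simps power_add)
    also have "\<dots> = (poly A u + poly B u * w) * (poly A' u + poly B' u * w) * poly q u"
      unfolding 1[OF that] 2[OF that] ..
    also have "\<dots> = poly A u * poly A' u * poly q u + poly B u * poly B' u * (w^2 * poly q u)
       + (poly A u * poly B' u + poly A' u * poly B u) * poly q u * w"
      by (simp add: algebra_simps power2_eq_square)
    finally show ?thesis unfolding that by simp
  qed
  then show ?case
    by (intro exI[of _ "N + N' + 1"] exI[of _ "A * A' * q + B * B' * p"]
        exI[of _ "(A * B' + A' * B) * q"]) blast
qed

lemma conic_zeros:
  fixes p q :: "'k::field poly"
  assumes p: "p = [:-\<alpha>, 1:] * r" and r: "poly r \<alpha> \<noteq> 0" and q: "poly q \<alpha> \<noteq> 0"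
    and cop: "\<And>u. \<not> (poly p u = 0 \<and> poly q u = 0)"
    and inf: "infinite {(u, w). w^2 * poly q u = poly p u \<and> poly A u + poly B u * w = 0}"
  shows "A = 0 \<and> B = 0"
proof -
  define S where "S = {(u, w). w^2 * poly q u = poly p u \<and> poly A u + poly B u * w = 0}"
  have sq: "finite {w::'k. w^2 * c = b}" if "\<not> (b = 0 \<and> c = 0)" for b c
  proof (cases "c = 0")
    case True then show ?thesis using that by auto
  next
    case False
    have "{w. w^2 * c = b} = {w. poly [:-b, 0, c:] w = 0}"
      by (auto simp: algebra_simps power2_eq_square)
    then show ?thesis using False poly_roots_finite[of "[:-b, 0, c:]"] by simp
  qed
  have "S \<subseteq> (SIGMA u:fst ` S. {w. w^2 * poly q u = poly p u})"
    unfolding S_def by (auto simp: image_iff)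
  moreover have "finite {w. w^2 * poly q u = poly p u}" for u using sq cop by blast
  ultimately have "infinite (fst ` S)" using inf unfolding S_def[symmetric]
    using finite_SigmaI infinite_super by meson
  moreover have "fst ` S \<subseteq> {u. poly (A^2 * q - B^2 * p) u = 0}"
  proof (clarsimp simp: S_def)
    fix u w assume 1: "w^2 * poly q u = poly p u" and "poly A u + poly B u * w = 0"
    then have "poly A u = - (poly B u * w)" by (simp add: eq_neg_iff_add_eq_0)
    then show "(poly A u)^2 * poly q u = (poly B u)^2 * poly p u"
      unfolding 1[symmetric] by (simp add: algebra_simps power2_eq_square)
  qed
  ultimately have "infinite {u. poly (A^2 * q - B^2 * p) u = 0}" using infinite_super by blast
  then have "A^2 * q - B^2 * p = 0" using poly_roots_finite by blast
  then have eq: "A^2 * q = B^2 * p" by simp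
  have "q \<noteq> 0" "r \<noteq> 0" using q r by auto
  moreover have "[:-\<alpha>, 1:] \<noteq> 0" by simp
  ultimately have nz: "p \<noteq> 0" "q \<noteq> 0" "r \<noteq> 0" unfolding p using mult_eq_0_iff by blast+
  show ?thesis
  proof (rule ccontr)
    assume "\<not> ?thesis"
    then have AB: "A \<noteq> 0" "B \<noteq> 0" using eq nz by auto
    have "order \<alpha> (A^2 * q) = 2 * order \<alpha> A + 0"
      using AB nz q order_0I[of q \<alpha>] by (simp add: order_mult power2_eq_square)
    moreover have "order \<alpha> p = 1"
      using order_mult[OF nz(1)[unfolded p], of \<alpha>] order_power_n_n[of \<alpha> 1] order_0I[OF r]
      unfolding p by simp
    then have "order \<alpha> (B^2 * p) = 2 * order \<alpha> B + 1"
      using AB nz by (simp add: order_mult power2_eq_square)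
    ultimately have "2 * order \<alpha> A + 0 = 2 * order \<alpha> B + 1" unfolding eq by metis
    then show False by presburger
  qed
qed

lemma form_vanishes_on_conic:
  fixes m :: "'k::field \<Rightarrow> 'k \<Rightarrow> 'k^'n"
  assumes "form F e f" "\<And>i. \<exists>A B. \<forall>u w. m u w $ i = poly A u + poly B u * w"
    and p: "p = [:-\<alpha>, 1:] * r" and r: "poly r \<alpha> \<noteq> 0" and q: "poly q \<alpha> \<noteq> 0"
    and cop: "\<And>u. \<not> (poly p u = 0 \<and> poly q u = 0)"
    and inf: "infinite {(u, w). w^2 * poly q u = poly p u \<and> f (m u w) = 0}"
    and uw: "w^2 * poly q u = poly p u"
  shows "f (m u w) = 0"
proof -
  obtain N A B where 1: "\<And>u w. w^2 * poly q u = poly p u \<Longrightarrow>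
    f (m u w) * poly q u ^ N = poly A u + poly B u * w"
    using form_on_conic[OF assms(1,2), of q p] by blast
  have "{(u, w). w^2 * poly q u = poly p u \<and> f (m u w) = 0} \<subseteq>
    {(u, w). w^2 * poly q u = poly p u \<and> poly A u + poly B u * w = 0}"
    using 1 by force
  then have "infinite {(u, w). w^2 * poly q u = poly p u \<and> poly A u + poly B u * w = 0}"
    using inf infinite_super by blast
  from conic_zeros[OF p r q cop this] have "A = 0 \<and> B = 0" .
  then have "f (m u w) * poly q u ^ N = 0" using 1[OF uw] by simp
  moreover have "poly q u \<noteq> 0" using cop uw by force
  ultimately show ?thesis by simp
qed

lemma infinite_alg_closed: "infinite (UNIV :: 'k::alg_closed_field set)"
proof
  assume fin: "finite (UNIV :: 'k set)"
  define P where "P = (\<Prod>x\<in>(UNIV::'k set). [:-x, 1:]) + 1"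
  have "degree (\<Prod>x\<in>(UNIV::'k set). [:-x, 1:]) = card (UNIV :: 'k set)"
    by (subst degree_prod_eq_sum_degree) auto
  moreover have "card (UNIV :: 'k set) > 0" using fin by (simp add: finite_UNIV_card_ge_0)
  ultimately have "degree P > 0" unfolding P_def
    by (subst degree_add_eq_left) auto
  then obtain x where "poly P x = 0" using alg_closed_imp_poly_has_root by blast
  moreover have "poly P x = 1" unfolding P_def using fin by (auto simp: poly_prod)
  ultimately show False by simp
qed

lemma vec4_eq: "(v::'a^4) = w \<longleftrightarrow> v$1 = w$1 \<and> v$2 = w$2 \<and> v$3 = w$3 \<and> v$4 = w$4"
  by (simp add: vec_eq_iff forall_4)

lemma vec3_eq: "(v::'a^3) = w \<longleftrightarrow> v$1 = w$1 \<and> v$2 = w$2 \<and> v$3 = w$3"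
  by (simp add: vec_eq_iff forall_3)

lemma eq4: "(1::4) \<noteq> 2" "(1::4) \<noteq> 3" "(1::4) \<noteq> 4" "(2::4) \<noteq> 3" "(2::4) \<noteq> 4" "(3::4) \<noteq> 4"
  by simp_all

context
  fixes a d :: "'k::alg_closed_field"
  assumes nz: "(2::'k) \<noteq> 0" "a \<noteq> 0" "d \<noteq> 0" "a \<noteq> d"
begin

definition edwards_eqs :: "'k^4 \<Rightarrow> bool"
  where "edwards_eqs v \<longleftrightarrow> a * (v$1)^2 + (v$2)^2 = (v$3)^2 + d * (v$4)^2 \<and> v$1 * v$2 = v$3 * v$4"

definition chart :: "4 \<Rightarrow> 'k \<Rightarrow> 'k \<Rightarrow> 'k^4"
  where "chart L u w = (\<chi> i. if i = 1 then u else if i = 2 then w else if i = L then 1 else u * w)"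

definition chart_params :: "4 \<Rightarrow> 4 \<Rightarrow> 'k \<Rightarrow> 'k \<Rightarrow> bool"
  where "chart_params L M g e \<longleftrightarrow>
    L = 3 \<and> M = 4 \<and> g = 1 \<and> e = d \<or> L = 4 \<and> M = 3 \<and> g = d \<and> e = 1"

lemma edwards_eqs_scale: "c \<noteq> 0 \<Longrightarrow> edwards_eqs (c *s v) \<longleftrightarrow> edwards_eqs v"
proof -
  assume c: "c \<noteq> 0"
  have "a * (c * v$1)^2 + (c * v$2)^2 = c^2 * (a * (v$1)^2 + (v$2)^2)"
    "(c * v$3)^2 + d * (c * v$4)^2 = c^2 * ((v$3)^2 + d * (v$4)^2)"
    "c * v$1 * (c * v$2) = c^2 * (v$1 * v$2)" "c * v$3 * (c * v$4) = c^2 * (v$3 * v$4)"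
    by (simp_all add: algebra_simps power2_eq_square)
  then show ?thesis unfolding edwards_eqs_def using c by simp
qed

lemma edwards_points_alt: "edwards_points a d = {proj_point v | v. v \<noteq> 0 \<and> edwards_eqs v}"
  by (simp add: edwards_points_def edwards_eqs_def)

lemma edwards_pointsD:
  assumes "P \<in> edwards_points a d" "v \<in> P"
  shows "P = proj_point v" "v \<noteq> 0" "edwards_eqs v"
proof -
  obtain w where w: "P = proj_point w" "w \<noteq> 0" "edwards_eqs w"
    using assms(1) unfolding edwards_points_alt by blast
  obtain c where c: "c \<noteq> 0" "v = c *s w" using mem_proj_point assms(2) w by blast
  show "P = proj_point v" using c w proj_point_scale by metis
  show "v \<noteq> 0" using c w by simp
  show "edwards_eqs v" using c w edwards_eqs_scale by blast
qed

lemma edwards_pointsI: "v \<noteq> 0 \<Longrightarrow> edwards_eqs v \<Longrightarrow> proj_point v \<in> edwards_points a d"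
  unfolding edwards_points_alt by blast

lemma edwards_points_ex: "P \<in> edwards_points a d \<Longrightarrow> \<exists>v. v \<in> P"
  unfolding edwards_points_alt using proj_point_self by blast

lemma edwards_nonzero:
  assumes "v \<noteq> 0" "edwards_eqs v" shows "v$3 \<noteq> 0 \<or> v$4 \<noteq> 0"
proof (rule ccontr)
  assume "\<not> ?thesis"
  then have 0: "v$3 = 0" "v$4 = 0" by auto
  then have "v$1 * v$2 = 0" "a * (v$1)^2 + (v$2)^2 = 0" using assms(2) by (auto simp: edwards_eqs_def)
  then have "v$1 = 0 \<and> v$2 = 0" using nz by auto
  then show False using assms(1) 0 by (simp add: vec4_eq)
qed

lemma chart_nth:
  assumes "chart_params L M g e"
  shows "chart L u w $ 1 = u" "chart L u w $ 2 = w" "chart L u w $ L = 1" "chart L u w $ M = u * w"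
  using assms by (auto simp: chart_def chart_params_def)

lemma chart_ex: assumes "v$3 \<noteq> 0 \<or> v$4 \<noteq> 0"
  obtains L M g e where "chart_params L M g e" "v$L \<noteq> 0"
  using assms unfolding chart_params_def by blast

lemma chart_eqs:
  assumes "chart_params L M g e"
  shows "edwards_eqs v \<longleftrightarrow> a * (v$1)^2 + (v$2)^2 = g * (v$L)^2 + e * (v$M)^2 \<and> v$1 * v$2 = v$L * v$M"
  using assms by (auto simp: chart_params_def edwards_eqs_def algebra_simps)

lemma chart_conic:
  assumes "chart_params L M g e"
  shows "edwards_eqs (chart L u w) \<longleftrightarrow> w^2 * poly [:1, 0, -e:] u = poly [:g, 0, -a:] u"
  unfolding chart_eqs[OF assms] by (simp add: chart_nth[OF assms] algebra_simps power2_eq_square)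

lemma chart_nz: assumes "chart_params L M g e" shows "chart L u w \<noteq> 0"
  using chart_nth(3)[OF assms] by (metis zero_index zero_neq_one)

lemma chart_rep:
  assumes "chart_params L M g e" "edwards_eqs v" "v$L \<noteq> 0"
  shows "v = v$L *s chart L (v$1 / v$L) (v$2 / v$L)" "edwards_eqs (chart L (v$1 / v$L) (v$2 / v$L))"
proof -
  have "v$1 * v$2 = v$L * v$M" using assms chart_eqs by blast
  then have M: "v$M = v$L * ((v$1 / v$L) * (v$2 / v$L))" using assms(3) by (simp add: field_simps)
  have "L = 3 \<and> M = 4 \<or> L = 4 \<and> M = 3" using assms(1) by (auto simp: chart_params_def)
  then show 1: "v = v$L *s chart L (v$1 / v$L) (v$2 / v$L)"
    using M assms(3) by (auto simp: vec4_eq chart_def)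
  show "edwards_eqs (chart L (v$1 / v$L) (v$2 / v$L))"
    using edwards_eqs_scale[OF assms(3)] assms(2) 1 by metis
qed

lemma chart_inj:
  assumes "chart_params L M g e" "proj_point (chart L u w) = proj_point (chart L u' w')"
  shows "u = u' \<and> w = w'"
proof -
  obtain c where "chart L u w = c *s chart L u' w'"
    using mem_proj_point proj_point_self assms(2) by metis
  then have "chart L u w $ i = c * chart L u' w' $ i" for i by simp
  from this[of 1] this[of 2] this[of L] show ?thesis using chart_nth[OF assms(1)] by simp
qed

lemma params_facts: assumes "chart_params L M g e" shows "g \<noteq> 0" "e \<noteq> 0" "g * e = d"
  using assms nz by (auto simp: chart_params_def)

lemma form_vanishes_on_chart:
  assumes "chart_params L M g e" "form UNIV n f"
    "infinite {(u, w). edwards_eqs (chart L u w) \<and> f (chart L u w) = 0}"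
    "edwards_eqs (chart L u w)"
  shows "f (chart L u w) = 0"
proof -
  note pf = params_facts[OF assms(1)]
  obtain \<alpha> where al: "\<alpha>^2 = g / a" using nth_root_exists[of 2] by fastforce
  have 1: "[:g, 0, -a:] = [:-\<alpha>, 1:] * [:-a * \<alpha>, -a:]"
    using al nz by (simp add: power2_eq_square field_simps)
  have "\<alpha> \<noteq> 0" using al pf nz by auto
  then have 2: "poly [:-a * \<alpha>, -a:] \<alpha> \<noteq> 0" using nz
    by (simp add: algebra_simps)
  have "1 - e * \<alpha>^2 \<noteq> 0" unfolding al using pf nz by (auto simp: field_simps)
  then have 3: "poly [:1, 0, -e:] \<alpha> \<noteq> 0" by (simp add: power2_eq_square algebra_simps)
  have 4: "\<not> (poly [:g, 0, -a:] u = 0 \<and> poly [:1, 0, -e:] u = 0)" for u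
  proof
    assume "poly [:g, 0, -a:] u = 0 \<and> poly [:1, 0, -e:] u = 0"
    then have "g = a * u^2" "1 = e * u^2" by (auto simp: algebra_simps power2_eq_square)
    then have "g * e = a * (e * u^2)" "e * u^2 = 1" by (auto simp: algebra_simps)
    then show False using pf nz by auto
  qed
  have 5: "\<exists>A B. \<forall>u w. chart L u w $ i = poly A u + poly B u * w" for i
  proof -
    consider "i = 1" | "i = 2" | "i = L" "i \<noteq> 1" "i \<noteq> 2" | "i \<noteq> 1" "i \<noteq> 2" "i \<noteq> L" by blast
    then show ?thesis
    proof cases
      case 1 show ?thesis
        by (rule exI[of _ "[:0,1:]"], rule exI[of _ 0]) (simp add: chart_def 1)
    next
      case 2 show ?thesis
        by (rule exI[of _ 0], rule exI[of _ 1]) (simp add: chart_def 2)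
    next
      case 3 show ?thesis
        by (rule exI[of _ 1], rule exI[of _ 0]) (use 3 in \<open>simp add: chart_def\<close>)
    next
      case 4 show ?thesis
        by (rule exI[of _ 0], rule exI[of _ "[:0,1:]"]) (use 4 in \<open>simp add: chart_def\<close>)
    qed
  qed
  show ?thesis
    by (rule form_vanishes_on_conic[OF assms(2) 5 1 2 3 4])
      (use assms(3,4) in \<open>simp_all only: chart_conic[OF assms(1)] not_False_eq_True\<close>)
qed

lemma finite_sq: "finite {x::'k. x^2 = c}"
proof -
  have "{x. x^2 = c} = {x. poly [:-c, 0, 1:] x = 0}" by (auto simp: power2_eq_square)
  then show ?thesis using poly_roots_finite[of "[:-c, 0, 1:]"] by simp
qed

lemma finite_coord_zero:
  assumes "chart_params L M g e"
  shows "finite {P \<in> edwards_points a d. \<exists>v\<in>P. v$M = 0}"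
proof -
  note pf = params_facts[OF assms]
  let ?U = "{0} \<times> {w. w^2 = g} \<union> {u. u^2 = g / a} \<times> {0}"
  have sub: "{P \<in> edwards_points a d. \<exists>v\<in>P. v$M = 0} \<subseteq> (\<lambda>(u, w). proj_point (chart L u w)) ` ?U"
  proof clarify
    fix P v assume P: "P \<in> edwards_points a d" "v \<in> P" "v$M = 0"
    note v = edwards_pointsD[OF P(1,2)]
    have "v$L \<noteq> 0" using edwards_nonzero[OF v(2,3)] P(3) assms by (auto simp: chart_params_def)
    note r = chart_rep[OF assms v(3) this]
    let ?u = "v$1 / v$L" and ?w = "v$2 / v$L"
    have PP: "P = proj_point (chart L ?u ?w)" using r(1) v(1) proj_point_scale \<open>v$L \<noteq> 0\<close> by metis
    have 0: "?u * ?w = 0" using v(3) P(3) unfolding chart_eqs[OF assms] by simp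
    have "a * ?u^2 + ?w^2 = g"
      using r(2) unfolding chart_eqs[OF assms] chart_nth[OF assms] 0 by simp
    then have "(?u, ?w) \<in> ?U" using 0 nz by (auto simp: field_simps)
    then show "P \<in> (\<lambda>(u, w). proj_point (chart L u w)) ` ?U" using PP by (intro image_eqI[of _ _ "(?u, ?w)"]) auto
  qed
  have fin: "finite ?U" using finite_sq by auto
  show ?thesis by (rule finite_surj[OF fin sub])
qed

lemma infinite_chart:
  assumes "chart_params L M g e"
  shows "infinite {P \<in> edwards_points a d. \<exists>v\<in>P. v$L \<noteq> 0}"
proof -
  note pf = params_facts[OF assms]
  let ?A = "{(u, w). edwards_eqs (chart L u w)}"
  have "UNIV - {u. u^2 = 1 / e} \<subseteq> fst ` ?A"
  proof
    fix u assume "u \<in> UNIV - {u. u^2 = 1 / e}"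
    then have q: "poly [:1, 0, -e:] u \<noteq> 0" using pf by (auto simp: field_simps power2_eq_square)
    obtain w where "w^2 = poly [:g, 0, -a:] u / poly [:1, 0, -e:] u"
      using nth_root_exists[of 2] by fastforce
    then have "edwards_eqs (chart L u w)" unfolding chart_conic[OF assms] using q by simp
    then show "u \<in> fst ` ?A" by (intro image_eqI[of _ _ "(u, w)"]) auto
  qed
  moreover have "infinite (UNIV - {u::'k. u^2 = 1 / e})" using finite_sq infinite_alg_closed
    by (intro Diff_infinite_finite) auto
  ultimately have "infinite ?A" using finite_imageI infinite_super by blast
  moreover have "inj_on (\<lambda>(u, w). proj_point (chart L u w)) ?A"
    using chart_inj[OF assms] by (force simp: inj_on_def)
  ultimately have "infinite ((\<lambda>(u, w). proj_point (chart L u w)) ` ?A)" using finite_imageD by blast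
  moreover have "(\<lambda>(u, w). proj_point (chart L u w)) ` ?A \<subseteq> {P \<in> edwards_points a d. \<exists>v\<in>P. v$L \<noteq> 0}"
  proof clarify
    fix u w assume "edwards_eqs (chart L u w)"
    then show "proj_point (chart L u w) \<in> edwards_points a d \<and> (\<exists>v\<in>proj_point (chart L u w). v$L \<noteq> 0)"
      using edwards_pointsI chart_nz[OF assms] chart_nth(3)[OF assms] proj_point_self by (metis zero_neq_one)
  qed
  ultimately show ?thesis using infinite_super by blast
qed

lemma form_chart_imp:
  assumes "chart_params L M g e" "form UNIV n f"
    "infinite {P \<in> edwards_points a d. (\<exists>v\<in>P. v$L \<noteq> 0) \<and> (\<forall>v\<in>P. f v = 0)}"
    "P \<in> edwards_points a d" "v \<in> P" "v$L \<noteq> 0"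
  shows "f v = 0"
proof -
  let ?A = "{(u, w). edwards_eqs (chart L u w) \<and> f (chart L u w) = 0}"
  have rep: "Q = proj_point (chart L (w$1/w$L) (w$2/w$L)) \<and> edwards_eqs (chart L (w$1/w$L) (w$2/w$L))"
    if "Q \<in> edwards_points a d" "w \<in> Q" "w$L \<noteq> 0" for Q w
    using chart_rep[OF assms(1) edwards_pointsD(3)[OF that(1,2)] that(3)] edwards_pointsD(1)[OF that(1,2)]
      proj_point_scale that(3) by metis
  have sub: "{P \<in> edwards_points a d. (\<exists>v\<in>P. v$L \<noteq> 0) \<and> (\<forall>v\<in>P. f v = 0)} \<subseteq>
    (\<lambda>(u, w). proj_point (chart L u w)) ` ?A"
  proof clarify
    fix Q w assume Q: "Q \<in> edwards_points a d" "w \<in> Q" "w$L \<noteq> 0" "\<forall>v\<in>Q. f v = 0"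
    note r = rep[OF Q(1-3)]
    then have "f (chart L (w$1/w$L) (w$2/w$L)) = 0" using Q(4) proj_point_self by metis
    then show "Q \<in> (\<lambda>(u, w). proj_point (chart L u w)) ` ?A"
      using r by (intro image_eqI[of _ _ "(w$1/w$L, w$2/w$L)"]) auto
  qed
  have "infinite ?A" using assms(3) finite_surj[OF _ sub] by meson
  note van = form_vanishes_on_chart[OF assms(1,2) this]
  note r = rep[OF assms(4-6)]
  have "f (chart L (v$1/v$L) (v$2/v$L)) = 0" by (rule van) (rule r[THEN conjunct2])
  moreover have "v \<in> proj_point (chart L (v$1/v$L) (v$2/v$L))" using r assms(5) by simp
  ultimately show ?thesis using form_zero_iff[OF assms(2)] by simp
qed

lemma edwards_form_dichotomy:
  assumes f: "form UNIV n f" and inf: "infinite {P \<in> edwards_points a d. \<forall>v\<in>P. f v = 0}"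
    and P: "P \<in> edwards_points a d" "v \<in> P"
  shows "f v = 0"
proof -
  let ?Z = "\<lambda>L. {P \<in> edwards_points a d. (\<exists>v\<in>P. v$L \<noteq> 0) \<and> (\<forall>v\<in>P. f v = 0)}"
  have 34: "chart_params 3 4 1 d" and 43: "chart_params 4 3 d 1" by (auto simp: chart_params_def)
  have inf': "infinite (?Z L)" if "chart_params M L g e" for L M g e
  proof -
    have "{P \<in> edwards_points a d. \<forall>v\<in>P. f v = 0} \<subseteq> ?Z L \<union> {P \<in> edwards_points a d. \<exists>v\<in>P. v$L = 0}"
      using edwards_points_ex by blast
    then show ?thesis using finite_coord_zero[OF that] inf finite_subset by (metis (lifting) finite_UnI)
  qed
  have "v$3 \<noteq> 0 \<or> v$4 \<noteq> 0" using edwards_pointsD[OF P] edwards_nonzero by blast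
  then show ?thesis
    using form_chart_imp[OF 34 f inf'[OF 43] P] form_chart_imp[OF 43 f inf'[OF 34] P] by blast
qed

lemma edwards_irreducible: "irreducible_curve (edwards_points a d)"
proof -
  have 34: "chart_params 3 4 1 d" by (auto simp: chart_params_def)
  have cl: "edwards_points a d \<subseteq> zariski_closure (edwards_points a d)"
  proof
    fix P assume P: "P \<in> edwards_points a d"
    then obtain v where v: "v \<in> P" using edwards_points_ex by blast
    show "P \<in> zariski_closure (edwards_points a d)"
      using edwards_pointsD[OF P v] P v unfolding zariski_closure_def by blast
  qed
  moreover have "zariski_closure (edwards_points a d) \<subseteq> edwards_points a d"
  proof
    fix P assume "P \<in> zariski_closure (edwards_points a d)"
    then obtain w where w: "P = proj_point w" "w \<noteq> 0"
      "\<And>e f. form UNIV e f \<Longrightarrow> (\<forall>P\<in>edwards_points a d. \<forall>v\<in>P. f v = 0) \<Longrightarrow> f w = 0"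
      unfolding zariski_closure_def by blast
    have sq: "form UNIV 2 (\<lambda>v::'k^4. (v$i)^2)" for i using form_power'[OF form_coord, of 2 2] by simp
    have f1: "form UNIV 2 (\<lambda>v::'k^4. (a * (v$1)^2 + (v$2)^2) - ((v$3)^2 + d * (v$4)^2))"
      by (intro form_diff form.add form_cmult sq)
    have f2: "form UNIV 2 (\<lambda>v::'k^4. v$1 * v$2 - v$3 * v$4)"
      by (intro form_diff form_mult'[OF form_coord form_coord]) auto
    have "\<forall>P\<in>edwards_points a d. \<forall>v\<in>P. edwards_eqs v" using edwards_pointsD(3) by blast
    then have "edwards_eqs w" using w(3)[OF f1] w(3)[OF f2] by (simp add: edwards_eqs_def)
    then show "P \<in> edwards_points a d" using w edwards_pointsI by blast
  qed
  ultimately have "zariski_closure (edwards_points a d) = edwards_points a d" by blast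
  moreover have "infinite (edwards_points a d)"
    by (rule infinite_super[OF _ infinite_chart[OF 34]]) blast
  ultimately show ?thesis unfolding irreducible_curve_def
    by (intro conjI allI impI ballI) (assumption+, rule edwards_form_dichotomy)
qed

lemma local_generator:
  fixes p :: "'k^4"
  assumes s: "form UNIV 1 s" and pL: "p $ L = 1"
    and gen: "\<And>i. \<exists>l b A B. form UNIV l A \<and> form UNIV b B \<and> B p \<noteq> 0 \<and> l + 1 = 1 + b \<and>
      (\<forall>v. edwards_eqs v \<longrightarrow> (v$i - p$i * v$L) * B v = s v * A v)"
    and N: "form UNIV n N"
  shows "\<exists>l b A B. form UNIV l A \<and> form UNIV b B \<and> B p \<noteq> 0 \<and> l + 1 = n + b \<and>
      (\<forall>v. edwards_eqs v \<longrightarrow> (N v - N p * (v$L) ^ n) * B v = s v * A v)"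
  using N
proof (induction rule: form.induct)
  case (const c)
  show ?case
    by (rule exI[of _ 0], rule exI[of _ 1], rule exI[of _ "\<lambda>_. 0"], rule exI[of _ "\<lambda>v. v$L"])
      (use form.const[of 0 UNIV] form_coord pL in auto)
next
  case (coord i)
  show ?case using gen[of i] by simp
next
  case (add n f g)
  obtain l b A B where 1: "form UNIV l A" "form UNIV b B" "B p \<noteq> 0" "l + 1 = n + b"
    "\<And>v. edwards_eqs v \<Longrightarrow> (f v - f p * (v$L) ^ n) * B v = s v * A v" using add.IH(1) by blast
  obtain l' b' A' B' where 2: "form UNIV l' A'" "form UNIV b' B'" "B' p \<noteq> 0" "l' + 1 = n + b'"
    "\<And>v. edwards_eqs v \<Longrightarrow> (g v - g p * (v$L) ^ n) * B' v = s v * A' v" using add.IH(2) by blast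
  have A: "form UNIV (l + b') (\<lambda>v. A v * B' v + A' v * B v)"
    by (intro form.add form.mult form_mult'[OF 2(1) 1(2)] 1(1) 2(2)) (use 1(4) 2(4) in linarith)
  have "(f v + g v - (f p + g p) * (v$L) ^ n) * (B v * B' v) = s v * (A v * B' v + A' v * B v)"
    if "edwards_eqs v" for v
  proof -
    have "(f v + g v - (f p + g p) * (v$L) ^ n) * (B v * B' v) =
      ((f v - f p * (v$L) ^ n) * B v) * B' v + ((g v - g p * (v$L) ^ n) * B' v) * B v"
      by (simp add: algebra_simps)
    then show ?thesis unfolding 1(5)[OF that] 2(5)[OF that] by (simp add: algebra_simps)
  qed
  then show ?case using A form.mult[OF 1(2) 2(2)] 1(3,4) 2(3)
    by (intro exI[of _ "l + b'"] exI[of _ "b + b'"] exI[of _ "\<lambda>v. A v * B' v + A' v * B v"]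
        exI[of _ "\<lambda>v. B v * B' v"]) auto
next
  case (mult n f n' g)
  obtain l b A B where 1: "form UNIV l A" "form UNIV b B" "B p \<noteq> 0" "l + 1 = n + b"
    "\<And>v. edwards_eqs v \<Longrightarrow> (f v - f p * (v$L) ^ n) * B v = s v * A v" using mult.IH(1) by blast
  obtain l' b' A' B' where 2: "form UNIV l' A'" "form UNIV b' B'" "B' p \<noteq> 0" "l' + 1 = n' + b'"
    "\<And>v. edwards_eqs v \<Longrightarrow> (g v - g p * (v$L) ^ n') * B' v = s v * A' v" using mult.IH(2) by blast
  let ?A = "\<lambda>v. A v * (B' v * g v) + f p * ((v$L) ^ n * (A' v * B v))"
  have pw: "form UNIV n (\<lambda>v::'k^4. (v$L) ^ n)" using form_power'[OF form_coord, of n n] by simp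
  have A: "form UNIV (l + (b' + n')) ?A"
    by (intro form.add form.mult 1(1) 2(2) mult.hyps form_cmult
        form_mult'[OF pw form.mult[OF 2(1) 1(2)]]) (use 1(4) 2(4) in linarith)
  have "(f v * g v - f p * g p * (v$L) ^ (n + n')) * (B v * B' v) = s v * ?A v"
    if "edwards_eqs v" for v
  proof -
    have "(f v * g v - f p * g p * (v$L) ^ (n + n')) * (B v * B' v) =
      ((f v - f p * (v$L) ^ n) * B v) * (B' v * g v) +
      f p * (v$L) ^ n * B v * ((g v - g p * (v$L) ^ n') * B' v)"
      by (simp add: algebra_simps power_add)
    then show ?thesis unfolding 1(5)[OF that] 2(5)[OF that] by (simp add: algebra_simps)
  qed
  then show ?case using A form.mult[OF 1(2) 2(2)] 1(3,4) 2(3)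
    by (intro exI[of _ "l + (b' + n')"] exI[of _ "b + b'"] exI[of _ ?A]
        exI[of _ "\<lambda>v. B v * B' v"]) auto
qed

lemma nonsingular_from_generator:
  assumes "P = proj_point p" "form UNIV 1 s" "s p = 0" "p$L = 1"
    and gen: "\<And>i. \<exists>l b A B. form UNIV l A \<and> form UNIV b B \<and> B p \<noteq> 0 \<and> l + 1 = 1 + b \<and>
      (\<forall>v. edwards_eqs v \<longrightarrow> (v$i - p$i * v$L) * B v = s v * A v)"
  shows "nonsingular_at (edwards_points a d) P"
proof -
  have main: "\<exists>l A B. form UNIV l A \<and> form UNIV l B \<and> (\<forall>v\<in>P. B v \<noteq> 0) \<and>
          (\<forall>Q\<in>edwards_points a d. \<forall>v\<in>Q. v$L \<noteq> 0 \<longrightarrow> D v \<noteq> 0 \<longrightarrow> B v \<noteq> 0 \<longrightarrow>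
            N v / D v = (s v / v$L) * (A v / B v))"
    if N: "form UNIV e N" and D: "form UNIV e D" and ND: "\<forall>v\<in>P. N v = 0 \<and> D v \<noteq> 0" for e N D
  proof -
    have p: "N p = 0" "D p \<noteq> 0" using ND assms(1) by auto
    obtain l b A B where 1: "form UNIV l A" "form UNIV b B" "B p \<noteq> 0" "l + 1 = e + b"
      "\<And>v. edwards_eqs v \<Longrightarrow> N v * B v = s v * A v"
      using local_generator[OF assms(2,4) gen N] p(1) by auto
    have B: "form UNIV (l + 1) (\<lambda>v. D v * B v)" unfolding 1(4) by (rule form.mult[OF D 1(2)])
    have A: "form UNIV (l + 1) (\<lambda>v. A v * v$L)" by (rule form.mult[OF 1(1) form.coord])
    have z1: "\<forall>v\<in>P. D v * B v \<noteq> 0" using form_zero_iff[OF B] 1(3) p(2) assms(1) by simp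
    have z2: "N v / D v = (s v / v$L) * (A v * v$L / (D v * B v))"
      if "Q \<in> edwards_points a d" "v \<in> Q" "v$L \<noteq> 0" "D v \<noteq> 0" "D v * B v \<noteq> 0" for Q v
      using 1(5)[OF edwards_pointsD(3)[OF that(1,2)]] that(3-5) by (simp add: field_simps)
    show ?thesis
      by (rule exI[of _ "l + 1"], rule exI[of _ "\<lambda>v. A v * v$L"], rule exI[of _ "\<lambda>v. D v * B v"],
          intro conjI A B z1 ballI impI) (rule z2)
  qed
  have z: "\<forall>v\<in>P. s v = 0 \<and> v$L \<noteq> 0"
    using form_zero_iff[OF assms(2)] form_zero_iff[OF form_coord] assms(1,3,4) by fastforce
  show ?thesis unfolding nonsingular_at_def
    by (rule exI[of _ 1], rule exI[of _ s], rule exI[of _ "\<lambda>v. v$L"],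
        intro conjI assms(2) form.coord z allI impI) (rule main)
qed

lemma edwards_nonsingular:
  assumes "P \<in> edwards_points a d" shows "nonsingular_at (edwards_points a d) P"
proof -
  obtain v where v: "v \<in> P" using edwards_points_ex assms by blast
  note vD = edwards_pointsD[OF assms v]
  obtain L M g e where ch: "chart_params L M g e" and vL: "v$L \<noteq> 0"
    using chart_ex edwards_nonzero[OF vD(2,3)] by blast
  note pf = params_facts[OF ch]
  let ?x = "v$1 / v$L" and ?y = "v$2 / v$L"
  define x y where xy: "x = ?x" "y = ?y"
  define p where "p = chart L x y"
  have P: "P = proj_point p" and pe: "edwards_eqs p"
    unfolding p_def xy using chart_rep[OF ch vD(3) vL] vD(1) proj_point_scale[OF vL] by metis+
  note pn = chart_nth[OF ch, of x y, folded p_def]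
  have pq: "a * x^2 + y^2 = g + e * (x * y)^2"
    using pe unfolding chart_eqs[OF ch] pn by simp
  have i4: "i = 1 \<or> i = 2 \<or> i = L \<or> i = M" for i
    using exhaust_4[of i] ch by (auto simp: chart_params_def)
  let ?gen = "\<lambda>s i. \<exists>l b A B. form UNIV l A \<and> form UNIV b B \<and> B p \<noteq> 0 \<and> l + 1 = 1 + b \<and>
      (\<forall>v. edwards_eqs v \<longrightarrow> (v$i - p$i * v$L) * B v = s v * A v)"
  have sq: "form UNIV 2 (\<lambda>v::'k^4. (v$i)^2)" for i using form_power'[OF form_coord, of 2 2] by simp
  have lin: "form UNIV 1 (\<lambda>v::'k^4. v$i - c * v$L)" "form UNIV 1 (\<lambda>v::'k^4. v$i + c * v$L)" for i c
    by (intro form_diff form.add form_cmult form.coord)+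
  have c1: "form UNIV 1 (\<lambda>v::'k^4. c * v$i)" for i c
    by (intro form_cmult form.coord)
  have key: "(v$1 - x * v$L) * ((v$1 + x * v$L) * (a * (v$L)^2 - e * (v$2)^2)) =
     (v$2 - y * v$L) * (- ((v$2 + y * v$L) * ((1 - e * x^2) * (v$L)^2)))" if "edwards_eqs v" for v
  proof -
    have 1: "a * (v$1)^2 + (v$2)^2 = g * (v$L)^2 + e * (v$M)^2" "v$1 * v$2 = v$L * v$M"
      using that chart_eqs[OF ch] by auto
    have "(v$1 - x * v$L) * ((v$1 + x * v$L) * (a * (v$L)^2 - e * (v$2)^2)) +
     (v$2 - y * v$L) * ((v$2 + y * v$L) * ((1 - e * x^2) * (v$L)^2)) =
      (v$L)^2 * (a * (v$1)^2 + (v$2)^2) - e * (v$1 * v$2)^2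
        - (v$L)^4 * (a * x^2 + y^2 - e * (x * y)^2)"
      by (simp add: algebra_simps power2_eq_square power4_eq_xxxx)
    also have "a * x^2 + y^2 - e * (x * y)^2 = g" using pq by simp
    also have "(v$L)^2 * (a * (v$1)^2 + (v$2)^2) - e * (v$1 * v$2)^2 - (v$L)^4 * g = 0"
      unfolding 1 by (simp add: algebra_simps power2_eq_square power4_eq_xxxx)
    finally show ?thesis by (simp add: eq_neg_iff_add_eq_0)
  qed
  have xyM: "(v$M - p$M * v$L) * v$L = (v$1 - x * v$L) * v$2 + x * v$L * (v$2 - y * v$L)"
    if "edwards_eqs v" for v
  proof -
    have "v$L * v$M = v$1 * v$2" using that chart_eqs[OF ch] by auto
    then show ?thesis unfolding pn by (simp add: algebra_simps)
  qed
  show ?thesis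
  proof (cases "y = 0")
    case False
    have nz1: "1 - e * x^2 \<noteq> 0"
    proof
      assume 0: "1 - e * x^2 = 0"
      have "y^2 * (1 - e * x^2) = g - a * x^2" using pq by (simp add: algebra_simps)
      then have g1: "g = a * x^2" and e1: "e * x^2 = 1" using 0 by simp_all
      have "g * e = a * (e * x^2)" unfolding g1 by (simp only: ac_simps)
      then show False using e1 pf nz by simp
    qed
    let ?s = "\<lambda>v::'k^4. v$1 - x * v$L"
    let ?B = "\<lambda>v::'k^4. - ((v$2 + y * v$L) * ((1 - e * x^2) * (v$L)^2))"
    let ?A = "\<lambda>v::'k^4. (v$1 + x * v$L) * (a * (v$L)^2 - e * (v$2)^2)"
    have fB: "form UNIV 3 ?B"
      using form_cmult[OF form_mult'[OF lin(2) form_cmult[OF sq]], where c="-1"] by simp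
    have fA: "form UNIV 3 ?A"
      by (rule form_mult'[OF lin(2) form_diff[OF form_cmult[OF sq] form_cmult[OF sq]]]) simp
    have Bp: "?B p \<noteq> 0" unfolding pn using nz1 False nz(1) by (simp flip: mult_2)
    show ?thesis
    proof (rule nonsingular_from_generator[OF P lin(1)])
      fix i
      consider "i = 1" | "i = 2" | "i = L" | "i = M" using i4 by blast
      then show "?gen ?s i"
      proof cases
        case 1 show ?thesis
          by (rule exI[of _ 0], rule exI[of _ 0], rule exI[of _ "\<lambda>_. 1"], rule exI[of _ "\<lambda>_. 1"])
            (simp add: form.const 1 pn)
      next
        case 2 show ?thesis
          by (rule exI[of _ 3], rule exI[of _ 3], rule exI[of _ ?A], rule exI[of _ ?B])
            (use fA fB Bp key in \<open>simp add: 2 pn\<close>)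
      next
        case 3 show ?thesis
          by (rule exI[of _ 0], rule exI[of _ 0], rule exI[of _ "\<lambda>_. 0"], rule exI[of _ "\<lambda>_. 1"])
            (simp add: form.const 3 pn)
      next
        case 4
        let ?A' = "\<lambda>v::'k^4. v$2 * ?B v + (x * v$L) * ?A v"
        have "form UNIV 4 ?A'"
          by (intro form.add form_mult'[OF form_coord fB] form_mult'[OF c1 fA]) auto
        moreover have "form UNIV 4 (\<lambda>v::'k^4. v$L * ?B v)" by (rule form_mult'[OF form_coord fB]) simp
        moreover have "(v$M - p$M * v$L) * (v$L * ?B v) = ?s v * ?A' v" if "edwards_eqs v" for v
        proof -
          have "(v$M - p$M * v$L) * (v$L * ?B v) =
             ?s v * (v$2 * ?B v) + x * v$L * ((v$2 - y * v$L) * ?B v)"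
            unfolding mult.assoc[symmetric] xyM[OF that] by (simp add: algebra_simps)
          then show ?thesis unfolding key[OF that, symmetric] by (simp add: algebra_simps)
        qed
        moreover have "p$L * ?B p \<noteq> 0" using Bp pn by simp
        ultimately show ?thesis unfolding 4
          by (intro exI[of _ 4] exI[of _ 4] exI[of _ ?A'] exI[of _ "\<lambda>v. v$L * ?B v"]) simp
      qed
    qed (auto simp: pn)
  next
    case True
    have x0: "x \<noteq> 0" using pq pf True by auto
    let ?s = "\<lambda>v::'k^4. v$2 - y * v$L"
    let ?A = "\<lambda>v::'k^4. - ((v$2 + y * v$L) * ((1 - e * x^2) * (v$L)^2))"
    let ?B = "\<lambda>v::'k^4. (v$1 + x * v$L) * (a * (v$L)^2 - e * (v$2)^2)"
    have fA: "form UNIV 3 ?A"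
      using form_cmult[OF form_mult'[OF lin(2) form_cmult[OF sq]], where c="-1"] by simp
    have fB: "form UNIV 3 ?B"
      by (rule form_mult'[OF lin(2) form_diff[OF form_cmult[OF sq] form_cmult[OF sq]]]) simp
    have Bp: "?B p \<noteq> 0" unfolding pn using x0 True nz(1,2) by (simp flip: mult_2)
    show ?thesis
    proof (rule nonsingular_from_generator[OF P lin(1)])
      fix i
      consider "i = 2" | "i = 1" | "i = L" | "i = M" using i4 by blast
      then show "?gen ?s i"
      proof cases
        case 1 show ?thesis
          by (rule exI[of _ 0], rule exI[of _ 0], rule exI[of _ "\<lambda>_. 1"], rule exI[of _ "\<lambda>_. 1"])
            (simp add: form.const 1 pn)
      next
        case 2 show ?thesis
          by (rule exI[of _ 3], rule exI[of _ 3], rule exI[of _ ?A], rule exI[of _ ?B])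
            (use fA fB Bp key in \<open>simp add: 2 pn\<close>)
      next
        case 3 show ?thesis
          by (rule exI[of _ 0], rule exI[of _ 0], rule exI[of _ "\<lambda>_. 0"], rule exI[of _ "\<lambda>_. 1"])
            (simp add: form.const 3 pn)
      next
        case 4
        let ?A' = "\<lambda>v::'k^4. v$2 * ?A v + (x * v$L) * ?B v"
        have "form UNIV 4 ?A'"
          by (intro form.add form_mult'[OF form_coord fA] form_mult'[OF c1 fB]) auto
        moreover have "form UNIV 4 (\<lambda>v::'k^4. v$L * ?B v)" by (rule form_mult'[OF form_coord fB]) simp
        moreover have "(v$M - p$M * v$L) * (v$L * ?B v) = ?s v * ?A' v" if "edwards_eqs v" for v
        proof -
          have "(v$M - p$M * v$L) * (v$L * ?B v) =
             v$2 * ((v$1 - x * v$L) * ?B v) + ?s v * (x * v$L * ?B v)"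
            unfolding mult.assoc[symmetric] xyM[OF that] by (simp add: algebra_simps)
          then show ?thesis unfolding key[OF that] by (simp add: algebra_simps)
        qed
        moreover have "p$L * ?B p \<noteq> 0" using Bp pn by simp
        ultimately show ?thesis unfolding 4
          by (intro exI[of _ 4] exI[of _ 4] exI[of _ ?A'] exI[of _ "\<lambda>v. v$L * ?B v"]) simp
      qed
    qed (auto simp: pn)
  qed
qed


definition proj_vec :: "'k^4 \<Rightarrow> 'k^3"
  where "proj_vec v = vector [v$1, v$2, v$3]"

definition lift_vec :: "'k^3 \<Rightarrow> 'k^4"
  where "lift_vec w = vector [w$1 * w$3, w$2 * w$3, (w$3)^2, w$1 * w$2]"

definition quartic :: "'k^3 \<Rightarrow> 'k"
  where "quartic w = (a * ((w$1)^2 * (w$3)^2) + (w$2)^2 * (w$3)^2) - ((w$3)^4 + d * ((w$1)^2 * (w$2)^2))"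

lemma proj_vec_scale: "proj_vec (c *s v) = c *s proj_vec v"
  by (simp add: proj_vec_def vec3_eq)

lemma lift_vec_scale: "lift_vec (c *s w) = c^2 *s lift_vec w"
  by (simp add: lift_vec_def vec4_eq power2_eq_square algebra_simps)

lemma proj_vec_nz:
  assumes "v \<noteq> 0" "edwards_eqs v" shows "proj_vec v \<noteq> 0"
proof
  assume "proj_vec v = 0"
  then have 0: "v$1 = 0" "v$2 = 0" "v$3 = 0" by (simp_all add: proj_vec_def vec3_eq)
  then have "v$4 = 0" using assms(2) nz by (simp add: edwards_eqs_def)
  then show False using 0 assms(1) by (simp add: vec4_eq)
qed

lemma edwards_projection_eq:
  assumes "P \<in> edwards_points a d" "v \<in> P"
  shows "edwards_projection P = proj_point (proj_vec v)"
proof -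
  let ?w = "SOME w. w \<in> P"
  have "?w \<in> P" using assms(2) by (rule someI)
  then obtain c where "c \<noteq> 0" "?w = c *s v"
    using edwards_pointsD(1)[OF assms] mem_proj_point by metis
  then have "proj_point (proj_vec ?w) = proj_point (proj_vec v)"
    by (simp add: proj_vec_scale proj_point_scale)
  then show ?thesis by (simp add: edwards_projection_def proj_vec_def Let_def)
qed

lemma form_proj_vec: "form UNIV e f \<Longrightarrow> form UNIV e (\<lambda>v. f (proj_vec v))"
proof (induction rule: form.induct)
  case (coord i)
  have "i = 1 \<or> i = 2 \<or> i = 3" by (rule exhaust_3)
  then show ?case using form.coord[of UNIV "1::4"] form.coord[of UNIV "2::4"] form.coord[of UNIV "3::4"]
    by (auto simp: proj_vec_def)
qed (auto intro: form.intros)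

lemma quartic_form: "form UNIV 4 quartic"
proof -
  have sq: "form UNIV 2 (\<lambda>v::'k^3. (v$i)^2)" for i using form_power'[OF form_coord, of 2 2] by simp
  have q: "form UNIV 4 (\<lambda>v::'k^3. (v$i)^4)" for i using form_power'[OF form_coord, of 4 4] by simp
  have p: "form UNIV 4 (\<lambda>v::'k^3. (v$i)^2 * (v$j)^2)" for i j by (rule form_mult'[OF sq sq]) simp
  show ?thesis unfolding quartic_def[abs_def] by (rule form_diff[OF form.add[OF form_cmult[OF p] p] form.add[OF q form_cmult[OF p]]])
qed

lemma edwards_projection_closure:
  assumes P: "P \<in> edwards_points a d"
  shows "edwards_projection P \<in> edwards_plane_closure a d"
proof -
  have 34: "chart_params 3 4 1 d" by (auto simp: chart_params_def)
  obtain v where v: "v \<in> P" using edwards_points_ex P by blast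
  note vD = edwards_pointsD[OF P v]
  have "f (proj_vec v) = 0"
    if f: "form UNIV e f" and van: "\<forall>Q\<in>{proj_point (vector [x, y, 1]) | x y. a * x^2 + y^2 = 1 + d * x^2 * y^2}. \<forall>v\<in>Q. f v = 0"
    for e f
  proof (rule edwards_form_dichotomy[OF form_proj_vec[OF f] _ P v], rule infinite_super[OF _ infinite_chart[OF 34]], safe)
    fix Q u w assume Q: "Q \<in> edwards_points a d" "u \<in> Q" "u$3 \<noteq> 0" "w \<in> Q"
    have "w \<in> proj_point u" using edwards_pointsD(1)[OF Q(1,2)] Q(4) by simp
    then have w3: "w$3 \<noteq> 0" using form_zero_iff[OF form_coord] Q(3) by blast
    have we: "edwards_eqs w" using edwards_pointsD(3)[OF Q(1,4)] .
    let ?x = "w$1 / w$3" and ?y = "w$2 / w$3"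
    have e: "proj_vec w = w$3 *s vector [?x, ?y, 1]" using w3 by (simp add: proj_vec_def vec3_eq)
    have "w$4 = w$1 * w$2 / w$3" using we w3 by (simp add: edwards_eqs_def field_simps)
    then have "a * (w$1)^2 + (w$2)^2 = (w$3)^2 + d * (w$1 * w$2 / w$3)^2"
      using we by (simp add: edwards_eqs_def)
    then have "a * ?x^2 + ?y^2 = 1 + d * ?x^2 * ?y^2"
      using w3 by (simp add: field_simps power2_eq_square)
    then have "f (vector [?x, ?y, 1]) = 0" using van proj_point_self by blast
    then show "f (proj_vec w) = 0" unfolding e form_scale[OF f] by simp
  qed
  then show ?thesis unfolding edwards_plane_closure_def zariski_closure_def edwards_projection_eq[OF P v]
    using proj_vec_nz[OF vD(2,3)] by blast
qed

lemma plane_closureD: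
  assumes "Q \<in> edwards_plane_closure a d" "w \<in> Q"
  shows "Q = proj_point w" "w \<noteq> 0" "quartic w = 0"
proof -
  obtain u where u: "Q = proj_point u" "u \<noteq> 0"
    "\<And>e f. form UNIV e f \<Longrightarrow> \<forall>P\<in>{proj_point (vector [x, y, 1]) | x y. a * x^2 + y^2 = 1 + d * x^2 * y^2}. \<forall>v\<in>P. f v = 0 \<Longrightarrow> f u = 0"
    using assms(1) unfolding edwards_plane_closure_def zariski_closure_def by blast
  obtain c where c: "c \<noteq> 0" "w = c *s u" using mem_proj_point assms(2) u(1) by blast
  show "Q = proj_point w" using c u(1) proj_point_scale by metis
  show "w \<noteq> 0" using c u(2) by simp
  have "quartic u = 0"
  proof (rule u(3)[OF quartic_form], safe)
    fix x y v assume e: "a * x^2 + y^2 = 1 + d * x^2 * y^2" and "v \<in> proj_point (vector [x, y, 1] :: 'k^3)"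
    moreover have "quartic (vector [x, y, 1]) = 0" using e by (simp add: quartic_def)
    ultimately show "quartic v = 0" using form_zero_iff[OF quartic_form] by blast
  qed
  then show "quartic w = 0" unfolding c form_scale[OF quartic_form] by simp
qed

lemma lift_vec_point:
  assumes "w$3 \<noteq> 0" "quartic w = 0"
  shows "lift_vec w \<noteq> 0" "edwards_eqs (lift_vec w)" "proj_vec (lift_vec w) = w$3 *s w"
proof -
  show "lift_vec w \<noteq> 0" using assms(1) by (auto simp: lift_vec_def vec4_eq)
  show "edwards_eqs (lift_vec w)" using assms(2)
    by (simp add: edwards_eqs_def lift_vec_def quartic_def power2_eq_square power4_eq_xxxx algebra_simps)
  show "proj_vec (lift_vec w) = w$3 *s w"
    by (simp add: lift_vec_def proj_vec_def vec3_eq power2_eq_square)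
qed

lemma edwards_projection_surj:
  assumes "Q \<in> edwards_plane_closure a d"
  shows "Q \<in> edwards_projection ` edwards_points a d"
proof -
  obtain w where w: "w \<in> Q"
    using assms unfolding edwards_plane_closure_def zariski_closure_def by (blast intro: proj_point_self)
  note wD = plane_closureD[OF assms w]
  have "\<exists>v c. v \<noteq> 0 \<and> edwards_eqs v \<and> c \<noteq> 0 \<and> proj_vec v = c *s w"
  proof (cases "w$3 = 0")
    case False
    then show ?thesis using lift_vec_point[OF False wD(3)] by blast
  next
    case True
    then have "w$1 = 0 \<or> w$2 = 0" using wD(3) nz by (simp add: quartic_def)
    then show ?thesis
    proof
      assume 1: "w$1 = 0"
      obtain t where t: "t^2 = 1 / d" using nth_root_exists[of 2] by fastforce
      have "w$2 \<noteq> 0" using 1 True wD(2) by (simp add: vec3_eq)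
      then show ?thesis using 1 True nz t
        by (intro exI[of _ "vector [0, w$2, 0, t * w$2]"] exI[of _ 1])
          (simp add: vec4_eq vec3_eq edwards_eqs_def proj_vec_def power_mult_distrib)
    next
      assume 2: "w$2 = 0"
      obtain t where t: "t^2 = a / d" using nth_root_exists[of 2] by fastforce
      have "w$1 \<noteq> 0" using 2 True wD(2) by (simp add: vec3_eq)
      then show ?thesis using 2 True nz t
        by (intro exI[of _ "vector [w$1, 0, 0, t * w$1]"] exI[of _ 1])
          (simp add: vec4_eq vec3_eq edwards_eqs_def proj_vec_def power_mult_distrib)
    qed
  qed
  then obtain v c where v: "v \<noteq> 0" "edwards_eqs v" "c \<noteq> 0" "proj_vec v = c *s w" by blast
  have P: "proj_point v \<in> edwards_points a d" using v edwards_pointsI by blast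
  have "edwards_projection (proj_point v) = Q"
    using edwards_projection_eq[OF P proj_point_self] v proj_point_scale wD(1) by simp
  then show ?thesis using P by blast
qed

lemma edwards_desingularization:
  "desingularization (edwards_plane_closure a d) (edwards_points a d) edwards_projection"
proof -
  let ?V = "edwards_plane_closure a d" and ?C = "edwards_points a d"
  let ?S = "{proj_point (vector [1, 0, 0]), proj_point (vector [0, 1, 0])} :: ('k^3) set set"
  define \<rho> where "\<rho> Q = proj_point (lift_vec (SOME w. w \<in> Q))" for Q :: "('k^3) set"
  have 43: "chart_params 4 3 d 1" by (auto simp: chart_params_def)
  have c3: "form UNIV 1 (\<lambda>v::'k^4. v$1)" "form UNIV 1 (\<lambda>v::'k^4. v$2)" "form UNIV 1 (\<lambda>v::'k^4. v$3)"
    by (rule form.coord)+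
  have im: "edwards_projection ` ?C = ?V"
    using edwards_projection_closure edwards_projection_surj by blast
  have reg: "regular_map UNIV ?C ?V edwards_projection"
    unfolding regular_map_def
  proof (intro conjI ballI)
    show "edwards_projection ` ?C \<subseteq> ?V" using im by simp
    fix P assume P: "P \<in> ?C"
    show "\<exists>e G. (\<forall>i. form UNIV e (\<lambda>v. G v $ i)) \<and> (\<forall>v\<in>P. G v \<noteq> 0) \<and>
      (\<forall>Q\<in>?C. \<forall>v\<in>Q. G v \<noteq> 0 \<longrightarrow> edwards_projection Q = proj_point (G v))"
    proof (rule exI[of _ 1], rule exI[of _ proj_vec], intro conjI allI ballI impI)
      show "form UNIV 1 (\<lambda>v. proj_vec v $ i)" for i
        using exhaust_3[of i] c3 by (auto simp: proj_vec_def)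
      show "proj_vec v \<noteq> 0" if "v \<in> P" for v
        using proj_vec_nz edwards_pointsD[OF P that] by blast
      show "edwards_projection Q = proj_point (proj_vec v)" if "Q \<in> ?C" "v \<in> Q" for Q v
        using edwards_projection_eq[OF that] .
    qed
  qed
  have w3: "w$3 \<noteq> 0" if Q: "Q \<in> ?V" "Q \<notin> ?S" "w \<in> Q" for Q w
  proof
    assume 0: "w$3 = 0"
    note wD = plane_closureD[OF Q(1,3)]
    have "w$1 = 0 \<or> w$2 = 0" using wD(3) nz 0 by (simp add: quartic_def)
    then have "w = w$1 *s vector [1, 0, 0] \<and> w$1 \<noteq> 0 \<or> w = w$2 *s vector [0, 1, 0] \<and> w$2 \<noteq> 0"
      using wD(2) 0 by (auto simp: vec3_eq)
    then have "proj_point w \<in> ?S" using proj_point_scale by (metis insertCI)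
    then show False using Q(2) wD(1) by simp
  qed
  have S3: "v$3 = 0" if "P \<in> ?C" "v \<in> P" "edwards_projection P \<in> ?S" for P v
  proof -
    have "proj_vec v \<in> edwards_projection P" using edwards_projection_eq[OF that(1,2)] proj_point_self by simp
    then have "proj_vec v \<in> proj_point (vector [1, 0, 0]) \<or> proj_vec v \<in> proj_point (vector [0, 1, 0])"
      using that(3) by auto
    then obtain c where "proj_vec v = c *s vector [1, 0, 0] \<or> proj_vec v = c *s vector [0, 1, 0]"
      using mem_proj_point by metis
    then show ?thesis by (auto simp: proj_vec_def vec3_eq)
  qed
  have finS: "finite {P \<in> ?C. edwards_projection P \<in> ?S}"
    by (rule finite_subset[OF _ finite_coord_zero[OF 43]]) (use S3 edwards_points_ex in blast)
  have rho: "\<rho> Q = proj_point (lift_vec w)" if Q: "Q \<in> ?V" "w \<in> Q" for Q w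
  proof -
    let ?u = "SOME u. u \<in> Q"
    have "?u \<in> Q" using Q(2) by (rule someI)
    then obtain c where c: "c \<noteq> 0" "?u = c *s w" using plane_closureD(1)[OF Q] mem_proj_point by metis
    show ?thesis unfolding \<rho>_def c(2) lift_vec_scale using c(1) by (intro proj_point_scale) simp
  qed
  have V_ex: "\<exists>w. w \<in> Q" if "Q \<in> ?V" for Q
    using that unfolding edwards_plane_closure_def zariski_closure_def by (blast intro: proj_point_self)
  have rhoC: "\<rho> Q \<in> ?C" and pirho: "edwards_projection (\<rho> Q) = Q" if Q: "Q \<in> ?V - ?S" for Q
  proof -
    obtain w where w: "w \<in> Q" using V_ex Q by blast
    have QV: "Q \<in> ?V" "Q \<notin> ?S" using Q by blast+
    note l = lift_vec_point[OF w3[OF QV w] plane_closureD(3)[OF QV(1) w]]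
    have r: "\<rho> Q = proj_point (lift_vec w)" using rho[OF QV(1) w] .
    show C: "\<rho> Q \<in> ?C" unfolding r using edwards_pointsI[OF l(1,2)] .
    have "edwards_projection (\<rho> Q) = proj_point (proj_vec (lift_vec w))"
      by (rule edwards_projection_eq[OF C]) (simp add: r)
    then show "edwards_projection (\<rho> Q) = Q"
      using l(3) proj_point_scale[OF w3[OF QV w]] plane_closureD(1)[OF QV(1) w] by simp
  qed
  have regrho: "regular_map UNIV (?V - ?S) ?C \<rho>"
    unfolding regular_map_def
  proof (intro conjI ballI)
    show "\<rho> ` (?V - ?S) \<subseteq> ?C" using rhoC by blast
    fix P assume P: "P \<in> ?V - ?S"
    have PV: "P \<in> ?V" "P \<notin> ?S" using P by blast+
    have sq: "form UNIV 2 (\<lambda>v::'k^3. v$i * v$j)" for i j by (rule form_mult'[OF form_coord form_coord]) simp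
    show "\<exists>e G. (\<forall>i. form UNIV e (\<lambda>v. G v $ i)) \<and> (\<forall>v\<in>P. G v \<noteq> 0) \<and>
      (\<forall>Q\<in>?V - ?S. \<forall>v\<in>Q. G v \<noteq> 0 \<longrightarrow> \<rho> Q = proj_point (G v))"
    proof (rule exI[of _ 2], rule exI[of _ lift_vec], intro conjI allI ballI impI)
      show "form UNIV 2 (\<lambda>v. lift_vec v $ i)" for i
        using exhaust_4[of i] sq by (auto simp: lift_vec_def power2_eq_square)
      show "lift_vec v \<noteq> 0" if "v \<in> P" for v
        using lift_vec_point(1)[OF w3[OF PV that] plane_closureD(3)[OF PV(1) that]] .
      show "\<rho> Q = proj_point (lift_vec v)" if "Q \<in> ?V - ?S" "v \<in> Q" for Q v
        using rho[of Q v] that by blast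
    qed
  qed
  have rhopi: "\<rho> (edwards_projection P) = P" if P: "P \<in> ?C" "edwards_projection P \<notin> ?S" for P
  proof -
    obtain v where v: "v \<in> P" using edwards_points_ex P by blast
    note vD = edwards_pointsD[OF P(1) v]
    have V: "edwards_projection P \<in> ?V" using im P by blast
    have m: "proj_vec v \<in> edwards_projection P" using edwards_projection_eq[OF P(1) v] by simp
    have "proj_vec v $ 3 \<noteq> 0" using w3[OF V P(2) m] .
    then have v3: "v$3 \<noteq> 0" by (simp add: proj_vec_def)
    have "lift_vec (proj_vec v) = v$3 *s v" using vD(3)
      by (simp add: lift_vec_def proj_vec_def vec4_eq power2_eq_square edwards_eqs_def mult.commute)
    then show ?thesis using rho[OF V m] proj_point_scale[OF v3] vD(1) by simp
  qed
  show ?thesis unfolding desingularization_def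
    by (intro conjI edwards_irreducible ballI edwards_nonsingular reg im exI[of _ ?S] exI[of _ \<rho>]
        finS regrho impI rhopi pirho) simp_all
qed

end

end

(*
  The image psi P of a point P = (x, y) determines x up to sign and then y, so psi is the quotient
  by the translation neg : (x, y) |-> (-x, -y), with x^2 = 1 / (a u) and y = - r a v x / (a u - d) in
  terms of the coordinates (u, v) of psi P. Hence every function on E is of the form
  h0 o psi + h1 o psi * x almost everywhere; such functions are closed under inversion because the
  norm g (P) g (neg P) is a function on L. They are independent because neg changes the sign of x.
  Both maps are given by two vectors of forms without common zeros on the curve, and the duality
  phi o psi = [2], psi o phi = [2] comes down to polynomial identities in homogeneous coordinates.
*)
theory Submission
  imports Defs
begin

section \<open>Projective points and coordinates\<close>

text \<open>The stated formulas have poles, while regularity and duality concern every geometric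
  point; this is why two vectors of forms per map are needed. On \<open>E\<close> the identity
  \<open>(1 - y^2) * (1 - d * x^2) = (a - d) * x^2\<close> rewrites the second coordinate of
  \<open>psi\<close> as \<open>- y * (1 - d * x^2) / (a * r * x^3)\<close>, and
  \<open>X * Y = Z * T\<close> gives the second expression \<open>x = T / Y\<close> besides
  \<open>x = X / Z\<close>. On \<open>L\<close> a common factor \<open>x\<close> cancels in the
  second coordinate of \<open>phi\<close> and leaves \<open>M / N\<close>. With
  \<open>D = d - a * x^2\<close> the affine identities \<open>D^2 - 4 * d * a * y^2 = N^2\<close>
  and \<open>D^2 - 4 * a^2 * y^2 = M^2\<close> carry the work on \<open>phi\<close>: they imply that
  its image lies on \<open>E\<close>, and they produce the abscissa
  \<open>D^2 / (4 * a^2 * y^2)\<close> of the double of a point. For the degree, elements of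
  function fields are only known up to finite sets of points; surjectivity of \<open>psi\<close> is
  what carries a statement about almost all points of \<open>E\<close> over to \<open>L\<close>.
  Coefficients stay in \<open>F\<close> because every form is built from \<open>a\<close>,
  \<open>d\<close>, \<open>r\<close> by ring operations.\<close>

lemma proj_point_eqI: "c \<noteq> 0 \<Longrightarrow> v = c *s w \<Longrightarrow> proj_point v = proj_point w"
  by (simp add: proj_point_scale)

text \<open>Maps and addition laws pick a representative by \<open>SOME\<close>; as the formulas are
  homogeneous, knowing it up to a nonzero factor is enough.\<close>

lemma proj_point_some:
  assumes "P = proj_point v"
  obtains c where "c \<noteq> 0" "(SOME w. w \<in> P) = c *s v"
  using mem_proj_point[of "SOME w. w \<in> P" v] someI[of "\<lambda>w. w \<in> P" v] assms by auto

lemma legendre_point_eq_iff [simp]: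
  "legendre_point x y = legendre_point x' y' \<longleftrightarrow> x = x' \<and> y = y'"
proof
  assume "legendre_point x y = legendre_point x' y'"
  then obtain c where "vector [x, y, 1] = c *s (vector [x', y', 1] :: 'a^3)"
    unfolding legendre_point_def using mem_proj_point proj_point_self by metis
  then show "x = x' \<and> y = y'" by (simp add: vec3_eq)
qed simp

lemma legendre_point_neq_origin [simp]: "legendre_point x y \<noteq> legendre_origin"
proof
  assume "legendre_point x y = legendre_origin"
  then obtain c where "vector [x, y, 1] = c *s (vector [0, 1, 0] :: 'a^3)"
    unfolding legendre_point_def legendre_origin_def using mem_proj_point proj_point_self by metis
  then show False by (simp add: vec3_eq)
qed

lemma legendre_coords_point [simp]: "legendre_coords (legendre_point x y) = (x, y)"
  unfolding legendre_coords_def by (rule the_equality) auto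

lemma legendre_point_scale: "z \<noteq> 0 \<Longrightarrow> proj_point (vector [x, y, z]) = legendre_point (x / z) (y / z)"
  unfolding legendre_point_def by (rule proj_point_eqI[of z]) (simp_all add: vec3_eq)

lemma edwards_point_scale:
  "z \<noteq> 0 \<Longrightarrow> x * y = z * t \<Longrightarrow> proj_point (vector [x, y, z, t]) = edwards_point (x / z) (y / z)"
  unfolding edwards_point_def by (rule proj_point_eqI[of z]) (simp_all add: vec4_eq field_simps)

section \<open>Rational functions\<close>

text \<open>The filter of almost all points of \<open>C\<close>: identities that hold off finite
  sets can be combined by \<open>eventually_elim\<close> without naming the sets.\<close>

abbreviation "cofin C \<equiv> inf cofinite (principal C)"

lemma eventually_cofin: "eventually \<phi> (cofin C) \<longleftrightarrow> finite {P \<in> C. \<not> \<phi> P}"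
  by (simp add: eventually_inf_principal eventually_cofinite)

lemma eventually_cofin_in: "\<forall>\<^sub>F P in cofin C. P \<in> C"
  by (simp add: eventually_cofin)

lemma same_rational_function_iff:
  "same_rational_function C f g \<longleftrightarrow> (\<forall>\<^sub>F P in cofin C. f P = g P)"
  by (simp add: same_rational_function_def eventually_cofin)

lemma rational_function_iff:
  "rational_function F C g \<longleftrightarrow> (\<exists>e N D. form F e N \<and> form F e D \<and>
    (\<forall>\<^sub>F P in cofin C. \<forall>v\<in>P. D v \<noteq> 0) \<and> (\<forall>P\<in>C. \<forall>v\<in>P. D v \<noteq> 0 \<longrightarrow> g P = N v / D v))"
  by (simp add: rational_function_def eventually_cofin)

lemma rational_function_const: "1 \<in> F \<Longrightarrow> c \<in> F \<Longrightarrow> rational_function F C (\<lambda>_. c)"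
  unfolding rational_function_iff
  by (intro exI[of _ 0] exI[of _ "\<lambda>_. c"] exI[of _ "\<lambda>_. 1"]) (simp add: form.const)

lemma rational_function_add:
  assumes "rational_function F C f" "rational_function F C g"
  shows "rational_function F C (\<lambda>P. f P + g P)"
proof -
  obtain e N D where 1: "form F e N" "form F e D" "\<forall>\<^sub>F P in cofin C. \<forall>v\<in>P. D v \<noteq> 0"
    "\<forall>P\<in>C. \<forall>v\<in>P. D v \<noteq> 0 \<longrightarrow> f P = N v / D v" using assms(1) unfolding rational_function_iff by blast
  obtain e' N' D' where 2: "form F e' N'" "form F e' D'" "\<forall>\<^sub>F P in cofin C. \<forall>v\<in>P. D' v \<noteq> 0"
    "\<forall>P\<in>C. \<forall>v\<in>P. D' v \<noteq> 0 \<longrightarrow> g P = N' v / D' v" using assms(2) unfolding rational_function_iff by blast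
  have "form F (e + e') (\<lambda>v. N v * D' v + D v * N' v)" by (intro form.add form.mult 1 2)
  moreover have "form F (e + e') (\<lambda>v. D v * D' v)" by (intro form.mult 1 2)
  moreover have "\<forall>\<^sub>F P in cofin C. \<forall>v\<in>P. D v * D' v \<noteq> 0" using 1(3) 2(3) by eventually_elim simp
  moreover have "\<forall>P\<in>C. \<forall>v\<in>P. D v * D' v \<noteq> 0 \<longrightarrow> f P + g P = (N v * D' v + D v * N' v) / (D v * D' v)"
    using 1(4) 2(4) by (auto simp: add_frac_eq mult.commute)
  ultimately show ?thesis unfolding rational_function_iff by blast
qed

lemma rational_function_mult:
  assumes "rational_function F C f" "rational_function F C g"
  shows "rational_function F C (\<lambda>P. f P * g P)"
proof -
  obtain e N D where 1: "form F e N" "form F e D" "\<forall>\<^sub>F P in cofin C. \<forall>v\<in>P. D v \<noteq> 0"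
    "\<forall>P\<in>C. \<forall>v\<in>P. D v \<noteq> 0 \<longrightarrow> f P = N v / D v" using assms(1) unfolding rational_function_iff by blast
  obtain e' N' D' where 2: "form F e' N'" "form F e' D'" "\<forall>\<^sub>F P in cofin C. \<forall>v\<in>P. D' v \<noteq> 0"
    "\<forall>P\<in>C. \<forall>v\<in>P. D' v \<noteq> 0 \<longrightarrow> g P = N' v / D' v" using assms(2) unfolding rational_function_iff by blast
  have "form F (e + e') (\<lambda>v. N v * N' v)" by (intro form.mult 1 2)
  moreover have "form F (e + e') (\<lambda>v. D v * D' v)" by (intro form.mult 1 2)
  moreover have "\<forall>\<^sub>F P in cofin C. \<forall>v\<in>P. D v * D' v \<noteq> 0" using 1(3) 2(3) by eventually_elim simp
  moreover have "\<forall>P\<in>C. \<forall>v\<in>P. D v * D' v \<noteq> 0 \<longrightarrow> f P * g P = (N v * N' v) / (D v * D' v)"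
    using 1(4) 2(4) by auto
  ultimately show ?thesis unfolding rational_function_iff by blast
qed

lemma rational_function_inverse:
  assumes "rational_function F C f" and nz: "\<forall>\<^sub>F P in cofin C. f P \<noteq> 0"
  shows "rational_function F C (\<lambda>P. inverse (f P))"
proof -
  obtain e N D where 1: "form F e N" "form F e D" "\<forall>\<^sub>F P in cofin C. \<forall>v\<in>P. D v \<noteq> 0"
    "\<forall>P\<in>C. \<forall>v\<in>P. D v \<noteq> 0 \<longrightarrow> f P = N v / D v" using assms(1) unfolding rational_function_iff by blast
  \<comment> \<open>The new denominator is \<open>N * D\<close>, not \<open>N\<close>: where
    \<open>D\<close> vanishes the value of \<open>f\<close> is arbitrary, so those points must be
    excluded too.\<close>
  have "form F (e + e) (\<lambda>v. D v * D v)" "form F (e + e) (\<lambda>v. N v * D v)" by (intro form.mult 1)+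
  moreover have "\<forall>\<^sub>F P in cofin C. \<forall>v\<in>P. N v * D v \<noteq> 0"
    using 1(3) nz eventually_cofin_in by eventually_elim (use 1(4) in force)
  moreover have "\<forall>P\<in>C. \<forall>v\<in>P. N v * D v \<noteq> 0 \<longrightarrow> inverse (f P) = (D v * D v) / (N v * D v)"
  proof (intro ballI impI)
    fix P v assume "P \<in> C" "v \<in> P" and "N v * D v \<noteq> 0"
    moreover from this have "f P = N v / D v" using 1(4) by simp
    ultimately show "inverse (f P) = (D v * D v) / (N v * D v)" by simp
  qed
  ultimately show ?thesis unfolding rational_function_iff by blast
qed

text \<open>The quotient does not depend on the chosen representative. Where coordinate
  \<open>j\<close> vanishes it is 0 by default, a value that \<open>rational_function\<close> leaves
  free.\<close>

definition ratio :: "'n \<Rightarrow> 'n \<Rightarrow> ('k::field^'n) set \<Rightarrow> 'k"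
  where "ratio i j P = (let v = SOME v. v \<in> P in v$i / v$j)"

lemma ratio_proj_point: "P = proj_point v \<Longrightarrow> ratio i j P = v$i / v$j"
proof -
  assume "P = proj_point v"
  then obtain c where "c \<noteq> 0" "(SOME w. w \<in> P) = c *s v" by (rule proj_point_some)
  then show ?thesis by (simp add: ratio_def)
qed

lemma rational_function_ratio:
  assumes "\<And>P v. P \<in> C \<Longrightarrow> v \<in> P \<Longrightarrow> P = proj_point v"
    and "\<forall>\<^sub>F P in cofin C. \<forall>v\<in>P. v$j \<noteq> 0"
  shows "rational_function F C (ratio i j)"
  unfolding rational_function_iff
proof (rule exI[of _ 1], rule exI[of _ "\<lambda>v. v$i"], rule exI[of _ "\<lambda>v. v$j"], intro conjI ballI impI)
  show "ratio i j P = v$i / v$j" if "P \<in> C" "v \<in> P" for P v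
    using ratio_proj_point assms(1)[OF that] .
qed (use assms(2) in \<open>simp_all only: form.coord\<close>)

lemma ratio_legendre_point [simp]:
  "ratio 1 3 (legendre_point x y) = x" "ratio 2 3 (legendre_point x y) = y"
  by (simp_all add: ratio_proj_point[OF legendre_point_def])

lemma ratio_edwards_point [simp]:
  "ratio 1 3 (edwards_point x y) = x" "ratio 2 3 (edwards_point x y) = y"
  by (simp_all add: ratio_proj_point[OF edwards_point_def])

section \<open>The two maps\<close>

text \<open>Points have coordinates in the algebraically closed type, while \<open>F\<close> records
  coefficients of forms. Closure under ring operations is asked of \<open>F\<close>: inverting a
  rational function only exchanges its two forms.\<close>

locale edwards_isogeny =
  fixes a d r :: "'k::alg_closed_field" and F :: "'k set"
  assumes nz: "(2::'k) \<noteq> 0" "a \<noteq> 0" "d \<noteq> 0" "a \<noteq> d"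
    and rr: "r^2 = a"
    and F_one: "1 \<in> F" and F_uminus: "x \<in> F \<Longrightarrow> - x \<in> F"
    and F_add: "x \<in> F \<Longrightarrow> y \<in> F \<Longrightarrow> x + y \<in> F"
    and F_mult: "x \<in> F \<Longrightarrow> y \<in> F \<Longrightarrow> x * y \<in> F"
    and F_a: "a \<in> F" and F_d: "d \<in> F" and F_r: "r \<in> F"
begin

abbreviation "E \<equiv> edwards_points a d"
abbreviation "L \<equiv> points (legendre_curve (d / a))"

section \<open>The equations of the Edwards curve\<close>

lemmas E_D = edwards_pointsD[OF nz] and E_I = edwards_pointsI[OF nz] and E_ex = edwards_points_ex[OF nz]
lemmas edwards_eqs_iff = edwards_eqs_def[OF nz]

lemma r0: "r \<noteq> 0" using rr nz by auto

lemma nz4: "(4::'k) \<noteq> 0" using nz(1) by (metis mult_2 numeral_Bit0 mult_eq_0_iff)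

lemma nz8: "(8::'k) \<noteq> 0"
proof -
  have "(8::'k) = 2 * 4" by simp
  then show ?thesis using nz(1) nz4 by (metis mult_eq_0_iff)
qed

text \<open>Multiply the quadric equation by \<open>(v$3)^2\<close> or by \<open>(v$4)^2\<close> and
  substitute \<open>v$3 * v$4 = v$1 * v$2\<close>: this eliminates \<open>v$4\<close> from the first
  relation and \<open>v$3\<close> from the second.\<close>

lemma curve_relations:
  assumes "edwards_eqs a d v"
  shows "(v$2)^2 * ((v$3)^2 - d * (v$1)^2) = (v$3)^2 * ((v$3)^2 - a * (v$1)^2)"
    "(v$1)^2 * ((v$2)^2 - a * (v$4)^2) = (v$4)^2 * ((v$2)^2 - d * (v$4)^2)"
  using assms unfolding edwards_eqs_iff by Groebner_Basis.algebra+

lemma E_zero4: assumes "edwards_eqs a d v" "v \<noteq> 0" "v$4 = 0" shows "v$3 \<noteq> 0"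
  using edwards_nonzero[OF nz assms(2,1)] assms(3) by blast

text \<open>If the factor vanished, \<open>curve_relations\<close> would make its companion with
  \<open>a\<close> and \<open>d\<close> exchanged vanish too; up to sign the two differ by
  \<open>a - d\<close> times a square.\<close>

lemma E_factor_nz:
  assumes "edwards_eqs a d v"
  shows "v$3 \<noteq> 0 \<Longrightarrow> (v$3)^2 - d * (v$1)^2 \<noteq> 0"
    "v$4 \<noteq> 0 \<Longrightarrow> (v$2)^2 - a * (v$4)^2 \<noteq> 0"
proof -
  show "(v$3)^2 - d * (v$1)^2 \<noteq> 0" if "v$3 \<noteq> 0"
  proof
    assume 0: "(v$3)^2 - d * (v$1)^2 = 0"
    have "(v$3)^2 - a * (v$1)^2 = 0"
      using curve_relations(1)[OF assms] that unfolding 0 by (metis mult_eq_0_iff power_not_zero)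
    then have "(a - d) * (v$1)^2 = 0" using 0 by Groebner_Basis.algebra
    then have "v$1 = 0" using nz by auto
    then show False using 0 that by simp
  qed
  show "(v$2)^2 - a * (v$4)^2 \<noteq> 0" if "v$4 \<noteq> 0"
  proof
    assume 0: "(v$2)^2 - a * (v$4)^2 = 0"
    then have "(v$2)^2 - d * (v$4)^2 = 0" using curve_relations(2)[OF assms] that by simp
    then have "(a - d) * (v$4)^2 = 0" using 0 by Groebner_Basis.algebra
    then show False using nz that by simp
  qed
qed

text \<open>On the curve this is zero only at the two points with \<open>v$1 = v$3 = 0\<close>,
  which \<open>psi\<close> sends to \<open>(d / a, 0)\<close>.\<close>

definition psi_vec1 :: "'k^4 \<Rightarrow> 'k^3"
  where "psi_vec1 v = vector [r * v$1 * (v$3)^2, - v$2 * ((v$3)^2 - d * (v$1)^2), a * r * (v$1)^3]"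

text \<open>Rests on \<open>x = v$4 / v$2\<close>. On the curve it is zero only at the two points
  with \<open>v$2 = v$4 = 0\<close>, which \<open>psi\<close> sends to
  \<open>(1, 0)\<close>.\<close>

definition psi_vec2 :: "'k^4 \<Rightarrow> 'k^3"
  where "psi_vec2 v = vector [r * (v$2)^2 * v$4, - v$3 * ((v$2)^2 - a * (v$4)^2), a * r * (v$4)^3]"

definition psi :: "('k^4) set \<Rightarrow> ('k^3) set"
  where "psi P = (let v = SOME v. v \<in> P in
    proj_point (if psi_vec1 v \<noteq> 0 then psi_vec1 v else psi_vec2 v))"

definition phi_D :: "'k^3 \<Rightarrow> 'k"
  where "phi_D w = d * (w$3)^2 - a * (w$1)^2"

text \<open>On the affine curve the numerator and the denominator in the second coordinate of the
  dual are \<open>x * phi_M\<close> and \<open>x * phi_N\<close>; the factor \<open>x\<close> is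
  dropped.\<close>

definition phi_M :: "'k^3 \<Rightarrow> 'k"
  where "phi_M w = a * (w$1)^2 - 2 * a * w$1 * w$3 + d * (w$3)^2"

definition phi_N :: "'k^3 \<Rightarrow> 'k"
  where "phi_N w = a * (w$1)^2 - 2 * d * w$1 * w$3 + d * (w$3)^2"

definition phi_vec :: "'k^3 \<Rightarrow> 'k^4"
  where "phi_vec w = vector [2 * r * w$2 * w$3 * phi_N w, phi_M w * phi_D w, phi_N w * phi_D w,
    2 * r * w$2 * w$3 * phi_M w]"

text \<open>The same map, rewritten by means of \<open>a y\<^sup>2 z = x (x - z) (a x - d z)\<close> so that it is
  defined at the origin.\<close>

definition phi_vec2 :: "'k^3 \<Rightarrow> 'k^4"
  where "phi_vec2 w =
    (let D = 2 * d * w$1 * w$3 - (a + d) * (w$1)^2 - a * (w$2)^2;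
         M = a * (w$2)^2 - (a - d) * (w$1)^2;
         N = a * (w$2)^2 + (a - d) * (w$1)^2
     in vector [2 * r * w$1 * w$2 * N, M * D, N * D, 2 * r * w$1 * w$2 * M])"

definition phi :: "('k^3) set \<Rightarrow> ('k^4) set"
  where "phi Q = (let w = SOME w. w \<in> Q in
    proj_point (if phi_vec w \<noteq> 0 then phi_vec w else phi_vec2 w))"

lemmas phi_DMN = phi_D_def phi_M_def phi_N_def

section \<open>Homogeneity of the vectors, and well-definedness of psi\<close>

lemma psi_vec1_scale: "psi_vec1 (c *s v) = c^3 *s psi_vec1 v"
  by (simp add: psi_vec1_def vec3_eq algebra_simps power2_eq_square power3_eq_cube)

lemma psi_vec2_scale: "psi_vec2 (c *s v) = c^3 *s psi_vec2 v"
  by (simp add: psi_vec2_def vec3_eq algebra_simps power2_eq_square power3_eq_cube)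

lemma phi_vec_scale: "phi_vec (c *s w) = c^4 *s phi_vec w"
  unfolding phi_vec_def phi_DMN vec4_eq vector_smult_component vector_4
  by (intro conjI; Groebner_Basis.algebra)

lemma phi_vec2_scale: "phi_vec2 (c *s w) = c^4 *s phi_vec2 w"
  unfolding phi_vec2_def Let_def vec4_eq vector_smult_component vector_4
  by (intro conjI; Groebner_Basis.algebra)

lemma psi_vec_agree:
  assumes e: "edwards_eqs a d v" and n: "psi_vec1 v \<noteq> 0" "psi_vec2 v \<noteq> 0"
  shows "proj_point (psi_vec1 v) = proj_point (psi_vec2 v)"
proof (cases "v$1 = 0 \<or> v$4 = 0")
  case False
  have xy: "v$1 * v$2 = v$3 * v$4" using e by (simp add: edwards_eqs_iff)
  \<comment> \<open>One name for \<open>v$1 * v$2\<close> and \<open>v$3 * v$4\<close> exposes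
    \<open>p\<close> as a common factor; what remains is a multiple of the quadric equation.\<close>
  define p where "p = v$1 * v$2"
  have p: "v$1 * v$2 = p" "v$3 * v$4 = p" using xy by (simp_all add: p_def)
  have 1: "v$1 * (v$3)^2 * (v$4)^3 = (v$1)^3 * (v$2)^2 * v$4" using xy by Groebner_Basis.algebra
  have "(v$4)^3 * (v$2 * ((v$3)^2 - d * (v$1)^2)) - (v$1)^3 * (v$3 * ((v$2)^2 - a * (v$4)^2)) =
    v$4 * v$2 * (v$3 * v$4)^2 - d * (v$4)^3 * v$1 * (v$1 * v$2)
    - v$1 * v$3 * (v$1 * v$2)^2 + a * (v$1)^3 * v$4 * (v$3 * v$4)" by Groebner_Basis.algebra
  also have "\<dots> = p * (v$4 * v$2 * p - d * (v$4)^3 * v$1 - v$1 * v$3 * p + a * (v$1)^3 * v$4)"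
    unfolding p by Groebner_Basis.algebra
  also have "\<dots> = p * (v$4 * v$2 * (v$1 * v$2) - d * (v$4)^3 * v$1 - v$1 * v$3 * (v$3 * v$4) + a * (v$1)^3 * v$4)"
    unfolding p ..
  also have "\<dots> = p * v$1 * v$4 * ((a * (v$1)^2 + (v$2)^2) - ((v$3)^2 + d * (v$4)^2))" by Groebner_Basis.algebra
  also have "\<dots> = 0" using e by (simp add: edwards_eqs_iff)
  finally have 2: "(v$4)^3 * (v$2 * ((v$3)^2 - d * (v$1)^2)) = (v$1)^3 * (v$3 * ((v$2)^2 - a * (v$4)^2))"
    by simp
  have "(v$4)^3 *s psi_vec1 v = (v$1)^3 *s psi_vec2 v"
    using 1 2 by (simp add: psi_vec1_def psi_vec2_def vec3_eq mult_ac)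
  then show ?thesis using False by (metis proj_point_scale power_not_zero)
next
  case True
  \<comment> \<open>The second case makes \<open>psi_vec1 v\<close> zero and the third makes
    \<open>psi_vec2 v\<close> zero, so only the points \<open>(0, 1)\<close> and
    \<open>(0, -1)\<close> remain.\<close>
  then have "v$1 = 0 \<and> v$4 = 0 \<or> v$1 = 0 \<and> v$3 = 0 \<or> v$4 = 0 \<and> v$2 = 0"
    using e by (auto simp: edwards_eqs_iff)
  then have 0: "v$1 = 0" "v$4 = 0" "v$2 \<noteq> 0" "v$3 \<noteq> 0"
    using n by (auto simp: psi_vec1_def psi_vec2_def vec3_eq)
  then show ?thesis
    by (intro proj_point_eqI[of "v$3 / v$2"])
      (simp_all add: psi_vec1_def psi_vec2_def vec3_eq power2_eq_square)
qed

lemma psi_vec_nz: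
  assumes e: "edwards_eqs a d v" and v: "v \<noteq> 0" and n: "psi_vec1 v = 0"
  shows "psi_vec2 v \<noteq> 0"
proof -
  have 1: "v$1 = 0" using n nz r0 by (simp add: psi_vec1_def vec3_eq)
  have "v$2 \<noteq> 0"
  proof
    assume 2: "v$2 = 0"
    then have "v$3 = 0 \<or> v$4 = 0" "(v$3)^2 + d * (v$4)^2 = 0" using e 1 by (auto simp: edwards_eqs_iff)
    then show False using 1 2 v nz by (auto simp: vec4_eq)
  qed
  then have "v$3 = 0" using 1 n by (simp add: psi_vec1_def vec3_eq)
  then show ?thesis using E_zero4[OF e v] r0 nz by (auto simp: psi_vec2_def vec3_eq)
qed

text \<open>The linear factors of the Legendre cubic pull back to multiples of the factors in
  \<open>curve_relations\<close>, so its equation is one of those relations times a common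
  factor.\<close>

lemma psi_vec_on_curve:
  assumes e: "edwards_eqs a d v" and w: "w \<in> {psi_vec1 v, psi_vec2 v}"
  shows "(w$2)^2 * w$3 = w$1 * (w$1 - w$3) * (w$1 - d / a * w$3)"
proof -
  note c = curve_relations[OF e]
  have xy: "v$1 * v$2 = v$3 * v$4" using e by (simp add: edwards_eqs_iff)
  consider "w = psi_vec1 v" | "w = psi_vec2 v" using w by blast
  then show ?thesis
  proof cases
    case 1
    let ?k = "(v$3)^2 - d * (v$1)^2" and ?m = "(v$3)^2 - a * (v$1)^2"
    have f: "w$1 - w$3 = r * v$1 * ?m" "w$1 - d / a * w$3 = r * v$1 * ?k"
      using nz by (simp_all add: 1 psi_vec1_def algebra_simps power2_eq_square power3_eq_cube)
    have "(w$2)^2 * w$3 = a * r * (v$1)^3 * ((v$2)^2 * ?k) * ?k"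
      unfolding 1 psi_vec1_def vector_3 by Groebner_Basis.algebra
    also have "\<dots> = r^2 * r * (v$1)^3 * ((v$3)^2 * ?m) * ?k" unfolding c(1) rr ..
    also have "\<dots> = w$1 * (r * v$1 * ?m) * (r * v$1 * ?k)"
      unfolding 1 psi_vec1_def vector_3 by Groebner_Basis.algebra
    finally show ?thesis unfolding f .
  next
    case 2
    let ?k = "(v$2)^2 - a * (v$4)^2" and ?m = "(v$2)^2 - d * (v$4)^2"
    have f: "w$1 - w$3 = r * v$4 * ?k" "w$1 - d / a * w$3 = r * v$4 * ?m"
      using nz by (simp_all add: 2 psi_vec2_def algebra_simps power2_eq_square power3_eq_cube)
    have "(w$2)^2 * w$3 = a * r * v$4 * (v$3 * v$4)^2 * ?k^2"
      unfolding 2 psi_vec2_def vector_3 by Groebner_Basis.algebra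
    also have "\<dots> = r^2 * r * v$4 * (v$2)^2 * ?k * ((v$1)^2 * ?k)"
      unfolding xy[symmetric] rr by Groebner_Basis.algebra
    also have "\<dots> = w$1 * (r * v$4 * ?k) * (r * v$4 * ?m)"
      unfolding c(2) 2 psi_vec2_def vector_3 by Groebner_Basis.algebra
    finally show ?thesis unfolding f .
  qed
qed

lemma psi_eq:
  assumes "P \<in> E" "v \<in> P"
  shows "psi_vec1 v \<noteq> 0 \<Longrightarrow> psi P = proj_point (psi_vec1 v)"
    "psi_vec2 v \<noteq> 0 \<Longrightarrow> psi P = proj_point (psi_vec2 v)"
proof -
  note D = E_D[OF assms]
  obtain c where c: "c \<noteq> 0" "(SOME w. w \<in> P) = c *s v" using proj_point_some[OF D(1)] .
  have "psi P = proj_point (if psi_vec1 v \<noteq> 0 then psi_vec1 v else psi_vec2 v)"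
    using c(1) by (simp add: psi_def Let_def c(2) psi_vec1_scale psi_vec2_scale proj_point_scale)
  then show "psi_vec1 v \<noteq> 0 \<Longrightarrow> psi P = proj_point (psi_vec1 v)"
    "psi_vec2 v \<noteq> 0 \<Longrightarrow> psi P = proj_point (psi_vec2 v)"
    using psi_vec_agree[OF D(3)] by (auto split: if_splits)
qed

section \<open>Points of the Legendre curve, and well-definedness of phi\<close>

lemma L_I: "w \<noteq> 0 \<Longrightarrow> (w$2)^2 * w$3 = w$1 * (w$1 - w$3) * (w$1 - d / a * w$3) \<Longrightarrow> proj_point w \<in> L"
  by (auto simp: legendre_curve_def)

lemma L_D:
  assumes "Q \<in> L" "w \<in> Q"
  shows "Q = proj_point w" "w \<noteq> 0" "(w$2)^2 * w$3 = w$1 * (w$1 - w$3) * (w$1 - d / a * w$3)"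
proof -
  obtain u where u: "Q = proj_point u" "u \<noteq> 0" "(u$2)^2 * u$3 = u$1 * (u$1 - u$3) * (u$1 - d / a * u$3)"
    using assms(1) by (auto simp: legendre_curve_def)
  obtain c where c: "c \<noteq> 0" "w = c *s u" using mem_proj_point assms(2) u(1) by blast
  show "Q = proj_point w" "w \<noteq> 0" using c u proj_point_scale by auto
  have "(w$2)^2 * w$3 = c^3 * ((u$2)^2 * u$3)" unfolding c vector_smult_component by Groebner_Basis.algebra
  also have "\<dots> = w$1 * (w$1 - w$3) * (w$1 - d / a * w$3)" unfolding u(3) unfolding c vector_smult_component by Groebner_Basis.algebra
  finally show "(w$2)^2 * w$3 = w$1 * (w$1 - w$3) * (w$1 - d / a * w$3)" .
qed

lemma L_cases:
  assumes "Q \<in> L"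
  obtains "Q = legendre_origin"
    | x y where "Q = legendre_point x y" "a * y^2 = x * (x - 1) * (a * x - d)"
proof -
  obtain w where w: "w \<in> Q"
    using assms proj_point_self unfolding legendre_curve_def elliptic_curve.select_convs by blast
  note D = L_D[OF assms w]
  show ?thesis
  proof (cases "w$3 = 0")
    case True
    then have "w$1 = 0" using D(3) by simp
    then have "Q = legendre_origin" unfolding D(1) legendre_origin_def using D(2) True
      by (intro proj_point_eqI[of "w$2"]) (auto simp: vec3_eq)
    then show ?thesis by (rule that)
  next
    case False
    let ?x = "w$1 / w$3" and ?y = "w$2 / w$3"
    have "w = vector [w$1, w$2, w$3]" by (simp add: vec3_eq)
    then have "Q = legendre_point ?x ?y" using legendre_point_scale[OF False] D(1) by metis
    moreover have "a * ?y^2 = ?x * (?x - 1) * (a * ?x - d)"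
    proof -
      have "a * ?y^2 * (w$3)^3 = a * ((w$2)^2 * w$3)"
        using False by (simp add: field_simps power2_eq_square power3_eq_cube)
      also have "\<dots> = w$1 * (w$1 - w$3) * (a * w$1 - d * w$3)"
        unfolding D(3) using nz by (simp add: field_simps)
      also have "\<dots> = ?x * (?x - 1) * (a * ?x - d) * (w$3)^3"
        using False by (simp add: field_simps power2_eq_square power3_eq_cube)
      finally show ?thesis using False by (metis mult_right_cancel power_not_zero)
    qed
    ultimately show ?thesis by (rule that)
  qed
qed

lemma legendre_point_in_L: "legendre_point x y \<in> L \<longleftrightarrow> a * y^2 = x * (x - 1) * (a * x - d)"
proof
  assume "legendre_point x y \<in> L"
  then show "a * y^2 = x * (x - 1) * (a * x - d)" by (cases rule: L_cases) auto
next
  assume e: "a * y^2 = x * (x - 1) * (a * x - d)"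
  have "y^2 = x * (x - 1) * (x - d / a)"
  proof -
    have "a * y^2 = a * (x * (x - 1) * (x - d / a))" unfolding e using nz by (simp add: field_simps)
    then show ?thesis using nz by simp
  qed
  then show "legendre_point x y \<in> L" unfolding legendre_point_def by (intro L_I) (simp_all add: vec3_eq)
qed

lemma origin_in_L: "legendre_origin \<in> L"
  unfolding legendre_origin_def by (intro L_I) (simp_all add: vec3_eq)

lemma psi_in_L: assumes "P \<in> E" shows "psi P \<in> L"
proof -
  obtain v where v: "v \<in> P" using E_ex assms by blast
  note D = E_D[OF assms v]
  show ?thesis
  proof (cases "psi_vec1 v = 0")
    case True
    from psi_vec_nz[OF D(3,2) this] show ?thesis
      using psi_eq(2)[OF assms v] L_I psi_vec_on_curve[OF D(3)] by simp
  next
    case False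
    then show ?thesis using psi_eq(1)[OF assms v] L_I psi_vec_on_curve[OF D(3)] by simp
  qed
qed

lemma phi_rel:
  assumes "(w$2)^2 * w$3 = w$1 * (w$1 - w$3) * (w$1 - d / a * w$3)"
  shows "a * ((w$2)^2 * w$3) = w$1 * (w$1 - w$3) * (a * w$1 - d * w$3)"
  unfolding assms using nz by (simp add: field_simps)

text \<open>The vector has the shape \<open>(s * N, M * D, N * D, s * M)\<close> with
  \<open>s = 2 * r * y * z\<close>. The product equation is then automatic, and the quadric becomes
  \<open>s^2 * (a * N^2 - d * M^2) = D^2 * (N^2 - M^2)\<close>.\<close>

lemma phi_vec_on_curve:
  assumes "(w$2)^2 * w$3 = w$1 * (w$1 - w$3) * (w$1 - d / a * w$3)"
  shows "edwards_eqs a d (phi_vec w)"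
proof -
  define x y z where xyz: "x = w$1" "y = w$2" "z = w$3"
  define D M N where DMN: "D = phi_D w" "M = phi_M w" "N = phi_N w"
  have v: "phi_vec w = vector [2 * r * y * z * N, M * D, N * D, 2 * r * y * z * M]"
    by (simp add: phi_vec_def xyz DMN)
  note 0 = phi_rel[OF assms, folded xyz]
  have 1: "N^2 - M^2 = 4 * (a - d) * z * (x * (x - z) * (a * x - d * z))"
    unfolding DMN phi_DMN xyz[symmetric] by Groebner_Basis.algebra
  have 2: "a * N^2 - d * M^2 = (a - d) * D^2"
    unfolding DMN phi_DMN xyz[symmetric] by Groebner_Basis.algebra
  have "a * (2 * r * y * z * N)^2 + (M * D)^2 - ((N * D)^2 + d * (2 * r * y * z * M)^2) =
     4 * r^2 * y^2 * z^2 * (a * N^2 - d * M^2) - D^2 * (N^2 - M^2)" by Groebner_Basis.algebra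
  also have "\<dots> = 0" unfolding 1 2 rr 0[symmetric] by Groebner_Basis.algebra
  finally show ?thesis unfolding edwards_eqs_iff v vector_4 by (simp add: mult_ac)
qed

text \<open>If \<open>w$2\<close> is nonzero, \<open>phi_M\<close> and \<open>phi_N\<close> would
  vanish together although they differ by \<open>2 * (a - d) * w$1 * w$3\<close>. Otherwise the
  point is one of three 2-torsion points, where \<open>phi_M * phi_D\<close> can be
  evaluated.\<close>

lemma phi_vec_nz:
  assumes z: "w$3 \<noteq> 0" and e: "(w$2)^2 * w$3 = w$1 * (w$1 - w$3) * (w$1 - d / a * w$3)"
  shows "phi_vec w \<noteq> 0"
proof
  assume 0: "phi_vec w = 0"
  note e = phi_rel[OF e]
  have v: "w$2 \<noteq> 0 \<Longrightarrow> phi_N w = 0" "w$2 \<noteq> 0 \<Longrightarrow> phi_M w = 0" "phi_M w * phi_D w = 0"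
    using 0 z nz r0 by (auto simp: phi_vec_def vec4_eq)
  have "w$2 = 0"
  proof (rule ccontr)
    assume y: "w$2 \<noteq> 0"
    have "phi_N w - phi_M w = 2 * (a - d) * w$1 * w$3" unfolding phi_DMN by Groebner_Basis.algebra
    then have "w$1 = 0" using v y z nz by simp
    then show False using e y z nz by simp
  qed
  then consider "w$1 = 0" | "w$1 = w$3" | "a * w$1 = d * w$3" using e by auto
  then show False
  proof cases
    case 1
    then show ?thesis using v(3) z nz by (simp add: phi_DMN)
  next
    case 2
    have "phi_M w * phi_D w = (a - d)^2 * (w$3)^4" unfolding phi_DMN 2 by Groebner_Basis.algebra
    then show ?thesis using v(3) z nz by simp
  next
    case 3
    have "a^2 * (phi_M w * phi_D w) = ((a * w$1)^2 - 2 * a * w$3 * (a * w$1) + a * d * (w$3)^2) *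
      (a * d * (w$3)^2 - (a * w$1)^2)" unfolding phi_DMN by Groebner_Basis.algebra
    also have "\<dots> = - (d^2 * (a - d)^2 * (w$3)^4)" unfolding 3 by Groebner_Basis.algebra
    finally show ?thesis using v(3) z nz by simp
  qed
qed

lemma phi_vec_agree:
  assumes e: "(w$2)^2 * w$3 = w$1 * (w$1 - w$3) * (w$1 - d / a * w$3)"
    and n: "phi_vec w \<noteq> 0" "phi_vec2 w \<noteq> 0"
  shows "proj_point (phi_vec w) = proj_point (phi_vec2 w)"
proof -
  note p = phi_rel[OF e]
  let ?D = "2 * d * w$1 * w$3 - (a + d) * (w$1)^2 - a * (w$2)^2"
  let ?M = "a * (w$2)^2 - (a - d) * (w$1)^2"
  let ?N = "a * (w$2)^2 + (a - d) * (w$1)^2"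
  \<comment> \<open>\<open>phi_vec\<close> is zero at the origin and \<open>phi_vec2\<close> at
    \<open>(0, 0)\<close>, so neither point occurs here.\<close>
  have z: "w$3 \<noteq> 0"
  proof
    assume z: "w$3 = 0"
    then have "w$1 = 0" using e by simp
    then show False using n(1) z by (simp add: phi_vec_def phi_DMN vec4_eq)
  qed
  have x: "w$1 \<noteq> 0"
  proof
    assume x: "w$1 = 0"
    then have "w$2 = 0" using e z by simp
    then show False using n(2) x by (simp add: phi_vec2_def Let_def vec4_eq)
  qed
  \<comment> \<open>Modulo the cubic, passing to the second version multiplies each quadratic form
    by \<open>w$1 / w$3\<close>; hence the vectors differ by the square of that factor.\<close>
  have D: "w$1 * phi_D w = w$3 * ?D" and M: "w$1 * phi_M w = w$3 * ?M" and N: "w$1 * phi_N w = w$3 * ?N"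
    using p unfolding phi_DMN by Groebner_Basis.algebra+
  have v: "phi_vec2 w = vector [2 * r * w$1 * w$2 * ?N, ?M * ?D, ?N * ?D, 2 * r * w$1 * w$2 * ?M]"
    by (simp add: phi_vec2_def Let_def)
  have "(w$1)^2 * (2 * r * w$2 * w$3 * phi_N w) = 2 * r * w$1 * w$2 * w$3 * (w$1 * phi_N w)"
    "(w$1)^2 * (phi_M w * phi_D w) = (w$1 * phi_M w) * (w$1 * phi_D w)"
    "(w$1)^2 * (phi_N w * phi_D w) = (w$1 * phi_N w) * (w$1 * phi_D w)"
    "(w$1)^2 * (2 * r * w$2 * w$3 * phi_M w) = 2 * r * w$1 * w$2 * w$3 * (w$1 * phi_M w)"
    by Groebner_Basis.algebra+
  then have "(w$1)^2 *s phi_vec w = (w$3)^2 *s phi_vec2 w"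
    unfolding D M N v phi_vec_def vec4_eq vector_smult_component vector_4
    by (simp add: power2_eq_square mult_ac)
  then show ?thesis using x z by (metis proj_point_scale power_not_zero)
qed

lemma phi_eq:
  assumes "Q \<in> L" "w \<in> Q"
  shows "phi_vec w \<noteq> 0 \<Longrightarrow> phi Q = proj_point (phi_vec w)"
    "phi_vec2 w \<noteq> 0 \<Longrightarrow> phi Q = proj_point (phi_vec2 w)"
proof -
  note D = L_D[OF assms]
  obtain c where c: "c \<noteq> 0" "(SOME w. w \<in> Q) = c *s w" using proj_point_some[OF D(1)] .
  have "phi Q = proj_point (if phi_vec w \<noteq> 0 then phi_vec w else phi_vec2 w)"
    using c(1) by (simp add: phi_def Let_def c(2) phi_vec_scale phi_vec2_scale proj_point_scale)
  then show "phi_vec w \<noteq> 0 \<Longrightarrow> phi Q = proj_point (phi_vec w)"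
    "phi_vec2 w \<noteq> 0 \<Longrightarrow> phi Q = proj_point (phi_vec2 w)"
    using phi_vec_agree[OF D(3)] by (auto split: if_splits)
qed

lemma phi_origin: "phi legendre_origin = edwards_point 0 1"
proof -
  let ?w = "vector [0, 1, 0] :: 'k^3"
  have v: "phi_vec2 ?w = - (a^2) *s vector [0, 1, 1, 0]"
    by (simp add: phi_vec2_def vec4_eq power2_eq_square)
  have "phi_vec2 ?w \<noteq> 0" unfolding v using nz by (simp add: vec4_eq)
  moreover have "?w \<in> legendre_origin" by (simp add: legendre_origin_def)
  ultimately have "phi legendre_origin = proj_point (phi_vec2 ?w)"
    using phi_eq(2)[OF origin_in_L] by blast
  then have "phi legendre_origin = proj_point (vector [0, 1, 1, 0])"
    unfolding v using nz by (subst (asm) proj_point_scale) simp_all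
  then show ?thesis by (simp add: edwards_point_def)
qed

lemma phi_legendre_point:
  assumes "legendre_point x y \<in> L"
  shows "phi (legendre_point x y) = proj_point (phi_vec (vector [x, y, 1]))"
    "phi_vec (vector [x, y, 1]) \<noteq> 0" "edwards_eqs a d (phi_vec (vector [x, y, 1]))"
proof -
  let ?w = "vector [x, y, 1] :: 'k^3"
  have m: "?w \<in> legendre_point x y" by (simp add: legendre_point_def)
  note D = L_D[OF assms m]
  show nz': "phi_vec ?w \<noteq> 0" by (rule phi_vec_nz[OF _ D(3)]) simp
  show "phi (legendre_point x y) = proj_point (phi_vec ?w)" by (rule phi_eq(1)[OF assms m nz'])
  show "edwards_eqs a d (phi_vec ?w)" by (rule phi_vec_on_curve[OF D(3)])
qed

lemma edwards_point_in_E: "edwards_point x y \<in> E \<longleftrightarrow> a * x^2 + y^2 = 1 + d * x^2 * y^2"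
proof
  assume "edwards_point x y \<in> E"
  then have "edwards_eqs a d (vector [x, y, 1, x * y])"
    using E_D(3) by (simp add: edwards_point_def)
  then show "a * x^2 + y^2 = 1 + d * x^2 * y^2"
    by (simp add: edwards_eqs_iff power_mult_distrib mult.assoc)
next
  assume "a * x^2 + y^2 = 1 + d * x^2 * y^2"
  then show "edwards_point x y \<in> E" unfolding edwards_point_def
    by (intro E_I) (simp_all add: edwards_eqs_iff power_mult_distrib mult.assoc vec4_eq)
qed

lemma phi_in_E: assumes "Q \<in> L" shows "phi Q \<in> E"
  using assms
proof (cases rule: L_cases)
  case 1
  then show ?thesis by (simp add: phi_origin edwards_point_in_E)
next
  case (2 x y)
  then have "legendre_point x y \<in> L" using assms by simp
  from phi_legendre_point[OF this] show ?thesis using E_I 2 by simp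
qed

section \<open>Duality\<close>

lemma origin_in_E: "edwards_point 0 1 \<in> E"
  by (simp add: edwards_point_in_E)

lemma edwards_point_0: "edwards_point 0 y = proj_point (vector [0, y, 1, 0])"
  by (simp add: edwards_point_def)

lemma psi_edwards_point_0:
  assumes "edwards_point 0 y \<in> E"
  shows "psi (edwards_point 0 y) = legendre_origin"
proof -
  have y: "y \<noteq> 0" using assms by (auto simp: edwards_point_in_E)
  have v: "psi_vec1 (vector [0, y, 1, 0]) = (- y) *s vector [0, 1, 0]"
    by (simp add: psi_vec1_def vec3_eq)
  have "psi (edwards_point 0 y) = proj_point (psi_vec1 (vector [0, y, 1, 0]))"
    by (rule psi_eq(1)[OF assms]) (use y in \<open>simp_all add: edwards_point_0 v vec3_eq\<close>)
  then show ?thesis unfolding v legendre_origin_def using y by (subst (asm) proj_point_scale) simp_all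
qed

lemma psi_edwards_point:
  assumes e: "edwards_point x y \<in> E" and x: "x \<noteq> 0"
  shows "psi (edwards_point x y) = legendre_point (1 / (a * x^2)) (- y * (1 - d * x^2) / (a * r * x^3))"
proof -
  let ?v = "vector [x, y, 1, x * y]"
  have v: "psi_vec1 ?v = vector [r * x, - y * (1 - d * x^2), a * r * x^3]"
    by (simp add: psi_vec1_def)
  have nz3: "a * r * x^3 \<noteq> 0" using x r0 nz by simp
  have "psi (edwards_point x y) = proj_point (psi_vec1 ?v)"
    by (rule psi_eq(1)[OF e]) (use nz3 in \<open>simp_all add: edwards_point_def v vec3_eq\<close>)
  also have "\<dots> = legendre_point (r * x / (a * r * x^3)) (- y * (1 - d * x^2) / (a * r * x^3))"
    unfolding v by (rule legendre_point_scale[OF nz3])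
  also have "r * x / (a * r * x^3) = 1 / (a * x^2)"
    using x r0 nz by (simp add: power2_eq_square power3_eq_cube)
  finally show ?thesis .
qed

lemma psi_formula:
  assumes e: "edwards_point x y \<in> E" and x: "x \<noteq> 0"
  shows "psi (edwards_point x y) =
    legendre_point (1 / (a * x^2)) (y * (d - a) / (a * r * x * (1 - y^2)))"
proof -
  have eq: "a * x^2 + y^2 = 1 + d * x^2 * y^2" using e by (simp add: edwards_point_in_E)
  have k: "1 - d * x^2 \<noteq> 0"
  proof
    assume 0: "1 - d * x^2 = 0"
    then have "a * x^2 = d * x^2" using eq by Groebner_Basis.algebra
    then show False using x nz by simp
  qed
  \<comment> \<open>The curve equation in factored form; the right side is nonzero, hence so are
    both factors.\<close>
  have 1: "(1 - y^2) * (1 - d * x^2) = x^2 * (a - d)" using eq by Groebner_Basis.algebra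
  have n: "1 - y^2 \<noteq> 0"
  proof
    assume "1 - y^2 = 0"
    then show False using 1 x nz by auto
  qed
  have "- y * (1 - d * x^2) * (a * r * x * (1 - y^2)) = - y * a * r * x * ((1 - y^2) * (1 - d * x^2))"
    by Groebner_Basis.algebra
  also have "\<dots> = y * (d - a) * (a * r * x^3)" unfolding 1 by Groebner_Basis.algebra
  finally have "- y * (1 - d * x^2) / (a * r * x^3) = y * (d - a) / (a * r * x * (1 - y^2))"
    using x n r0 nz by (subst frac_eq_eq) auto
  then show ?thesis using psi_edwards_point[OF e x] by simp
qed

lemma phi_formula:
  assumes L: "legendre_point x y \<in> L"
    and D: "d - a * x^2 \<noteq> 0" and N: "a * y^2 + x^2 * (a - d) \<noteq> 0"
  shows "phi (legendre_point x y) = edwards_point (2 * r * y / (d - a * x^2))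
    ((a * y^2 - x^2 * (a - d)) / (a * y^2 + x^2 * (a - d)))"
proof -
  let ?w = "vector [x, y, 1] :: 'k^3"
  define M' N' where "M' = a * x^2 - 2 * a * x + d" and "N' = a * x^2 - 2 * d * x + d"
  have e: "a * y^2 = x * (x - 1) * (a * x - d)" using L by (simp add: legendre_point_in_L)
  have N1: "a * y^2 + x^2 * (a - d) = x * N'" and M1: "a * y^2 - x^2 * (a - d) = x * M'"
    unfolding e N'_def M'_def by Groebner_Basis.algebra+
  have x: "x \<noteq> 0" and n: "N' \<noteq> 0" using N unfolding N1 by auto
  have v: "phi_vec ?w = vector [2 * r * y * N', M' * (d - a * x^2), N' * (d - a * x^2), 2 * r * y * M']"
    by (simp add: phi_vec_def phi_DMN M'_def N'_def)
  have "phi (legendre_point x y) = edwards_point (2 * r * y * N' / (N' * (d - a * x^2)))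
      (M' * (d - a * x^2) / (N' * (d - a * x^2)))"
    unfolding phi_legendre_point(1)[OF L] v
    by (rule edwards_point_scale) (use n D in \<open>simp_all add: mult_ac\<close>)
  then show ?thesis unfolding N1 M1 using x n D by simp
qed


section \<open>Doubling on the Edwards curve\<close>

lemma edwards_plus_origin:
  assumes P: "P \<in> E"
  shows "edwards_plus a d P (edwards_point 0 1) = P"
proof -
  let ?v = "SOME v. v \<in> P" and ?o = "SOME w :: 'k^4. w \<in> edwards_point 0 1"
  have v: "?v \<in> P" using E_ex[OF P] by (rule someI_ex)
  note D = E_D[OF P v]
  obtain c :: 'k where c: "c \<noteq> 0" "?o = c *s vector [0, 1, 1, 0]"
    using proj_point_some[OF edwards_point_0[of 1]] .
  have xy: "?v$1 * ?v$2 = ?v$3 * ?v$4" using D(3) by (simp add: edwards_eqs_iff)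
  \<comment> \<open>The two addition laws return the point scaled by its third and by its fourth
    coordinate, which do not vanish together.\<close>
  have 1: "edwards_sum1 a d ?v ?o = (c^2 * ?v$3) *s ?v"
    unfolding c(2) using xy by (simp add: edwards_sum1_def vec4_eq power2_eq_square mult_ac)
  have 2: "edwards_sum2 a ?v ?o = (c^2 * ?v$4) *s ?v"
    unfolding c(2) using xy by (simp add: edwards_sum2_def vec4_eq power2_eq_square mult_ac)
  have s: "edwards_plus a d P (edwards_point 0 1) =
    (if edwards_sum1 a d ?v ?o \<noteq> 0 then proj_point (edwards_sum1 a d ?v ?o)
     else proj_point (edwards_sum2 a ?v ?o))"
    by (simp add: edwards_plus_def Let_def)
  show ?thesis
  proof (cases "?v$3 = 0")
    case False
    then show ?thesis unfolding s 1 using c(1) D by (simp add: proj_point_scale)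
  next
    case True
    then have "?v$4 \<noteq> 0" using E_zero4[OF D(3,2)] by blast
    then show ?thesis unfolding s 1 2 using True c(1) D by (simp add: proj_point_scale)
  qed
qed

lemma edwards_sum1_self:
  "edwards_sum1 a d v v =
    vector [2 * (v$1 * v$2) * ((v$3)^2 - d * (v$4)^2),
      ((v$2)^2 - a * (v$1)^2) * ((v$3)^2 + d * (v$4)^2),
      ((v$3)^2 + d * (v$4)^2) * ((v$3)^2 - d * (v$4)^2),
      2 * (v$1 * v$2) * ((v$2)^2 - a * (v$1)^2)]"
  unfolding edwards_sum1_def Let_def vec4_eq vector_4 by (intro conjI; Groebner_Basis.algebra)

text \<open>Doubling is always given by the first law. If \<open>D = 0\<close>, then
  \<open>C\<close> is nonzero, so \<open>B = 0\<close>, and squaring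
  \<open>v$1 * v$2 = v$3 * v$4\<close> forces \<open>a = d\<close>. If \<open>C = 0\<close> instead,
  then \<open>A = 0\<close> makes \<open>v$3\<close> or \<open>v$4\<close> zero, hence both.\<close>

lemma edwards_sum1_double_nz:
  assumes e: "edwards_eqs a d v" and v: "v \<noteq> 0"
  shows "edwards_sum1 a d v v \<noteq> 0"
proof
  assume 0: "edwards_sum1 a d v v = 0"
  let ?A = "2 * (v$1 * v$2)" and ?B = "(v$2)^2 - a * (v$1)^2"
  let ?C = "(v$3)^2 + d * (v$4)^2" and ?D = "(v$3)^2 - d * (v$4)^2"
  have z: "?A * ?D = 0" "?B * ?C = 0" "?C * ?D = 0" "?A * ?B = 0"
    using 0 unfolding edwards_sum1_self vec4_eq vector_4 zero_index by blast+
  have xy: "v$1 * v$2 = v$3 * v$4" and q: "a * (v$1)^2 + (v$2)^2 = ?C"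
    using e by (auto simp: edwards_eqs_iff)
  have zt: "v$3 \<noteq> 0 \<or> v$4 \<noteq> 0" using E_zero4[OF e v] by blast
  show False
  proof (cases "?D = 0")
    case True
    then have D: "(v$3)^2 = d * (v$4)^2" by simp
    have t: "v$4 \<noteq> 0" using zt D nz by auto
    have "?C = 2 * d * (v$4)^2" using D by simp
    then have "?C \<noteq> 0" using t nz by simp
    then have B: "(v$2)^2 = a * (v$1)^2" using z(2) by simp
    have "2 * (a * (v$1)^2) = 2 * (d * (v$4)^2)" using q D B by simp
    then have x: "a * (v$1)^2 = d * (v$4)^2" using nz(1) by simp
    have "(a * (v$1)^2)^2 = a * (v$1 * v$2)^2" using B by Groebner_Basis.algebra
    also have "\<dots> = a * d * (v$4)^4" unfolding xy using D by Groebner_Basis.algebra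
    finally have "(d * d - a * d) * (v$4)^4 = 0" unfolding x by Groebner_Basis.algebra
    then show False using t nz by (simp flip: left_diff_distrib)
  next
    case False
    then have C: "?C = 0" and A: "v$1 * v$2 = 0" using z nz by auto
    then have "v$3 = 0 \<or> v$4 = 0" using xy by simp
    then show False using zt C nz by auto
  qed
qed

lemma edwards_double:
  assumes P: "P \<in> E" and v: "v \<in> P"
  shows "edwards_plus a d P P = proj_point (edwards_sum1 a d v v)"
proof -
  let ?v = "SOME v. v \<in> P"
  have vP: "?v \<in> P" using E_ex[OF P] by (rule someI_ex)
  note D = E_D[OF P vP]
  obtain c where c: "c \<noteq> 0" "?v = c *s v"
    using proj_point_some[OF E_D(1)[OF P v]] .
  have "edwards_plus a d P P = proj_point (edwards_sum1 a d ?v ?v)"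
    using edwards_sum1_double_nz[OF D(3,2)] by (simp add: edwards_plus_def Let_def)
  also have "edwards_sum1 a d ?v ?v = c^4 *s edwards_sum1 a d v v"
    unfolding c(2) edwards_sum1_def Let_def vec4_eq vector_smult_component vector_4
    by (intro conjI; Groebner_Basis.algebra)
  finally show ?thesis using c(1) by (simp add: proj_point_scale)
qed

lemma phi_psi_double:
  assumes P: "P \<in> E"
  shows "phi (psi P) = edwards_plus a d P P"
proof -
  obtain v where v: "v \<in> P" using E_ex P by blast
  note E = E_D[OF P v]
  define x y z t where xyzt: "x = v$1" "y = v$2" "z = v$3" "t = v$4"
  let ?A = "2 * (x * y)" and ?B = "y^2 - a * x^2" and ?C = "z^2 + d * t^2" and ?D = "z^2 - d * t^2"
  have s: "edwards_sum1 a d v v = vector [?A * ?D, ?B * ?C, ?C * ?D, ?A * ?B]"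
    unfolding edwards_sum1_self xyzt ..
  have dbl: "edwards_plus a d P P = proj_point (edwards_sum1 a d v v)" by (rule edwards_double[OF P v])
  have xy: "x * y = z * t" and q: "a * x^2 + y^2 = z^2 + d * t^2"
    using E(3) by (auto simp: edwards_eqs_iff xyzt)
  note psiL = psi_in_L[OF P]
  show ?thesis
  proof (cases "t = 0")
    case False
    let ?k = "y^2 - a * t^2"
    have k: "?k \<noteq> 0" using E_factor_nz(2)[OF E(3)] False by (simp add: xyzt)
    have r: "x^2 * ?k = t^2 * (y^2 - d * t^2)"
      using curve_relations(2)[OF E(3)] by (simp add: xyzt)
    \<comment> \<open>Multiplication by \<open>?k\<close> turns the forms of the doubling law into
      polynomials in \<open>y\<close> and \<open>t\<close>, as are the first and third coordinates
      of \<open>psi_vec2 v\<close>; so \<open>?C\<close>, \<open>?D\<close>, \<open>?B\<close> can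
      be matched with \<open>phi_D\<close>, \<open>phi_N\<close>, \<open>phi_M\<close>.\<close>
    have "t^2 * (?C * ?k) = t^2 * (y^4 - a * d * t^4)" "t^2 * (?D * ?k) = t^2 * (y^4 - 2 * d * y^2 * t^2 + a * d * t^4)"
      "t^2 * (?B * ?k) = t^2 * (y^4 - 2 * a * y^2 * t^2 + a * d * t^4)"
      using xy r by Groebner_Basis.algebra+
    then have C: "?C * ?k = y^4 - a * d * t^4" and D: "?D * ?k = y^4 - 2 * d * y^2 * t^2 + a * d * t^4"
      and B: "?B * ?k = y^4 - 2 * a * y^2 * t^2 + a * d * t^4" using False by simp_all
    let ?w = "psi_vec2 v"
    have w: "?w = vector [r * y^2 * t, - z * ?k, a * r * t^3]" by (simp add: psi_vec2_def xyzt)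
    have w3: "?w$3 \<noteq> 0" unfolding w using False r0 nz by simp
    then have wn: "?w \<noteq> 0" by auto
    have psi: "psi P = proj_point ?w" by (rule psi_eq(2)[OF P v wn])
    have wP: "?w \<in> psi P" unfolding psi by simp
    have "phi_vec ?w \<noteq> 0" by (rule phi_vec_nz[OF w3 L_D(3)[OF psiL wP]])
    then have phi: "phi (psi P) = proj_point (phi_vec ?w)" using phi_eq(1)[OF psiL wP] by blast
    have "phi_D ?w = - (a^2 * t^2 * (?C * ?k))" "phi_N ?w = a^2 * t^2 * (?D * ?k)"
      "phi_M ?w = a^2 * t^2 * (?B * ?k)"
      unfolding B C D w phi_DMN vector_3 unfolding rr[symmetric] by Groebner_Basis.algebra+
    then have "phi_vec ?w = (- (a^4 * t^4 * ?k^2)) *s edwards_sum1 a d v v"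
      unfolding phi_vec_def s xy vec4_eq vector_smult_component vector_4
      unfolding w vector_3 unfolding rr[symmetric]
      by (intro conjI; Groebner_Basis.algebra)
    from proj_point_eqI[OF _ this] show ?thesis unfolding phi dbl using False nz k by simp
  next
    case True
    then have z: "z \<noteq> 0" using E_zero4[OF E(3,2)] by (simp add: xyzt)
    have v': "v = vector [x, y, z, t]" by (simp add: vec4_eq xyzt)
    show ?thesis
    proof (cases "x = 0")
      \<comment> \<open>The points \<open>(0, 1)\<close> and \<open>(0, -1)\<close>:
        \<open>psi\<close> sends both to the origin, and both double to the origin.\<close>
      case x: True
      have P': "P = edwards_point 0 (y / z)"
        unfolding E(1) using v' edwards_point_scale[of z x y t] z x True by simp
      have yz: "y^2 = z^2" using q x True by simp
      have "edwards_sum1 a d v v = z^4 *s vector [0, 1, 1, 0]"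
        unfolding s vec4_eq using x True yz by (simp flip: power_add power_mult)
      then have "edwards_plus a d P P = edwards_point 0 1"
        unfolding dbl edwards_point_0 using z by (simp add: proj_point_scale)
      then show ?thesis using psi_edwards_point_0 phi_origin P P' by metis
    next
      \<comment> \<open>The points \<open>(1 / r, 0)\<close> and \<open>(- 1 / r, 0)\<close>: their
        image under \<open>psi\<close> is \<open>(1, 0)\<close> and their double is
        \<open>(0, -1)\<close>.\<close>
      case x: False
      then have y: "y = 0" using xy True by simp
      have q': "a * x^2 = z^2" using q y True by simp
      have P': "P = edwards_point (x / z) 0"
        unfolding E(1) using v' edwards_point_scale[of z x y t] z y True by simp
      have "psi P = legendre_point (1 / (a * (x / z)^2)) 0"
        using psi_edwards_point[of "x / z" 0] P P' x z by simp
      also have "1 / (a * (x / z)^2) = 1" using q' x z nz by (simp add: power_divide)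
      finally have psi1: "psi P = legendre_point 1 0" .
      have "phi_vec (vector [1, 0, 1]) = (d - a)^2 *s vector [0, 1, -1, 0]"
        by (simp add: phi_vec_def phi_DMN vec4_eq power2_eq_square algebra_simps)
      then have 1: "phi (psi P) = proj_point (vector [0, 1, -1, 0])"
        unfolding psi1 using phi_legendre_point(1)[of 1 0] psiL psi1 nz
        by (simp add: proj_point_scale)
      have "edwards_sum1 a d v v = (- (z^4)) *s vector [0, 1, -1, 0]"
        unfolding s vec4_eq using y True q' by (simp flip: power_add power_mult)
      from proj_point_eqI[OF _ this] show ?thesis unfolding 1 dbl using z by simp
    qed
  qed
qed

section \<open>Doubling on the Legendre curve\<close>

lemma psi_phi_legendre_point:
  assumes L: "legendre_point x y \<in> L" and y: "y \<noteq> 0"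
  defines "w \<equiv> vector [x, y, 1] :: 'k^3"
  shows "psi (phi (legendre_point x y)) =
    legendre_point ((phi_D w)^2 / (4 * a^2 * y^2)) (- (phi_M w * phi_N w * phi_D w) / (8 * a^3 * y^3))"
proof -
  define D M N where DMN: "D = phi_D w" "M = phi_M w" "N = phi_N w"
  have e: "a * y^2 = x * (x - 1) * (a * x - d)" using L by (simp add: legendre_point_in_L)
  \<comment> \<open>Subtracting \<open>d / a\<close> or 1 from the abscissa
    \<open>D^2 / (4 * a^2 * y^2)\<close> leaves a square, with numerator \<open>N^2\<close> or
    \<open>M^2\<close>.\<close>
  have hN: "D^2 - 4 * d * (a * y^2) = N^2" and hM: "D^2 - 4 * a * (a * y^2) = M^2"
    unfolding e DMN phi_DMN w_def vector_3 power_one mult_1_right by Groebner_Basis.algebra+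
  let ?v = "phi_vec w"
  have v: "?v = vector [2 * r * y * N, M * D, N * D, 2 * r * y * M]"
    by (simp add: phi_vec_def w_def DMN)
  note p = phi_legendre_point[OF L, folded w_def]
  \<comment> \<open>Both vectors for \<open>psi\<close> are multiples of this one, with factors
    \<open>N^3\<close> and \<open>M^3\<close>; since \<open>M\<close> and \<open>N\<close> do not
    vanish together, one of them can be used.\<close>
  let ?U = "vector [2 * a * y * D^2, - (M * N * D), 8 * a^3 * y^3] :: 'k^3"
  have 1: "psi_vec1 ?v = N^3 *s ?U"
  proof -
    have "- (M * D) * ((N * D)^2 - d * (2 * r * y * N)^2) = - (M * D) * N^2 * (D^2 - 4 * d * (r^2 * y^2))"
      by Groebner_Basis.algebra
    also have "\<dots> = N^3 * (- (M * N * D))" unfolding rr hN by Groebner_Basis.algebra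
    finally have h: "- (M * D) * ((N * D)^2 - d * (2 * r * y * N)^2) = N^3 * (- (M * N * D))" .
    show ?thesis unfolding psi_vec1_def v vec3_eq vector_smult_component vector_3 vector_4
      unfolding rr[symmetric] by (intro conjI; (rule h[folded rr] | Groebner_Basis.algebra))
  qed
  have 2: "psi_vec2 ?v = M^3 *s ?U"
  proof -
    have "- (N * D) * ((M * D)^2 - a * (2 * r * y * M)^2) = - (N * D) * M^2 * (D^2 - 4 * a * (r^2 * y^2))"
      by Groebner_Basis.algebra
    also have "\<dots> = M^3 * (- (M * N * D))" unfolding rr hM by Groebner_Basis.algebra
    finally have h: "- (N * D) * ((M * D)^2 - a * (2 * r * y * M)^2) = M^3 * (- (M * N * D))" .
    show ?thesis unfolding psi_vec2_def v vec3_eq vector_smult_component vector_3 vector_4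
      unfolding rr[symmetric] by (intro conjI; (rule h[folded rr] | Groebner_Basis.algebra))
  qed
  have z: "8 * a^3 * y^3 \<noteq> 0" using nz nz8 y by simp
  then have U: "?U \<noteq> 0" by (auto simp: vec3_eq)
  have P: "phi (legendre_point x y) \<in> E" by (rule phi_in_E[OF L])
  have vP: "?v \<in> phi (legendre_point x y)" unfolding p(1) by simp
  have "M \<noteq> 0 \<or> N \<noteq> 0" using p(2) unfolding v by (auto simp: vec4_eq)
  then have "psi (phi (legendre_point x y)) = proj_point ?U"
  proof
    assume n: "N \<noteq> 0"
    then have "psi_vec1 ?v \<noteq> 0" unfolding 1 using U by simp
    from psi_eq(1)[OF P vP this] show ?thesis unfolding 1 using n by (simp add: proj_point_scale)
  next
    assume n: "M \<noteq> 0"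
    then have "psi_vec2 ?v \<noteq> 0" unfolding 2 using U by simp
    from psi_eq(2)[OF P vP this] show ?thesis unfolding 2 using n by (simp add: proj_point_scale)
  qed
  also have "\<dots> = legendre_point (2 * a * y * D^2 / (8 * a^3 * y^3)) (- (M * N * D) / (8 * a^3 * y^3))"
    by (rule legendre_point_scale[OF z])
  also have "2 * a * y * D^2 / (8 * a^3 * y^3) = D^2 / (4 * a^2 * y^2)"
  proof -
    have "8 * a^3 * y^3 = (2 * a * y) * (4 * a^2 * y^2)" by Groebner_Basis.algebra
    moreover have "2 * a * y \<noteq> 0" using nz y by simp
    ultimately show ?thesis by (metis mult_divide_mult_cancel_left)
  qed
  finally show ?thesis unfolding DMN .
qed

lemma legendre_double:
  assumes L: "legendre_point x y \<in> L" and y: "y \<noteq> 0"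
  defines "w \<equiv> vector [x, y, 1] :: 'k^3"
  shows "legendre_plus (d / a) (legendre_point x y) (legendre_point x y) =
    legendre_point ((phi_D w)^2 / (4 * a^2 * y^2)) (- (phi_M w * phi_N w * phi_D w) / (8 * a^3 * y^3))"
proof -
  \<comment> \<open>The derivative of \<open>x * (x - 1) * (a * x - d)\<close>; the tangent slope is
    \<open>m / (2 * a * y)\<close>.\<close>
  define m where "m = 3 * a * x^2 - 2 * (a + d) * x + d"
  define q where "q = 1 + d / a"
  define s where "s = (3 * x^2 - 2 * q * x + d / a) / (2 * y)"
  let ?x = "(phi_D w)^2 / (4 * a^2 * y^2)"
  have e: "a * y^2 = x * (x - 1) * (a * x - d)" using L by (simp add: legendre_point_in_L)
  \<comment> \<open>Since 2 is nonzero, the sum falls into the tangent branch of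
    \<open>legendre_plus\<close>.\<close>
  have yy: "y \<noteq> - y" using y nz(1) by (metis add.left_inverse mult_2 mult_eq_0_iff)
  have aq: "a * q = a + d" and al: "a * (d / a) = d" using nz by (simp_all add: q_def field_simps)
  have "s * (2 * a * y) = a * (3 * x^2 - 2 * q * x + d / a)" using nz y by (simp add: s_def)
  also have "\<dots> = m" unfolding m_def using aq al by Groebner_Basis.algebra
  finally have sm: "s * (2 * a * y) = m" .
  have z4: "4 * a^2 * y^2 \<noteq> 0" using nz nz4 y by simp
  have z8: "8 * a^3 * y^3 \<noteq> 0" using nz nz8 y by simp
  have "(s^2 + q - x - x) * (4 * a^2 * y^2) = (s * (2 * a * y))^2 + 4 * (a * q) * (a * y^2) - 8 * a * x * (a * y^2)"
    by Groebner_Basis.algebra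
  also have "\<dots> = (phi_D w)^2"
    unfolding sm aq e m_def phi_DMN w_def vector_3 power_one mult_1_right by Groebner_Basis.algebra
  finally have x3: "s^2 + q - x - x = ?x" using z4 by (simp add: eq_divide_eq)
  have xD: "?x * (4 * a^2 * y^2) = (phi_D w)^2" using z4 by simp
  have "(s * (x - ?x) - y) * (8 * a^3 * y^3) =
      s * (2 * a * y) * (4 * a * x * (a * y^2) - ?x * (4 * a^2 * y^2)) - 8 * a * (a * y^2)^2"
    by Groebner_Basis.algebra
  also have "\<dots> = - (phi_M w * phi_N w * phi_D w)"
    unfolding sm xD e unfolding m_def phi_DMN w_def vector_3 power_one mult_1_right by Groebner_Basis.algebra
  finally have y3: "s * (x - ?x) - y = - (phi_M w * phi_N w * phi_D w) / (8 * a^3 * y^3)"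
    unfolding nonzero_eq_divide_eq[OF z8] .
  have "legendre_plus (d / a) (legendre_point x y) (legendre_point x y) =
      legendre_point (s^2 + q - x - x) (s * (x - (s^2 + q - x - x)) - y)"
    using yy by (simp add: legendre_plus_def Let_def s_def q_def)
  then show ?thesis unfolding x3 y3 .
qed

lemma psi_phi_double:
  assumes Q: "Q \<in> L"
  shows "psi (phi Q) = legendre_plus (d / a) Q Q"
  using Q
proof (cases rule: L_cases)
  case 1
  then show ?thesis
    by (simp add: phi_origin psi_edwards_point_0[OF origin_in_E] legendre_plus_def)
next
  case (2 x y)
  note L = Q[unfolded 2(1)]
  show ?thesis
  proof (cases "y = 0")
    case False
    show ?thesis unfolding 2(1) psi_phi_legendre_point[OF L False] legendre_double[OF L False] ..
  next
    \<comment> \<open>At a 2-torsion point \<open>phi\<close> lands on \<open>(0, 1)\<close> or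
      \<open>(0, -1)\<close>, and \<open>psi\<close> sends both to the origin.\<close>
    case True
    let ?w = "vector [x, y, 1] :: 'k^3"
    note p = phi_legendre_point[OF L]
    have v: "phi_vec ?w = vector [0, phi_M ?w * phi_D ?w, phi_N ?w * phi_D ?w, 0]"
      using True by (simp add: phi_vec_def)
    have "(phi_M ?w * phi_D ?w)^2 = (phi_N ?w * phi_D ?w)^2"
      using p(3) unfolding v edwards_eqs_iff by simp
    then have z: "phi_N ?w * phi_D ?w \<noteq> 0" using p(2) unfolding v by (auto simp: vec4_eq)
    have "phi Q = edwards_point 0 (phi_M ?w * phi_D ?w / (phi_N ?w * phi_D ?w))"
      unfolding 2(1) p(1) v by (subst edwards_point_scale[OF z]) simp_all
    then have "psi (phi Q) = legendre_origin" using psi_edwards_point_0 phi_in_E[OF Q] by simp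
    then show ?thesis using True unfolding 2(1) by (simp add: legendre_plus_def)
  qed
qed

section \<open>The degree\<close>

lemma form_F_cmult: "c \<in> F \<Longrightarrow> form F e f \<Longrightarrow> form F e (\<lambda>v. c * f v)"
  using form.mult[OF form.const[of c F]] by fastforce

lemma form_F_uminus: "form F e f \<Longrightarrow> form F e (\<lambda>v. - f v)"
  using form_F_cmult[OF F_uminus[OF F_one], of e f] by simp

lemma form_F_diff: "form F e f \<Longrightarrow> form F e g \<Longrightarrow> form F e (\<lambda>v. f v - g v)"
  using form.add[of F e f "\<lambda>v. - g v"] form_F_uminus[of e g] by simp

lemma form_F_mult: "form F e f \<Longrightarrow> form F e' g \<Longrightarrow> e + e' = n \<Longrightarrow> form F n (\<lambda>v. f v * g v)"
  using form.mult by blast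

lemma form_F_power: "form F e f \<Longrightarrow> n * e = m \<Longrightarrow> form F m (\<lambda>v. f v ^ n)"
proof (induction n arbitrary: m)
  case 0
  then show ?case using form.const[OF F_one] by simp
next
  case (Suc n)
  then show ?case using form.mult[of F e f "n * e" "\<lambda>v. f v ^ n"] by simp
qed

lemma F_2: "2 \<in> F" using F_add[OF F_one F_one] by simp

lemma F_diff: "x \<in> F \<Longrightarrow> y \<in> F \<Longrightarrow> x - y \<in> F"
  using F_add[OF _ F_uminus] by fastforce

lemmas form_F_intros = form_F_cmult form_F_mult form_F_power form_F_uminus form_F_diff form.add
  form.coord F_mult F_2 F_a F_d F_r F_add F_diff

lemma psi_vec_form: "form F 3 (\<lambda>v. psi_vec1 v $ i)" "form F 3 (\<lambda>v. psi_vec2 v $ i)"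
proof -
  have 1: "form F 3 (\<lambda>v::'k^4. r * v$1 * (v$3)^2)"
    "form F 3 (\<lambda>v::'k^4. - v$2 * ((v$3)^2 - d * (v$1)^2))"
    "form F 3 (\<lambda>v::'k^4. a * r * (v$1)^3)"
    by (rule refl form_F_intros | simp)+
  have 2: "form F 3 (\<lambda>v::'k^4. r * (v$2)^2 * v$4)"
    "form F 3 (\<lambda>v::'k^4. - v$3 * ((v$2)^2 - a * (v$4)^2))"
    "form F 3 (\<lambda>v::'k^4. a * r * (v$4)^3)"
    by (rule refl form_F_intros | simp)+
  consider "i = 1" | "i = 2" | "i = 3" using exhaust_3 by blast
  then show "form F 3 (\<lambda>v. psi_vec1 v $ i)" "form F 3 (\<lambda>v. psi_vec2 v $ i)"
    by (cases; simp only: psi_vec1_def psi_vec2_def vector_3 1 2)+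
qed

lemma phi_vec_form: "form F 4 (\<lambda>w. phi_vec w $ i)" "form F 4 (\<lambda>w. phi_vec2 w $ i)"
proof -
  have "form F 2 phi_D" "form F 2 phi_M" "form F 2 phi_N"
    unfolding phi_DMN[abs_def] by (rule refl form_F_intros | simp)+
  then have 1: "form F 4 (\<lambda>w. phi_M w * phi_D w)" "form F 4 (\<lambda>w. phi_N w * phi_D w)"
    "form F 4 (\<lambda>w. 2 * r * w$2 * w$3 * phi_N w)" "form F 4 (\<lambda>w. 2 * r * w$2 * w$3 * phi_M w)"
    by - (assumption | rule refl form_F_intros | simp)+
  let ?D = "\<lambda>w::'k^3. 2 * d * w$1 * w$3 - (a + d) * (w$1)^2 - a * (w$2)^2"
  let ?M = "\<lambda>w::'k^3. a * (w$2)^2 - (a - d) * (w$1)^2"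
  let ?N = "\<lambda>w::'k^3. a * (w$2)^2 + (a - d) * (w$1)^2"
  have "form F 2 ?D" "form F 2 ?M" "form F 2 ?N" by (rule refl form_F_intros | simp)+
  moreover have "form F 2 (\<lambda>w::'k^3. 2 * r * w$1 * w$2)" by (rule refl form_F_intros | simp)+
  ultimately have 2: "form F 4 (\<lambda>w. ?M w * ?D w)" "form F 4 (\<lambda>w. ?N w * ?D w)"
    "form F 4 (\<lambda>w. 2 * r * w$1 * w$2 * ?N w)" "form F 4 (\<lambda>w. 2 * r * w$1 * w$2 * ?M w)"
    using form_F_mult[where e = 2 and e' = 2 and n = 4] by simp_all
  have i: "i = 1 \<or> i = 2 \<or> i = 3 \<or> i = 4" by (rule exhaust_4)
  then show "form F 4 (\<lambda>w. phi_vec w $ i)"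
    by (elim disjE) (simp_all only: phi_vec_def vector_4 1)
  from i show "form F 4 (\<lambda>w. phi_vec2 w $ i)"
    by (elim disjE) (simp_all only: phi_vec2_def Let_def vector_4 2)
qed

lemma psi_regular: "regular_map F E L psi"
  unfolding regular_map_def
proof (intro conjI ballI)
  show "psi ` E \<subseteq> L" using psi_in_L by blast
  fix P assume P: "P \<in> E"
  obtain v where v: "v \<in> P" using E_ex P by blast
  note D = E_D[OF P v]
  have sc: "\<exists>c. c \<noteq> 0 \<and> w = c *s v" if "w \<in> P" for w
    using that D(1) mem_proj_point by blast
  show "\<exists>e G. (\<forall>i. form F e (\<lambda>v. G v $ i)) \<and> (\<forall>v\<in>P. G v \<noteq> 0) \<and>
      (\<forall>Q\<in>E. \<forall>v\<in>Q. G v \<noteq> 0 \<longrightarrow> psi Q = proj_point (G v))"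
  proof (cases "psi_vec1 v = 0")
    case False
    then have "\<forall>w\<in>P. psi_vec1 w \<noteq> 0" using sc psi_vec1_scale by fastforce
    then show ?thesis using psi_vec_form(1) psi_eq(1)
      by (intro exI[of _ 3] exI[of _ psi_vec1]) blast
  next
    case True
    then have "\<forall>w\<in>P. psi_vec2 w \<noteq> 0" using sc psi_vec2_scale psi_vec_nz[OF D(3,2)] by fastforce
    then show ?thesis using psi_vec_form(2) psi_eq(2)
      by (intro exI[of _ 3] exI[of _ psi_vec2]) blast
  qed
qed

lemma phi_vec2_nz:
  assumes "Q \<in> L" "w \<in> Q" "phi_vec w = 0"
  shows "phi_vec2 w \<noteq> 0"
proof -
  note D = L_D[OF assms(1,2)]
  have z: "w$3 = 0" using phi_vec_nz[OF _ D(3)] assms(3) by blast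
  then have x: "w$1 = 0" using D(3) by simp
  then have "w$2 \<noteq> 0" using D(2) z by (simp add: vec3_eq)
  then show ?thesis using x nz by (simp add: phi_vec2_def Let_def vec4_eq)
qed

lemma phi_regular: "regular_map F L E phi"
  unfolding regular_map_def
proof (intro conjI ballI)
  show "phi ` L \<subseteq> E" using phi_in_E by blast
  fix Q assume Q: "Q \<in> L"
  obtain w where w: "w \<in> Q"
    using Q proj_point_self unfolding legendre_curve_def elliptic_curve.select_convs by blast
  note D = L_D[OF Q w]
  have sc: "\<exists>c. c \<noteq> 0 \<and> u = c *s w" if "u \<in> Q" for u
    using that D(1) mem_proj_point by blast
  show "\<exists>e G. (\<forall>i. form F e (\<lambda>v. G v $ i)) \<and> (\<forall>v\<in>Q. G v \<noteq> 0) \<and>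
      (\<forall>Q\<in>L. \<forall>v\<in>Q. G v \<noteq> 0 \<longrightarrow> phi Q = proj_point (G v))"
  proof (cases "phi_vec w = 0")
    case False
    then have "\<forall>u\<in>Q. phi_vec u \<noteq> 0" using sc phi_vec_scale by fastforce
    then show ?thesis using phi_vec_form(1) phi_eq(1)
      by (intro exI[of _ 4] exI[of _ phi_vec]) blast
  next
    case True
    then have "\<forall>u\<in>Q. phi_vec2 u \<noteq> 0" using sc phi_vec2_scale phi_vec2_nz[OF Q w] by fastforce
    then show ?thesis using phi_vec_form(2) phi_eq(2)
      by (intro exI[of _ 4] exI[of _ phi_vec2]) blast
  qed
qed

section \<open>Surjectivity of psi\<close>

lemma psi_surj:
  assumes Q: "Q \<in> L"
  shows "\<exists>P\<in>E. psi P = Q"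
  using Q
proof (cases rule: L_cases)
  case 1
  then show ?thesis using psi_edwards_point_0[OF origin_in_E] origin_in_E by blast
next
  case (2 x y)
  show ?thesis
  proof (cases "x = 1")
    case True
    then have y: "y = 0" using 2(2) nz by simp
    \<comment> \<open>Preimages of \<open>(1, 0)\<close> have fourth coordinate zero, so
      \<open>psi_vec2\<close> cannot be used for them.\<close>
    have "edwards_point (1 / r) 0 \<in> E" using r0 nz by (simp add: edwards_point_in_E power_divide rr)
    moreover from this have "psi (edwards_point (1 / r) 0) = Q"
      using r0 nz True y 2(1) by (simp add: psi_edwards_point power_divide rr)
    ultimately show ?thesis by blast
  next
    case x1: False
    obtain v :: "'k^4" where v: "edwards_eqs a d v" "psi_vec2 v = vector [a * r * x, a * r * y, a * r]"
    proof (cases "x = 0")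
      case True
      then have y: "y = 0" using 2(2) nz by simp
      \<comment> \<open>The preimage of \<open>(0, 0)\<close> lies at infinity: its third coordinate
        is zero.\<close>
      obtain s where s: "s^2 = d / a" using nth_root_exists[of 2] by fastforce
      have "edwards_eqs a d (vector [s, 0, 0, 1])" using s nz by (simp add: edwards_eqs_iff)
      moreover have "psi_vec2 (vector [s, 0, 0, 1]) = vector [a * r * x, a * r * y, a * r]"
        using True y by (simp add: psi_vec2_def)
      ultimately show ?thesis by (rule that)
    next
      case False
      \<comment> \<open>Normalize \<open>v$4 = 1\<close> and compare \<open>psi_vec2 v\<close> with
        \<open>a * r\<close> times \<open>(x, y, 1)\<close>: this dictates
        \<open>(v$2)^2 = a * x\<close> and \<open>v$3 = - r * y / (x - 1)\<close>, and then
        \<open>v$1 = v$3 / v$2\<close>.\<close>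
      obtain s where s: "s^2 = a * x" using nth_root_exists[of 2] by fastforce
      have s0: "s \<noteq> 0" using s False nz by auto
      define z where "z = - r * y / (x - 1)"
      have zx: "z * (x - 1) = - r * y" using x1 by (simp add: z_def)
      have "(x - 1) * (z^2 * (x - 1)) = (x - 1) * (x * (a * x - d))"
      proof -
        have "(x - 1) * (z^2 * (x - 1)) = (z * (x - 1))^2" by Groebner_Basis.algebra
        also have "\<dots> = r^2 * y^2" unfolding zx by Groebner_Basis.algebra
        also have "\<dots> = (x - 1) * (x * (a * x - d))" unfolding rr 2(2) by Groebner_Basis.algebra
        finally show ?thesis .
      qed
      then have z2: "z^2 * (x - 1) = x * (a * x - d)" using x1 by simp
      have "x * (a * (z / s)^2 + s^2) = x * (z^2 + d)"
      proof -
        have "x * (a * (z / s)^2) = z^2" using s0 s False nz by (simp add: power_divide)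
        then show ?thesis unfolding s using z2 by Groebner_Basis.algebra
      qed
      then have "edwards_eqs a d (vector [z / s, s, z, 1])"
        using False s0 by (simp add: edwards_eqs_iff)
      moreover have "psi_vec2 (vector [z / s, s, z, 1]) = vector [a * r * x, a * r * y, a * r]"
        unfolding psi_vec2_def vector_4 s power_one mult_1_right vec3_eq vector_3
        using zx by (intro conjI) (Groebner_Basis.algebra+, rule refl)
      ultimately show ?thesis by (rule that)
    qed
    have ar: "a * r \<noteq> 0" using nz r0 by simp
    then have n: "psi_vec2 v \<noteq> 0" unfolding v(2) by (simp add: vec3_eq)
    then have "v \<noteq> 0" by (auto simp: psi_vec2_def vec3_eq)
    then have P: "proj_point v \<in> E" using v(1) E_I by blast
    have "psi (proj_point v) = proj_point (psi_vec2 v)" by (rule psi_eq(2)[OF P _ n]) simp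
    also have "\<dots> = Q" unfolding v(2) legendre_point_scale[OF ar] 2(1) using nz r0 by simp
    finally show ?thesis using P by blast
  qed
qed

text \<open>By surjectivity the exceptional set on \<open>L\<close> lies in the image of the
  exceptional set on \<open>E\<close>. This is how functions on \<open>L\<close> are shown to be
  zero, or nonzero, almost everywhere.\<close>

lemma eventually_psi:
  assumes "\<forall>\<^sub>F P in cofin E. \<phi> (psi P)"
  shows "\<forall>\<^sub>F Q in cofin L. \<phi> Q"
proof -
  have "{Q \<in> L. \<not> \<phi> Q} \<subseteq> psi ` {P \<in> E. \<not> \<phi> (psi P)}" using psi_surj by blast
  then show ?thesis using assms finite_surj unfolding eventually_cofin by blast
qed

section \<open>Translation by the kernel point (0, -1)\<close>

definition flip :: "'k^4 \<Rightarrow> 'k^4"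
  where "flip v = vector [- v$1, - v$2, v$3, v$4]"

text \<open>Not the group inverse, which is \<open>(- x, y)\<close>, but addition of
  \<open>(0, -1)\<close>. Taking the image of the whole set of representatives avoids a
  choice.\<close>

definition neg :: "('k^4) set \<Rightarrow> ('k^4) set"
  where "neg P = flip ` P"

lemma neg_proj_point: "neg (proj_point v) = proj_point (flip v)"
proof -
  have im: "proj_point w = (\<lambda>c. c *s w) ` {c. c \<noteq> 0}" for w :: "'k^4"
    unfolding proj_point_def by blast
  have "flip (c *s v) = c *s flip v" for c by (simp add: flip_def vec4_eq)
  then show ?thesis unfolding neg_def im image_image by simp
qed

lemma neg_neg: "neg (neg P) = P"
proof -
  have "flip (flip v) = v" for v by (simp add: flip_def vec4_eq)
  then show ?thesis by (simp add: neg_def image_image)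
qed

lemma neg_in_E: assumes "P \<in> E" shows "neg P \<in> E"
proof -
  obtain v where v: "v \<in> P" using E_ex assms by blast
  note D = E_D[OF assms v]
  have "flip v \<noteq> 0" "edwards_eqs a d (flip v)"
    using D(2,3) by (auto simp: flip_def vec4_eq edwards_eqs_iff)
  then show ?thesis unfolding D(1) neg_proj_point by (rule E_I)
qed

lemma neg_edwards_point: "neg (edwards_point x y) = edwards_point (- x) (- y)"
  unfolding edwards_point_def neg_proj_point by (simp add: flip_def)

lemma eventually_neg:
  assumes "\<forall>\<^sub>F P in cofin E. \<phi> P"
  shows "\<forall>\<^sub>F P in cofin E. \<phi> (neg P)"
proof -
  have "{P \<in> E. \<not> \<phi> (neg P)} \<subseteq> neg ` {P \<in> E. \<not> \<phi> P}"
  proof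
    fix P assume P: "P \<in> {P \<in> E. \<not> \<phi> (neg P)}"
    have "P = neg (neg P)" by (rule neg_neg[symmetric])
    then show "P \<in> neg ` {P \<in> E. \<not> \<phi> P}" using P neg_in_E by blast
  qed
  then show ?thesis using assms finite_surj unfolding eventually_cofin by blast
qed

lemma eventually_z: "\<forall>\<^sub>F P in cofin E. \<forall>v\<in>P. v$3 \<noteq> 0"
  and eventually_t: "\<forall>\<^sub>F P in cofin E. \<forall>v\<in>P. v$4 \<noteq> 0"
proof -
  have "chart_params d 3 4 1 d" "chart_params d 4 3 d 1" by (auto simp: chart_params_def[OF nz])
  from this[THEN finite_coord_zero[OF nz]]
  show "\<forall>\<^sub>F P in cofin E. \<forall>v\<in>P. v$3 \<noteq> 0" "\<forall>\<^sub>F P in cofin E. \<forall>v\<in>P. v$4 \<noteq> 0"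
    unfolding eventually_cofin by simp_all
qed

abbreviation "xc \<equiv> ratio (1::4) 3 :: ('k^4) set \<Rightarrow> 'k"
abbreviation "yc \<equiv> ratio (2::4) 3 :: ('k^4) set \<Rightarrow> 'k"

text \<open>Nonzero third and fourth coordinates suffice: their product is \<open>v$1 * v$2\<close>,
  so \<open>x\<close> is nonzero, and \<open>E_factor_nz\<close> gives the last condition.\<close>

lemma eventually_affine:
  "\<forall>\<^sub>F P in cofin E. P \<in> E \<and> (\<exists>x y. P = edwards_point x y \<and> x \<noteq> 0 \<and> 1 - d * x^2 \<noteq> 0)"
  using eventually_z eventually_t eventually_cofin_in
proof eventually_elim
  case (elim P)
  obtain v where v: "v \<in> P" using E_ex elim(3) by blast
  note D = E_D[OF elim(3) v]
  have nz': "v$3 \<noteq> 0" "v$4 \<noteq> 0" and xy: "v$1 * v$2 = v$3 * v$4"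
    using elim(1,2) v D(3) by (auto simp: edwards_eqs_iff)
  then have x: "v$1 \<noteq> 0" by auto
  have v': "vector [v$1, v$2, v$3, v$4] = v" by (simp add: vec4_eq)
  have P: "P = edwards_point (v$1 / v$3) (v$2 / v$3)"
    using edwards_point_scale[OF nz'(1) xy] D(1) unfolding v' by simp
  have "1 - d * (v$1 / v$3)^2 = ((v$3)^2 - d * (v$1)^2) / (v$3)^2"
    using nz' by (simp add: field_simps)
  then have "1 - d * (v$1 / v$3)^2 \<noteq> 0" using E_factor_nz(1)[OF D(3) nz'(1)] nz' by simp
  moreover have "v$1 / v$3 \<noteq> 0" using x nz' by simp
  ultimately show ?case using elim(3) P by blast
qed

lemma rational_xc: "rational_function F E xc"
  using rational_function_ratio[OF E_D(1) eventually_z] .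

lemma rational_L: "rational_function F L (ratio i 3)"
proof (rule rational_function_ratio[OF L_D(1)])
  have "{Q \<in> L. \<not> (\<forall>w\<in>Q. w$3 \<noteq> 0)} \<subseteq> {legendre_origin}"
  proof
    fix Q assume "Q \<in> {Q \<in> L. \<not> (\<forall>w\<in>Q. w$3 \<noteq> 0)}"
    then obtain w where w: "Q \<in> L" "w \<in> Q" "w$3 = 0" by blast
    note D = L_D[OF w(1,2)]
    have "w$1 = 0" using D(3) w(3) by simp
    then have "proj_point w = legendre_origin" unfolding legendre_origin_def
      using D(2) w(3) by (intro proj_point_eqI[of "w$2"]) (auto simp: vec3_eq)
    then show "Q \<in> {legendre_origin}" using D(1) by simp
  qed
  then show "\<forall>\<^sub>F Q in cofin L. \<forall>w\<in>Q. w$3 \<noteq> 0"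
    unfolding eventually_cofin using finite_subset by blast
qed

lemmas rational_intros = rational_function_add rational_function_mult rational_function_const[OF F_one]
  rational_L

section \<open>The span of 1 and x over the functions on the Legendre curve\<close>

definition spanned :: "(('k^4) set \<Rightarrow> 'k) \<Rightarrow> bool"
  where "spanned g \<longleftrightarrow> (\<exists>h0 h1. rational_function F L h0 \<and> rational_function F L h1 \<and>
    (\<forall>\<^sub>F P in cofin E. g P = h0 (psi P) + h1 (psi P) * xc P))"

lemma F_0: "0 \<in> F" using F_diff[OF F_one F_one] by simp

lemma eventually_psi_xc:
  "\<forall>\<^sub>F P in cofin E. ratio 1 3 (psi P) = inverse (a * (xc P)^2)"
  using eventually_affine
proof eventually_elim
  case (elim P)
  then obtain x y where "P = edwards_point x y" "x \<noteq> 0" "edwards_point x y \<in> E" by blast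
  then show ?case by (simp add: psi_edwards_point inverse_eq_divide)
qed

lemma eventually_u: "\<forall>\<^sub>F Q in cofin L. a * ratio 1 3 Q \<noteq> 0"
proof (rule eventually_psi)
  show "\<forall>\<^sub>F P in cofin E. a * ratio 1 3 (psi P) \<noteq> 0"
    using eventually_psi_xc eventually_affine
  proof eventually_elim
    case (elim P)
    then have "xc P \<noteq> 0" by auto
    then show ?case using elim(1) nz by simp
  qed
qed

lemma eventually_xc_sq: "\<forall>\<^sub>F P in cofin E. (xc P)^2 = inverse (a * ratio 1 3 (psi P))"
  using eventually_psi_xc by eventually_elim (use nz in simp)

lemma spanned_cong: "spanned g \<Longrightarrow> \<forall>\<^sub>F P in cofin E. f P = g P \<Longrightarrow> spanned f"
  unfolding spanned_def by (force elim: eventually_elim2)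

lemma spanned_const: "c \<in> F \<Longrightarrow> spanned (\<lambda>_. c)"
  unfolding spanned_def
  by (rule exI[of _ "\<lambda>_. c"], rule exI[of _ "\<lambda>_. 0"]) (simp add: rational_intros F_0)

lemma spanned_xc: "spanned xc"
  unfolding spanned_def
  by (rule exI[of _ "\<lambda>_. 0"], rule exI[of _ "\<lambda>_. 1"]) (simp add: rational_intros F_0 F_one)

lemma spanned_yc: "spanned yc"
proof -
  \<comment> \<open>The affine formula for \<open>psi\<close> solved for \<open>y\<close>. The form
    \<open>+ - d\<close> suits the closure rules, which treat sums and products but no
    differences.\<close>
  have ev: "\<forall>\<^sub>F P in cofin E. a * ratio 1 3 (psi P) + - d \<noteq> 0 \<and>
    yc P = (- (r * a)) * ratio 2 3 (psi P) * inverse (a * ratio 1 3 (psi P) + - d) * xc P"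
    using eventually_affine
  proof eventually_elim
    case (elim P)
    then obtain x y where e: "P = edwards_point x y" and x: "x \<noteq> 0" and k: "1 - d * x^2 \<noteq> 0"
      and P: "edwards_point x y \<in> E" by blast
    have u: "a * ratio 1 3 (psi P) + - d = (1 - d * x^2) / x^2"
      and v: "(- (r * a)) * ratio 2 3 (psi P) = y * (1 - d * x^2) / x^3"
      unfolding e psi_edwards_point[OF P x] ratio_legendre_point using x nz r0
      by (simp_all add: field_simps)
    have "y * (1 - d * x^2) / x^3 * inverse ((1 - d * x^2) / x^2) * x = y"
      using x k by (simp add: power2_eq_square power3_eq_cube)
    then show ?case unfolding u v using x k e by simp
  qed
  have nz': "\<forall>\<^sub>F Q in cofin L. a * ratio 1 3 Q + - d \<noteq> 0"
    by (rule eventually_psi) (use ev in \<open>eventually_elim, simp\<close>)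
  show ?thesis unfolding spanned_def
  proof (rule exI[of _ "\<lambda>_. 0"],
      rule exI[of _ "\<lambda>Q. (- (r * a)) * ratio 2 3 Q * inverse (a * ratio 1 3 Q + - d)"], intro conjI)
    show "rational_function F L (\<lambda>Q. (- (r * a)) * ratio 2 3 Q * inverse (a * ratio 1 3 Q + - d))"
      by (intro rational_intros rational_function_inverse nz' F_uminus F_mult F_r F_a F_d)
    show "rational_function F L (\<lambda>_. 0)" by (intro rational_intros F_0)
    show "\<forall>\<^sub>F P in cofin E. yc P =
      0 + (- (r * a)) * ratio 2 3 (psi P) * inverse (a * ratio 1 3 (psi P) + - d) * xc P"
      using ev by eventually_elim simp
  qed
qed

lemma spanned_add:
  assumes "spanned f" "spanned g" shows "spanned (\<lambda>P. f P + g P)"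
proof -
  obtain f0 f1 where f: "rational_function F L f0" "rational_function F L f1"
    "\<forall>\<^sub>F P in cofin E. f P = f0 (psi P) + f1 (psi P) * xc P" using assms(1) unfolding spanned_def by blast
  obtain g0 g1 where g: "rational_function F L g0" "rational_function F L g1"
    "\<forall>\<^sub>F P in cofin E. g P = g0 (psi P) + g1 (psi P) * xc P" using assms(2) unfolding spanned_def by blast
  have "\<forall>\<^sub>F P in cofin E. f P + g P = (f0 (psi P) + g0 (psi P)) + (f1 (psi P) + g1 (psi P)) * xc P"
    using f(3) g(3) by eventually_elim (simp add: algebra_simps)
  then show ?thesis unfolding spanned_def
    using rational_function_add[OF f(1) g(1)] rational_function_add[OF f(2) g(2)] by blast
qed

lemma rational_inverse_u: "rational_function F L (\<lambda>Q. inverse (a * ratio 1 3 Q))"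
  by (intro rational_function_inverse rational_intros F_a eventually_u)

text \<open>The square of \<open>x\<close> is almost everywhere a function of \<open>psi P\<close>,
  so a product of two expressions linear in \<open>x\<close> is again linear.\<close>

lemma spanned_mult:
  assumes "spanned f" "spanned g" shows "spanned (\<lambda>P. f P * g P)"
proof -
  obtain f0 f1 where f: "rational_function F L f0" "rational_function F L f1"
    "\<forall>\<^sub>F P in cofin E. f P = f0 (psi P) + f1 (psi P) * xc P" using assms(1) unfolding spanned_def by blast
  obtain g0 g1 where g: "rational_function F L g0" "rational_function F L g1"
    "\<forall>\<^sub>F P in cofin E. g P = g0 (psi P) + g1 (psi P) * xc P" using assms(2) unfolding spanned_def by blast
  have ev: "\<forall>\<^sub>F P in cofin E. f P * g P =
    (f0 (psi P) * g0 (psi P) + f1 (psi P) * g1 (psi P) * inverse (a * ratio 1 3 (psi P))) +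
    (f0 (psi P) * g1 (psi P) + f1 (psi P) * g0 (psi P)) * xc P"
    using f(3) g(3) eventually_xc_sq
  proof eventually_elim
    case (elim P)
    show ?case unfolding elim(1,2) elim(3)[symmetric] by (simp add: algebra_simps power2_eq_square)
  qed
  have 0: "rational_function F L (\<lambda>Q. f0 Q * g0 Q + f1 Q * g1 Q * inverse (a * ratio 1 3 Q))"
    and 1: "rational_function F L (\<lambda>Q. f0 Q * g1 Q + f1 Q * g0 Q)"
    by (intro rational_intros rational_inverse_u f(1,2) g(1,2))+
  show ?thesis unfolding spanned_def
    by (intro exI conjI) (rule 0, rule 1, rule ev)
qed

text \<open>Changing both signs preserves \<open>x^2\<close> and \<open>y / x^3\<close>, hence both
  coordinates of the image.\<close>

lemma psi_neg:
  assumes P: "P \<in> E" and e: "P = edwards_point x y" and x: "x \<noteq> 0"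
  shows "psi (neg P) = psi P" "xc (neg P) = - xc P"
proof -
  have n: "neg P = edwards_point (- x) (- y)" unfolding e neg_edwards_point ..
  have P': "edwards_point (- x) (- y) \<in> E" using neg_in_E[OF P] unfolding n .
  have x': "- x \<noteq> 0" using x by simp
  show "psi (neg P) = psi P"
    unfolding n psi_edwards_point[OF P' x'] unfolding e psi_edwards_point[OF P[unfolded e] x]
    by (simp add: power3_eq_cube)
  show "xc (neg P) = - xc P" unfolding n unfolding e by simp
qed

text \<open>The norm \<open>g(P) g(neg P)\<close> of \<open>g\<close> is a function on \<open>L\<close>; here \<open>neg\<close> is translation by the
  nontrivial point of the kernel of \<open>psi\<close>.\<close>

lemma spanned_inverse:
  assumes "spanned g" and nz0: "\<forall>\<^sub>F P in cofin E. g P \<noteq> 0"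
  shows "spanned (\<lambda>P. inverse (g P))"
proof -
  obtain g0 g1 where g: "rational_function F L g0" "rational_function F L g1"
    "\<forall>\<^sub>F P in cofin E. g P = g0 (psi P) + g1 (psi P) * xc P" using assms(1) unfolding spanned_def by blast
  define m where "m Q = g0 Q * g0 Q + (- 1) * (g1 Q * g1 Q * inverse (a * ratio 1 3 Q))" for Q
  have ev: "\<forall>\<^sub>F P in cofin E. g P = g0 (psi P) + g1 (psi P) * xc P \<and>
     m (psi P) = (g0 (psi P) + g1 (psi P) * xc P) * (g0 (psi P) - g1 (psi P) * xc P) \<and> m (psi P) \<noteq> 0"
    using g(3) nz0 eventually_neg[OF g(3)] eventually_neg[OF nz0] eventually_affine eventually_xc_sq
  proof eventually_elim
    case (elim P)
    obtain x y where e: "P = edwards_point x y" and x: "x \<noteq> 0" and P: "P \<in> E"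
      using elim(5) by blast
    have "psi (neg P) = psi P" "xc (neg P) = - xc P" using psi_neg P e x by blast+
    \<comment> \<open>The conjugate factor is \<open>g (neg P)\<close>, which is nonzero for almost
      all \<open>P\<close> because \<open>neg\<close> permutes \<open>E\<close>.\<close>
    then have "g0 (psi P) - g1 (psi P) * xc P \<noteq> 0" using elim(3,4) by simp
    moreover have "m (psi P) = (g0 (psi P) + g1 (psi P) * xc P) * (g0 (psi P) - g1 (psi P) * xc P)"
      unfolding m_def elim(6)[symmetric] by (simp add: algebra_simps power2_eq_square)
    ultimately show ?case using elim(1,2) by simp
  qed
  have m: "rational_function F L m" unfolding m_def
    by (intro rational_intros rational_inverse_u g(1,2) F_uminus F_one)
  have "\<forall>\<^sub>F P in cofin E. m (psi P) \<noteq> 0" using ev by (rule eventually_mono) blast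
  then have "\<forall>\<^sub>F Q in cofin L. m Q \<noteq> 0" by (rule eventually_psi)
  note im = rational_function_inverse[OF m this]
  have ev': "\<forall>\<^sub>F P in cofin E. inverse (g P) =
    g0 (psi P) * inverse (m (psi P)) + (- 1) * (g1 (psi P) * inverse (m (psi P))) * xc P"
    using ev
  proof eventually_elim
    case (elim P)
    then have f: "g0 (psi P) + g1 (psi P) * xc P \<noteq> 0" "g0 (psi P) - g1 (psi P) * xc P \<noteq> 0" by auto
    have "inverse (g P) = (g0 (psi P) - g1 (psi P) * xc P) * inverse (m (psi P))"
      using elim f by simp
    then show ?case by (simp add: algebra_simps)
  qed
  have 0: "rational_function F L (\<lambda>Q. g0 Q * inverse (m Q))"
    and 1: "rational_function F L (\<lambda>Q. (- 1) * (g1 Q * inverse (m Q)))"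
    by (intro rational_intros im g(1,2) F_uminus F_one)+
  show ?thesis unfolding spanned_def
    by (intro exI conjI) (rule 0, rule 1, rule ev')
qed

text \<open>A form is not a function on points; division by the matching power of \<open>v$3\<close>
  makes it one and reduces the induction to the coordinate quotients \<open>x\<close>,
  \<open>y\<close>, 1 and \<open>x * y\<close>.\<close>

lemma spanned_form:
  assumes "form F e f"
  shows "\<exists>g. spanned g \<and> (\<forall>\<^sub>F P in cofin E. \<forall>v\<in>P. f v / (v$3)^e = g P)"
  using assms
proof (induction rule: form.induct)
  case (const c)
  then show ?case using spanned_const by (intro exI[of _ "\<lambda>_. c"]) simp
next
  case (coord i)
  have c: "\<forall>\<^sub>F P in cofin E. \<forall>v\<in>P. v$i / (v$3)^1 = ratio i 3 P"
    using eventually_cofin_in by eventually_elim (use ratio_proj_point E_D(1) in force)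
  have "spanned (ratio i 3)"
  proof -
    consider "i = 1" | "i = 2" | "i = 3" | "i = 4" using exhaust_4 by blast
    then show ?thesis
    proof cases
      case 3
      have "\<forall>\<^sub>F P in cofin E. ratio 3 3 P = (1::'k)"
        using eventually_z eventually_cofin_in
      proof eventually_elim
        case (elim P)
        obtain v where "v \<in> P" using E_ex elim(2) by blast
        then show ?case using elim(1) ratio_proj_point[OF E_D(1)[OF elim(2)], of v 3 3] by simp
      qed
      then show ?thesis unfolding 3 using spanned_cong[OF spanned_const[OF F_one]] by blast
    next
      case 4
      have "\<forall>\<^sub>F P in cofin E. ratio 4 3 P = xc P * yc P"
        using eventually_affine
        by eventually_elim (auto simp: ratio_proj_point[OF edwards_point_def])
      then show ?thesis unfolding 4 using spanned_cong[OF spanned_mult[OF spanned_xc spanned_yc]] by blast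
    qed (simp_all add: spanned_xc spanned_yc)
  qed
  then show ?case using c by blast
next
  case (add e f f')
  obtain g g' where "spanned g" "\<forall>\<^sub>F P in cofin E. \<forall>v\<in>P. f v / (v$3)^e = g P"
    "spanned g'" "\<forall>\<^sub>F P in cofin E. \<forall>v\<in>P. f' v / (v$3)^e = g' P" using add.IH by blast
  moreover from this(2,4) have "\<forall>\<^sub>F P in cofin E. \<forall>v\<in>P. (f v + f' v) / (v$3)^e = g P + g' P"
    by eventually_elim (simp add: add_divide_distrib)
  ultimately show ?case using spanned_add by blast
next
  case (mult e f e' f')
  obtain g g' where "spanned g" "\<forall>\<^sub>F P in cofin E. \<forall>v\<in>P. f v / (v$3)^e = g P"
    "spanned g'" "\<forall>\<^sub>F P in cofin E. \<forall>v\<in>P. f' v / (v$3)^e' = g' P" using mult.IH by blast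
  moreover from this(2,4) have "\<forall>\<^sub>F P in cofin E. \<forall>v\<in>P. (f v * f' v) / (v$3)^(e + e') = g P * g' P"
    by eventually_elim (simp add: power_add flip: times_divide_times_eq)
  ultimately show ?case using spanned_mult by blast
qed

lemma spanned_rational:
  assumes "rational_function F E g"
  shows "spanned g"
proof -
  obtain e N D where 1: "form F e N" "form F e D" "\<forall>\<^sub>F P in cofin E. \<forall>v\<in>P. D v \<noteq> 0"
    "\<forall>P\<in>E. \<forall>v\<in>P. D v \<noteq> 0 \<longrightarrow> g P = N v / D v" using assms unfolding rational_function_iff by blast
  obtain n where n: "spanned n" "\<forall>\<^sub>F P in cofin E. \<forall>v\<in>P. N v / (v$3)^e = n P"
    using spanned_form[OF 1(1)] by blast
  obtain m where m: "spanned m" "\<forall>\<^sub>F P in cofin E. \<forall>v\<in>P. D v / (v$3)^e = m P"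
    using spanned_form[OF 1(2)] by blast
  have ev: "\<forall>\<^sub>F P in cofin E. m P \<noteq> 0 \<and> g P = n P * inverse (m P)"
    using 1(3) n(2) m(2) eventually_z eventually_cofin_in
  proof eventually_elim
    case (elim P)
    obtain v where v: "v \<in> P" using E_ex elim(5) by blast
    have "n P = N v / (v$3)^e" "m P = D v / (v$3)^e" "D v \<noteq> 0" "v$3 \<noteq> 0" "g P = N v / D v"
      using elim v 1(4) by auto
    then show ?case by simp
  qed
  have "\<forall>\<^sub>F P in cofin E. m P \<noteq> 0" using ev by eventually_elim simp
  note s = spanned_mult[OF n(1) spanned_inverse[OF m(1) this]]
  have "\<forall>\<^sub>F P in cofin E. g P = n P * inverse (m P)" using ev by eventually_elim simp
  then show ?thesis by (rule spanned_cong[OF s])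
qed

lemma psi_degree: "map_degree F E L psi 2"
proof -
  let ?b = "\<lambda>i::nat. if i = 0 then (\<lambda>_. 1) else xc"
  have sum2: "(\<Sum>i<2. h i (psi P) * ?b i P) = h 0 (psi P) + h 1 (psi P) * xc P"
    for h :: "nat \<Rightarrow> ('k^3) set \<Rightarrow> 'k" and P by (simp add: numeral_2_eq_2)
  have "\<exists>h. (\<forall>i<2. rational_function F L (h i)) \<and>
      same_rational_function E g (\<lambda>P. \<Sum>i<2. h i (psi P) * ?b i P)"
    if g: "rational_function F E g" for g
  proof -
    obtain h0 h1 where h: "rational_function F L h0" "rational_function F L h1"
      "\<forall>\<^sub>F P in cofin E. g P = h0 (psi P) + h1 (psi P) * xc P"
      using spanned_rational[OF g] unfolding spanned_def by blast
    let ?h = "\<lambda>i::nat. if i = 0 then h0 else h1"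
    have "same_rational_function E g (\<lambda>P. \<Sum>i<2. ?h i (psi P) * ?b i P)"
      unfolding sum2[of ?h] same_rational_function_iff using h(3) by simp
    moreover have "\<forall>i<2. rational_function F L (?h i)" using h(1,2) by simp
    ultimately show ?thesis by (intro exI[of _ ?h]) blast
  qed
  moreover have "\<forall>i<2. same_rational_function L (h i) (\<lambda>_. 0)"
    if "same_rational_function E (\<lambda>P. \<Sum>i<2. h i (psi P) * ?b i P) (\<lambda>_. 0)" for h
  proof -
    have "\<forall>\<^sub>F P in cofin E. h 0 (psi P) + h 1 (psi P) * xc P = 0"
      using that unfolding sum2 same_rational_function_iff .
    \<comment> \<open>At \<open>P\<close> and at \<open>neg P\<close> the relation reads
      \<open>h0 + h1 * x = 0\<close> and \<open>h0 - h1 * x = 0\<close>; since 2 and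
      \<open>x\<close> are nonzero, both coefficients vanish.\<close>
    note ev = this eventually_neg[OF this]
    have "\<forall>\<^sub>F P in cofin E. h 0 (psi P) = 0 \<and> h 1 (psi P) = 0"
      using ev eventually_affine
    proof eventually_elim
      case (elim P)
      obtain x y where e: "P = edwards_point x y" and x: "x \<noteq> 0" and P: "P \<in> E"
        using elim(3) by blast
      have n: "psi (neg P) = psi P" "xc (neg P) = - xc P" using psi_neg[OF P e x] by blast+
      have "xc P \<noteq> 0" unfolding e using x by simp
      moreover have "2 * h 0 (psi P) = 0" "2 * (h 1 (psi P) * xc P) = 0"
        using elim(1,2) unfolding n by Groebner_Basis.algebra+
      ultimately show ?case using nz(1) by simp
    qed
    then have "\<forall>\<^sub>F Q in cofin L. h 0 Q = 0 \<and> h 1 Q = 0" by (rule eventually_psi)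
    then have "\<forall>\<^sub>F Q in cofin L. h 0 Q = 0" "\<forall>\<^sub>F Q in cofin L. h 1 Q = 0"
      by (auto elim: eventually_mono)
    then show ?thesis unfolding same_rational_function_iff by (simp add: less_2_cases_iff)
  qed
  moreover have "\<forall>i<2. rational_function F E (?b i)"
    by (simp add: rational_xc rational_function_const F_one)
  ultimately show ?thesis unfolding map_degree_def by (intro exI[of _ ?b]) blast
qed

section \<open>The isogenies and their duality\<close>

lemma edwards_curve_simps [simp]:
  "points (edwards_curve a d) = E" "origin (edwards_curve a d) = edwards_point 0 1"
  "plus (edwards_curve a d) = edwards_plus a d"
  by (simp_all add: edwards_curve_def)

lemma legendre_curve_simps [simp]:
  "origin (legendre_curve l) = legendre_origin" "plus (legendre_curve l) = legendre_plus l"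
  by (simp_all add: legendre_curve_def)

lemma isogeny_psi: "isogeny F (edwards_curve a d) (legendre_curve (d / a)) psi"
proof -
  \<comment> \<open>A point with \<open>x\<close> nonzero has an affine image, so \<open>psi\<close>
    is not constant.\<close>
  have P: "edwards_point (1 / r) 0 \<in> E"
    using r0 nz by (simp add: edwards_point_in_E power_divide rr)
  have "psi (edwards_point (1 / r) 0) \<noteq> legendre_origin"
    using psi_edwards_point[OF P] r0 by simp
  then show ?thesis unfolding isogeny_def
    using P psi_regular psi_edwards_point_0[OF origin_in_E] by auto
qed

lemma isogeny_phi: "isogeny F (legendre_curve (d / a)) (edwards_curve a d) phi"
proof -
  \<comment> \<open>This point is sent to \<open>(0, -1)\<close>, which differs from the origin
    because 2 is nonzero.\<close>
  have Q: "legendre_point 1 0 \<in> L" by (simp add: legendre_point_in_L)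
  have "phi_vec (vector [1, 0, 1]) = (d - a)^2 *s vector [0, 1, - 1, 0]"
    by (simp add: phi_vec_def phi_DMN vec4_eq power2_eq_square algebra_simps)
  then have "phi (legendre_point 1 0) = proj_point (vector [0, 1, - 1, 0])"
    using phi_legendre_point(1)[OF Q] nz by (simp add: proj_point_scale)
  also have "\<dots> = edwards_point (0 / - 1) (1 / - 1)" by (rule edwards_point_scale) simp_all
  finally have "yc (phi (legendre_point 1 0)) = - 1" by simp
  moreover have "yc (edwards_point 0 1) \<noteq> - 1" using nz(1) by (simp add: eq_neg_iff_add_eq_0)
  ultimately have "phi (legendre_point 1 0) \<noteq> edwards_point 0 1" by metis
  then show ?thesis unfolding isogeny_def using Q phi_regular phi_origin by auto
qed

text \<open>\<open>multiple\<close> iterates from the origin, so an inner sum with the origin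
  remains, to be removed by \<open>edwards_plus_origin\<close> and
  \<open>legendre_plus_origin\<close>.\<close>

lemma multiple_2: "multiple C 2 P = plus C P (plus C P (origin C))"
  by (simp add: multiple_def numeral_2_eq_2)

lemma legendre_plus_origin: "legendre_plus l Q legendre_origin = Q"
  by (simp add: legendre_plus_def)

lemma psi_degree_2:
  "isogeny_of_degree F (edwards_curve a d) (legendre_curve (d / a)) psi 2"
  unfolding isogeny_of_degree_def using isogeny_psi psi_degree by simp

lemma dual_isogeny_phi:
  "dual_isogeny F (edwards_curve a d) (legendre_curve (d / a)) psi phi"
  unfolding dual_isogeny_def
proof (intro conjI exI[of _ 2] ballI)
  show "isogeny F (legendre_curve (d / a)) (edwards_curve a d) phi" by (rule isogeny_phi)
  show "isogeny_of_degree F (edwards_curve a d) (legendre_curve (d / a)) psi 2" by (rule psi_degree_2)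
  show "phi (psi P) = multiple (edwards_curve a d) 2 P" if "P \<in> points (edwards_curve a d)" for P
    using that by (simp add: multiple_2 phi_psi_double edwards_plus_origin)
  show "psi (phi Q) = multiple (legendre_curve (d / a)) 2 Q" if "Q \<in> L" for Q
    using that by (simp add: multiple_2 psi_phi_double legendre_plus_origin)
qed

end

section \<open>Specialization to the field generated by the square root of a\<close>

lemma to_ac_2_neq_0:
  assumes "CHAR('k::field) \<noteq> 2"
  shows "(2 :: 'k alg_closure) \<noteq> 0"
proof
  assume "(2 :: 'k alg_closure) = 0"
  then have "to_ac (2 :: 'k) = 0" by (simp only: to_ac_numeral)
  then have "(2 :: 'k) = 0" by (simp only: to_ac_eq_0_iff)
  then have "of_nat 2 = (0 :: 'k)" by (simp only: of_nat_numeral)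
  then have "CHAR('k) dvd 2" by (simp only: of_nat_eq_0_iff_char_dvd)
  then have "CHAR('k) = 1 \<or> CHAR('k) = 2" using two_is_prime_nat prime_nat_iff by blast
  then show False using assms by simp
qed

lemma edwards_isogeny_adjoin_sqrt:
  fixes a d :: "'k::field" and r :: "'k alg_closure"
  assumes "CHAR('k) \<noteq> 2" and "a \<noteq> 0" and "d \<noteq> 0" and "d \<noteq> a" and r: "r^2 = to_ac a"
  shows "edwards_isogeny (to_ac a) (to_ac d) r (adjoin_sqrt r)"
proof
  show "(2 :: 'k alg_closure) \<noteq> 0" using to_ac_2_neq_0 assms(1) .
  show "to_ac a \<noteq> 0" "to_ac d \<noteq> 0" "to_ac a \<noteq> to_ac d" using assms by simp_all
  show "r^2 = to_ac a" by (rule r)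
  have I: "to_ac u + to_ac v * r \<in> adjoin_sqrt r" for u v unfolding adjoin_sqrt_def by blast
  show "1 \<in> adjoin_sqrt r" "to_ac a \<in> adjoin_sqrt r" "to_ac d \<in> adjoin_sqrt r" "r \<in> adjoin_sqrt r"
    using I[of 1 0] I[of a 0] I[of d 0] I[of 0 1] by simp_all
  fix x assume "x \<in> adjoin_sqrt r"
  then obtain u v where x: "x = to_ac u + to_ac v * r" unfolding adjoin_sqrt_def by blast
  show "- x \<in> adjoin_sqrt r" using I[of "- u" "- v"] by (simp add: x)
  fix y assume "y \<in> adjoin_sqrt r"
  then obtain s t where y: "y = to_ac s + to_ac t * r" unfolding adjoin_sqrt_def by blast
  show "x + y \<in> adjoin_sqrt r" using I[of "u + s" "v + t"] by (simp add: x y algebra_simps)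
  \<comment> \<open>Only the term with \<open>r^2\<close> is not visibly in the span of 1 and
    \<open>r\<close>, and \<open>r^2\<close> is the image of \<open>a\<close>.\<close>
  have "x * y = to_ac u * to_ac s + to_ac v * to_ac t * r^2 + (to_ac u * to_ac t + to_ac v * to_ac s) * r"
    unfolding x y by Groebner_Basis.algebra
  also have "\<dots> = to_ac (u * s + v * t * a) + to_ac (u * t + v * s) * r" unfolding r by simp
  finally show "x * y \<in> adjoin_sqrt r" by (simp only: I)
qed

theorem theorem3p2:
  fixes a d :: "'k::field" and r :: "'k alg_closure"
  assumes "CHAR('k) \<noteq> 2"
    and "a \<noteq> 0" and "d \<noteq> 0" and "d \<noteq> a"
    and "r^2 = to_ac a"
  defines "a' \<equiv> to_ac a" and "d' \<equiv> to_ac d"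
  defines "E \<equiv> edwards_curve a' d'" and "L \<equiv> legendre_curve (d' / a')"
  shows "\<exists>\<psi> \<psi>'.
    (\<forall>x y. edwards_point x y \<in> points E \<longrightarrow> x \<noteq> 0 \<longrightarrow> 1 - y^2 \<noteq> 0 \<longrightarrow>
      \<psi> (edwards_point x y) =
        legendre_point (1 / (a' * x^2)) (y * (d' - a') / (a' * r * x * (1 - y^2)))) \<and>
    (\<forall>x y. legendre_point x y \<in> points L \<longrightarrow>
      d' - a' * x^2 \<noteq> 0 \<longrightarrow> a' * y^2 + x^2 * (a' - d') \<noteq> 0 \<longrightarrow>
      \<psi>' (legendre_point x y) =
        edwards_point (2 * r * y / (d' - a' * x^2))
          ((a' * y^2 - x^2 * (a' - d')) / (a' * y^2 + x^2 * (a' - d')))) \<and>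
    isogeny_of_degree (adjoin_sqrt r) E L \<psi> 2 \<and>
    dual_isogeny (adjoin_sqrt r) E L \<psi> \<psi>'"
proof -
  interpret edwards_isogeny a' d' r "adjoin_sqrt r"
    unfolding a'_def d'_def using assms(1-5) by (rule edwards_isogeny_adjoin_sqrt)
  show ?thesis
    unfolding E_def L_def
    using psi_formula phi_formula psi_degree_2 dual_isogeny_phi
    by (intro exI[of _ psi] exI[of _ phi]) simp
qed

end
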